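(* Let $k\geq 2$ be an integer and $s\in\{1,k-1,k\}$. Then \[ \sum_{\substack{n_1,\dots,n_{k-1}\geq 0 \\ m_1,\dots,m_{k-1}\geq 0}} \frac{q^{\sum_{i=1}^{k-1} (n_i^2-n_im_i+m_i^2+m_i)+ \sum_{i=s}^{k-1} n_i}}{(q)_{n_1}} \, {2n_{k-1} \brack m_{k-1}} \prod_{i=1}^{k-2} {n_i \brack n_{i+1}} {n_i-n_{i+1}+m_{i+1} \brack m_i} =\frac{(q^{3k+1};q^{3k+1})_{\infty}^2}{(q;q)_{\infty}^2}\, \theta(q,q^s,q^{s+1};q^{3k+1}). \]
   Context: Identities are between formal power series in $q$. For $n\in\mathbb{Z}$, $(a)_n=(a;q)_n:=(a;q)_\infty/(aq^n;q)_\infty$ with $(a;q)_\infty=\prod_{i\geq0}(1-aq^i)$. $\theta(a;q):=(a;q)_\infty(q/a;q)_\infty$ and $\theta(a_1,\dots,a_j;q):=\theta(a_1;q)\cdots\theta(a_j;q)$. For $n,m\in\mathbb{Z}$, ${n\brack m}=\frac{(q)_n}{(q)_m(q)_{n-m}}$ if $0\leq m\leq n$ and $0$ otherwise. Empty sums are $0$, empty products are $1$. *)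

theory Defs
  imports "HOL-Analysis.Analysis" "HOL-Computational_Algebra.Formal_Power_Series"
begin

text \<open>
  All series live in \<^typ>\<open>rat fps\<close>; the formal variable \<open>q\<close> is \<^term>\<open>fps_X :: rat fps\<close>.
  Infinite products and sums are taken in the library's metric topology on formal power series
  (coefficientwise stabilisation).
\<close>

definition qpoch_inf :: "rat fps \<Rightarrow> rat fps \<Rightarrow> rat fps" where
  "qpoch_inf a q = (\<Prod>i. 1 - a * q ^ i)"

text \<open>
  The finite symbol is needed only for indices \<open>n \<ge> 0\<close>; for \<open>n < 0\<close> the element \<open>a q\<^sup>n\<close>
  need not be a power series.
\<close>

definition qpoch :: "rat fps \<Rightarrow> rat fps \<Rightarrow> nat \<Rightarrow> rat fps" where
  "qpoch a q n = qpoch_inf a q / qpoch_inf (a * q ^ n) q"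

text \<open>
  The quotient \<open>q / a\<close> is the genuine one only if \<open>a\<close> divides \<open>q\<close> in \<^typ>\<open>rat fps\<close>,
  for instance for \<open>a\<close> and \<open>q\<close> powers of the variable, the exponent of \<open>a\<close> being at most
  that of \<open>q\<close>.
\<close>

definition theta :: "rat fps \<Rightarrow> rat fps \<Rightarrow> rat fps" where
  "theta a q = qpoch_inf a q * qpoch_inf (q / a) q"

definition thetas :: "rat fps list \<Rightarrow> rat fps \<Rightarrow> rat fps" where
  "thetas as q = (\<Prod>a\<leftarrow>as. theta a q)"

definition qbinom :: "int \<Rightarrow> int \<Rightarrow> rat fps" where
  "qbinom n m =
     (if 0 \<le> m \<and> m \<le> n
      then qpoch fps_X fps_X (nat n) / (qpoch fps_X fps_X (nat m) * qpoch fps_X fps_X (nat (n - m)))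
      else 0)"

text \<open>
  The exponent is computed in \<^typ>\<open>int\<close>; it is nonnegative, since \<open>a\<^sup>2 - a b + b\<^sup>2 \<ge> 0\<close>,
  so the conversion \<^const>\<open>nat\<close> does not truncate.
\<close>

definition summand_exponent :: "nat \<Rightarrow> nat \<Rightarrow> (nat \<Rightarrow> nat) \<Rightarrow> (nat \<Rightarrow> nat) \<Rightarrow> nat" where
  "summand_exponent k s n m =
     nat ((\<Sum>i=1..k-1. int (n i) ^ 2 - int (n i) * int (m i) + int (m i) ^ 2 + int (m i))
          + (\<Sum>i=s..k-1. int (n i)))"

end

theory Submission
  imports Defs "HOL-Computational_Algebra.Formal_Laurent_Series"
begin

text \<open>
  Peeling off the outermost pair \<open>(n\<^sub>1, m\<^sub>1)\<close> writes the multisum as \<open>k - 1\<close> applications of a linear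
  operator to the seed \<open>[2n, m] / (q)\<^sub>n\<close>. The transform
  \<open>h \<mapsto> (\<Sum>m. q\<^bsup>m(s+m+1-r)\<^esup> h(r, m) / ((q)\<^sub>s (q)\<^bsub>s+m+1-r\<^esub>))\<close> intertwines this operator with the symmetric
  \<open>A\<^sub>2\<close> Bailey operator with kernel \<open>q\<^bsup>r\<^sup>2-rs+s\<^sup>2+er+s\<^esup> / ((q)\<^bsub>L-r\<^esub> (q)\<^bsub>M-s\<^esub>)\<close>, and sends the seed to
  \<open>1 / ((q)\<^sub>r (q)\<^sub>s (q)\<^bsub>r+s+1\<^esub>)\<close>. The Bailey operator is diagonalised by the products
  \<open>(q)\<^bsub>r+s+c\<^esub> / \<Prod>\<^sub>i (q)\<^bsub>r+a\<^sub>i\<^esub> (q)\<^bsub>s+c-a\<^sub>i\<^esub>\<close>, with eigenvalue a power of \<open>q\<close> quadratic in \<open>a\<close>.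

  Expanding the seed in these eigenfunctions gives a sum over the root lattice of \<open>A\<^sub>2\<close> that alternates
  under the affine Weyl group; the expansion is proved by a recursion in \<open>r\<close> at fixed \<open>r + s\<close>, in which
  all but a few of the terms produced by the q-Pascal rule lie on walls and vanish. Letting \<open>r\<close> and
  \<open>s\<close> tend to infinity, the multisum becomes \<open>1 / (q)\<^sub>\<infinity>\<^sup>2\<close> times an alternating theta series of the
  root lattice. Multiplying three Jacobi triple products and summing over one index with the pentagonal
  number theorem turns the product side into the same theta series.
\<close>

section \<open>The q-Chu-Vandermonde sums\<close>

text \<open>The factors \<open>q^(n_i)\<close> are present only for \<open>i >= s\<close>, so two
  operators are iterated: \<open>e = 1\<close> in the inner \<open>k - s\<close> steps and
  \<open>e = 0\<close> in the outer \<open>s - 1\<close>. Their eigenfunctions differ. With the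
  coefficient of \<open>s\<close> in the Bailey exponent fixed at 1, the eigenvalue computation
  forces \<open>c = e + 1\<close> and \<open>a1 + a2 + a3 = 2 e + 1\<close>. The expansion is
  therefore carried by \<open>kernB\<close> (\<open>c = 2\<close>) through the steps with
  \<open>e = 1\<close>, then moved with unchanged coefficients to \<open>kernA\<close>
  (\<open>c = 1\<close>). This move is possible because the coefficients alternate.

  The modulus \<open>3k + 1\<close> is a sum of quadratic parts. For
  \<open>p = x^2 + x y + y^2\<close> the seed contributes \<open>4 p / 3\<close> to the exponent and
  each of the \<open>k - 1\<close> steps contributes \<open>p\<close>, together
  \<open>(3k + 1) p / 3\<close>.

  The lattice terms contain negative powers of \<open>q\<close>. The algebra is hence done over an
  abstract field, later specialised to Laurent series; only the comparison of coefficients up to a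
  given order takes place in power series.\<close>

definition qfac :: "'a::field \<Rightarrow> int \<Rightarrow> 'a" where
  "qfac q n = (if n < 0 then 0 else \<Prod>i\<in>{1..n}. 1 - q powi i)"

text \<open>
  On negative arguments both \<open>qfac\<close> and its inverse \<open>iqfac\<close> are \<open>0\<close>. For \<open>iqfac\<close> this is the usual
  convention, and it makes the recursion \<open>iqfac_step\<close> hold for all integers, so that summation ranges can
  be left implicit.
\<close>

definition iqfac :: "'a::field \<Rightarrow> int \<Rightarrow> 'a" where
  "iqfac q n = inverse (qfac q n)"

locale not_root_of_unity =
  fixes q :: "'a::field"
  assumes q_nonzero: "q \<noteq> 0"
    and q_power_neq_1: "i > 0 \<Longrightarrow> q powi i \<noteq> 1"
begin

abbreviation "F \<equiv> qfac q"
abbreviation "G \<equiv> iqfac q"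

lemma powi_add: "q powi (i + j) = q powi i * q powi j"
  by (simp add: power_int_add q_nonzero)

lemma qfac_neg [simp]: "n < 0 \<Longrightarrow> F n = 0"
  and qfac_0 [simp]: "F 0 = 1"
  and iqfac_neg [simp]: "n < 0 \<Longrightarrow> G n = 0"
  and iqfac_0 [simp]: "G 0 = 1"
  by (simp_all add: qfac_def iqfac_def)

lemma qfac_step: "n > 0 \<Longrightarrow> F n = F (n - 1) * (1 - q powi n)"
proof -
  assume "n > 0"
  then have "{1..n} = insert n {1..n-1}"
    by auto
  with \<open>n > 0\<close> show ?thesis
    by (simp add: qfac_def)
qed

lemma qfac_nonzero: "n \<ge> 0 \<Longrightarrow> F n \<noteq> 0"
  using q_power_neq_1 by (auto simp: qfac_def)

lemma qfac_iqfac: "n \<ge> 0 \<Longrightarrow> F n * G n = 1"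
  by (simp add: iqfac_def qfac_nonzero)

lemma iqfac_step: "G (n - 1) = (1 - q powi n) * G n"
proof (cases "n > 0")
  case True
  then show ?thesis
    using q_power_neq_1[of n] by (simp add: iqfac_def qfac_step[of n])
qed (cases "n = 0"; simp)

lemma q_chu_vandermonde_0:
  "(\<Sum>t\<in>{0..int A}. q powi (t * (t + d)) * G t * G (t + d) * G (int A - t))
    = G (int A) * G (int A + d)"
proof (induction A arbitrary: d)
  case 0
  then show ?case by simp
next
  case (Suc A)
  define n where "n = int (Suc A)"
  have n: "n > 0" "n - 1 = int A"
    by (auto simp: n_def)
  define f where "f d t = q powi (t * (t + d)) * G t * G (t + d)" for d t
  have IH: "(\<Sum>t\<in>{0..n-1}. f d t * G (n - 1 - t)) = G (n - 1) * G (n - 1 + d)" for d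
    using Suc.IH[of d] n by (simp add: f_def)
  \<comment> \<open>Writing \<open>1 - q^n\<close> as
    \<open>(1 - q^(n-t)) + q^(n-t) (1 - q^t)\<close> lowers either \<open>n - t\<close> or
    \<open>t\<close> by one. Both resulting sums are instances for \<open>n - 1\<close>, the second
    with \<open>d + 1\<close> after shifting \<open>t\<close>.\<close>
  have split: "(1 - q powi n) * (f d t * G (n - t))
      = f d t * G (n - 1 - t)
        + q powi (n - t) * (q powi (t * (t + d)) * G (t - 1) * G (t + d) * G (n - t))" for t
  proof -
    have "q powi n = q powi (n - t) * q powi t"
      using powi_add[of "n - t" t] by simp
    moreover have "G (n - 1 - t) = (1 - q powi (n - t)) * G (n - t)"
      using iqfac_step[of "n - t"] by (simp add: algebra_simps)
    moreover note iqfac_step[of t]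
    ultimately show ?thesis
      by (simp only: f_def) (simp only: algebra_simps mult_1_left mult_1_right)
  qed
  have "(1 - q powi n) * (\<Sum>t\<in>{0..n}. f d t * G (n - t))
      = (\<Sum>t\<in>{0..n}. f d t * G (n - 1 - t))
        + (\<Sum>t\<in>{0..n}. q powi (n - t) * (q powi (t * (t + d)) * G (t - 1) * G (t + d) * G (n - t)))"
    by (simp add: sum_distrib_left split sum.distrib)
  also have "(\<Sum>t\<in>{0..n}. f d t * G (n - 1 - t)) = (\<Sum>t\<in>{0..n-1}. f d t * G (n - 1 - t))"
    by (rule sum.mono_neutral_right) auto
  also have "(\<Sum>t\<in>{0..n}. q powi (n - t) * (q powi (t * (t + d)) * G (t - 1) * G (t + d) * G (n - t)))
      = (\<Sum>t\<in>{1..n}. q powi (n - t) * (q powi (t * (t + d)) * G (t - 1) * G (t + d) * G (n - t)))"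
    by (rule sum.mono_neutral_right) auto
  also have "\<dots> = (\<Sum>t\<in>{0..n-1}. q powi (n + d) * (f (d + 1) t * G (n - 1 - t)))"
  proof (rule sum.reindex_bij_witness[of _ "\<lambda>t. t + 1" "\<lambda>t. t - 1"])
    fix t assume "t \<in> {1..n}"
    have "n - t + t * (t + d) = n + d + (t - 1) * (t - 1 + (d + 1))"
      by (simp add: algebra_simps)
    then have "q powi (n - t) * q powi (t * (t + d)) = q powi (n + d) * q powi ((t - 1) * (t - 1 + (d + 1)))"
      by (metis powi_add)
    then show "q powi (n + d) * (f (d + 1) (t - 1) * G (n - 1 - (t - 1)))
      = q powi (n - t) * (q powi (t * (t + d)) * G (t - 1) * G (t + d) * G (n - t))"
      by (simp add: f_def algebra_simps)
  qed auto
  also have "\<dots> = q powi (n + d) * (G (n - 1) * G (n + d))"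
    unfolding sum_distrib_left[symmetric] IH by (simp add: algebra_simps)
  also have "(\<Sum>t\<in>{0..n-1}. f d t * G (n - 1 - t)) = G (n - 1) * G (n + d - 1)"
    using IH[of d] by (simp add: algebra_simps)
  also have "G (n - 1) * G (n + d - 1) + q powi (n + d) * (G (n - 1) * G (n + d))
      = (1 - q powi n) * (G n * G (n + d))"
    unfolding iqfac_step[of "n + d"] iqfac_step[of n] by (simp add: algebra_simps)
  finally have "(1 - q powi n) * (\<Sum>t\<in>{0..n}. f d t * G (n - t)) = (1 - q powi n) * (G n * G (n + d))" .
  with q_power_neq_1[of n] n show ?case
    by (simp add: f_def n_def)
qed

lemma q_chu_vandermonde:
  assumes "finite I" "{a..b} \<subseteq> I"
  shows "(\<Sum>x\<in>I. q powi ((x - a) * (x - c)) * G (x - a) * G (x - c) * G (b - x))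
    = G (b - a) * G (b - c)"
proof -
  have "(\<Sum>x\<in>I. q powi ((x - a) * (x - c)) * G (x - a) * G (x - c) * G (b - x))
      = (\<Sum>x\<in>{a..b}. q powi ((x - a) * (x - c)) * G (x - a) * G (x - c) * G (b - x))"
    by (rule sum.mono_neutral_right) (use assms in \<open>auto simp: not_le\<close>)
  also have "\<dots> = G (b - a) * G (b - c)"
  proof (cases "a \<le> b")
    case True
    have "(\<Sum>x\<in>{a..b}. q powi ((x - a) * (x - c)) * G (x - a) * G (x - c) * G (b - x))
       = (\<Sum>t\<in>{0..int (nat (b - a))}. q powi (t * (t + (a - c))) * G t * G (t + (a - c)) * G (int (nat (b - a)) - t))"
      by (rule sum.reindex_bij_witness[of _ "\<lambda>t. t + a" "\<lambda>t. t - a"]) (use True in \<open>auto simp: algebra_simps\<close>)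
    also have "\<dots> = G (b - a) * G (b - c)"
      using True by (subst q_chu_vandermonde_0) simp
    finally show ?thesis .
  qed auto
  finally show ?thesis .
qed

lemma q_vandermonde_0:
  "(\<Sum>m\<in>{0..int x}. q powi (m * (m + d)) * G m * G (m + d) * G (int x - m) * G (y - m))
    = F (int x + y + d) * G (int x) * G y * G (int x + d) * G (y + d)"
proof (induction x arbitrary: y d)
  case 0
  show ?case
  proof (cases "y < 0 \<or> d < 0")
    case False
    then show ?thesis
      using qfac_iqfac[of "y + d"] by (simp add: algebra_simps)
  qed auto
next
  case (Suc x)
  define n where "n = int (Suc x)"
  have n: "n > 0" "n - 1 = int x"
    by (auto simp: n_def)
  define f where "f d y m = q powi (m * (m + d)) * G m * G (m + d) * G (y - m)" for d y m
  have IH: "(\<Sum>m\<in>{0..n-1}. f d y m * G (n - 1 - m))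
     = F (n - 1 + y + d) * G (n - 1) * G y * G (n - 1 + d) * G (y + d)" for d y
    using Suc.IH[of d y] n by (simp add: f_def mult_ac)
  have split: "(1 - q powi n) * (f d y m * G (n - m))
      = f d y m * G (n - 1 - m)
        + q powi (n - m) * (q powi (m * (m + d)) * G (m - 1) * G (m + d) * G (y - m) * G (n - m))" for m
  proof -
    have "q powi n = q powi (n - m) * q powi m"
      using powi_add[of "n - m" m] by simp
    moreover have "G (n - 1 - m) = (1 - q powi (n - m)) * G (n - m)"
      using iqfac_step[of "n - m"] by (simp add: algebra_simps)
    moreover note iqfac_step[of m]
    ultimately show ?thesis
      by (simp only: f_def) (simp only: algebra_simps mult_1_left mult_1_right)
  qed
  have "(1 - q powi n) * (\<Sum>m\<in>{0..n}. f d y m * G (n - m))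
      = (\<Sum>m\<in>{0..n}. f d y m * G (n - 1 - m))
        + (\<Sum>m\<in>{0..n}. q powi (n - m) * (q powi (m * (m + d)) * G (m - 1) * G (m + d) * G (y - m) * G (n - m)))"
    by (simp add: sum_distrib_left split sum.distrib)
  also have "(\<Sum>m\<in>{0..n}. f d y m * G (n - 1 - m)) = (\<Sum>m\<in>{0..n-1}. f d y m * G (n - 1 - m))"
    by (rule sum.mono_neutral_right) auto
  also have "(\<Sum>m\<in>{0..n}. q powi (n - m) * (q powi (m * (m + d)) * G (m - 1) * G (m + d) * G (y - m) * G (n - m)))
      = (\<Sum>m\<in>{1..n}. q powi (n - m) * (q powi (m * (m + d)) * G (m - 1) * G (m + d) * G (y - m) * G (n - m)))"
    by (rule sum.mono_neutral_right) auto
  also have "\<dots> = (\<Sum>m\<in>{0..n-1}. q powi (n + d) * (f (d + 1) (y - 1) m * G (n - 1 - m)))"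
  proof (rule sum.reindex_bij_witness[of _ "\<lambda>m. m + 1" "\<lambda>m. m - 1"])
    fix m assume "m \<in> {1..n}"
    have "n - m + m * (m + d) = n + d + (m - 1) * (m - 1 + (d + 1))"
      by (simp add: algebra_simps)
    then have "q powi (n - m) * q powi (m * (m + d)) = q powi (n + d) * q powi ((m - 1) * (m - 1 + (d + 1)))"
      by (metis powi_add)
    then show "q powi (n + d) * (f (d + 1) (y - 1) (m - 1) * G (n - 1 - (m - 1)))
      = q powi (n - m) * (q powi (m * (m + d)) * G (m - 1) * G (m + d) * G (y - m) * G (n - m))"
      by (simp add: f_def algebra_simps)
  qed auto
  also have "\<dots> = q powi (n + d) * (F (n + y + d - 1) * G (n - 1) * G (y - 1) * G (n + d) * G (y + d))"
    unfolding sum_distrib_left[symmetric] IH by (simp add: algebra_simps)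
  also have "(\<Sum>m\<in>{0..n-1}. f d y m * G (n - 1 - m))
      = F (n + y + d - 1) * G (n - 1) * G y * G (n + d - 1) * G (y + d)"
    using IH[of d y] by (simp add: algebra_simps)
  also have "F (n + y + d - 1) * G (n - 1) * G y * G (n + d - 1) * G (y + d)
        + q powi (n + d) * (F (n + y + d - 1) * G (n - 1) * G (y - 1) * G (n + d) * G (y + d))
      = (1 - q powi n) * (F (n + y + d) * G n * G y * G (n + d) * G (y + d))"
  proof (cases "y + d < 0")
    case False
    have "(1 - q powi (n + d)) + q powi (n + d) * (1 - q powi y) = 1 - q powi (n + y + d)"
      using powi_add[of "n + d" y] by (simp add: algebra_simps)
    moreover have "F (n + y + d) = F (n + y + d - 1) * (1 - q powi (n + y + d))"
      using False n by (intro qfac_step) simp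
    ultimately have F: "F (n + y + d) = F (n + y + d - 1) * ((1 - q powi (n + d)) + q powi (n + d) * (1 - q powi y))"
      by simp
    show ?thesis
      unfolding F iqfac_step[of "n + d"] iqfac_step[of n] iqfac_step[of y] by (simp add: algebra_simps)
  qed auto
  finally have "(1 - q powi n) * (\<Sum>m\<in>{0..n}. f d y m * G (n - m))
     = (1 - q powi n) * (F (n + y + d) * G n * G y * G (n + d) * G (y + d))" .
  with q_power_neq_1[of n] n show ?case
    by (simp add: f_def n_def mult_ac)
qed

lemma q_vandermonde:
  assumes "finite I" "{-a..X} \<subseteq> I"
  shows "(\<Sum>x\<in>I. q powi ((x + a) * (x + b)) * G (x + a) * G (x + b) * G (X - x) * G (Y - x))
    = F (X + Y + a + b) * G (X + a) * G (X + b) * G (Y + a) * G (Y + b)"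
proof -
  have "(\<Sum>x\<in>I. q powi ((x + a) * (x + b)) * G (x + a) * G (x + b) * G (X - x) * G (Y - x))
      = (\<Sum>x\<in>{-a..X}. q powi ((x + a) * (x + b)) * G (x + a) * G (x + b) * G (X - x) * G (Y - x))"
    by (rule sum.mono_neutral_right) (use assms in \<open>auto simp: not_le\<close>)
  also have "\<dots> = F (X + Y + a + b) * G (X + a) * G (X + b) * G (Y + a) * G (Y + b)"
  proof (cases "-a \<le> X")
    case True
    have "(\<Sum>x\<in>{-a..X}. q powi ((x + a) * (x + b)) * G (x + a) * G (x + b) * G (X - x) * G (Y - x))
       = (\<Sum>t\<in>{0..int (nat (X + a))}. q powi (t * (t + (b - a))) * G t * G (t + (b - a)) * G (int (nat (X + a)) - t) * G (Y + a - t))"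
      by (rule sum.reindex_bij_witness[of _ "\<lambda>t. t - a" "\<lambda>t. t + a"]) (use True in \<open>auto simp: algebra_simps\<close>)
    also have "\<dots> = F (X + Y + a + b) * G (X + a) * G (X + b) * G (Y + a) * G (Y + b)"
      using True by (subst q_vandermonde_0) (simp add: algebra_simps)
    finally show ?thesis .
  qed auto
  finally show ?thesis .
qed

text \<open>The substitution \<open>x -> -x\<close> exchanges the roles of the pairs
  \<open>(a, b)\<close> and \<open>(X, Y)\<close>. Both forms are kept: the eigenfunction argument
  opens the kernel with this one and closes it again with \<open>q_vandermonde\<close>.\<close>

lemma q_vandermonde':
  assumes "finite I" "{-a..X} \<subseteq> I"
  shows "(\<Sum>x\<in>I. q powi ((X - x) * (Y - x)) * G (x + a) * G (x + b) * G (X - x) * G (Y - x))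
    = F (X + Y + a + b) * G (X + a) * G (X + b) * G (Y + a) * G (Y + b)"
proof -
  have "(\<Sum>x\<in>I. q powi ((X - x) * (Y - x)) * G (x + a) * G (x + b) * G (X - x) * G (Y - x))
     = (\<Sum>x\<in>uminus ` I. q powi ((x + X) * (x + Y)) * G (x + X) * G (x + Y) * G (a - x) * G (b - x))"
    by (rule sum.reindex_bij_witness[of _ uminus uminus]) (auto simp: algebra_simps)
  also have "\<dots> = F (a + b + X + Y) * G (a + X) * G (a + Y) * G (b + X) * G (b + Y)"
    by (rule q_vandermonde) (use assms image_mono[OF assms(2), of uminus] in simp_all)
  finally show ?thesis
    by (simp add: algebra_simps)
qed

end

section \<open>Eigenfunctions of the two-sided summation step\<close>

context not_root_of_unity
begin

definition kern :: "int \<Rightarrow> int \<Rightarrow> int \<Rightarrow> int \<Rightarrow> int \<Rightarrow> int \<Rightarrow> 'a" where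
  "kern c a1 a2 a3 r s = F (r + s + c) * (G (r + a1) * G (r + a2) * G (r + a3))
     * (G (s + c - a1) * G (s + c - a2) * G (s + c - a3))"

lemma kern_expand:
  assumes "finite I" "{-a2..r} \<subseteq> I"
  shows "kern c a1 a2 a3 r s = G (r + a1) * G (s + c - a1)
    * (\<Sum>x\<in>I. q powi ((r - x) * (s + (c - a2 - a3) - x))
         * G (x + a2) * G (x + a3) * G (r - x) * G (s + (c - a2 - a3) - x))"
  by (subst q_vandermonde'[OF assms]) (simp add: kern_def algebra_simps)

text \<open>
  With \<open>kern_expand\<close> substituted, the exponent of \<open>q\<close> has no term \<open>r s\<close> left, so for each \<open>x\<close> the sums
  over \<open>r\<close> and \<open>s\<close> are independent Chu-Vandermonde sums; the remaining sum over \<open>x\<close> is again of the form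
  \<open>kern_expand\<close>.
\<close>

lemma kern_eigenfunction:
  assumes I: "finite I" "{-a2..L1} \<subseteq> I" and J: "finite J" "{a1 - c..L2} \<subseteq> J"
  shows "(\<Sum>r\<in>I. \<Sum>s\<in>J. q powi (r * r - r * s + s * s + (a1 + a2 + a3 - c) * r + (2 * c - (a1 + a2 + a3)) * s)
             * G (L1 - r) * G (L2 - s) * kern c a1 a2 a3 r s)
    = q powi (- a2 * a3 - (c - a1) * (c - a2 - a3)) * kern c a1 a2 a3 L1 L2"
proof -
  define g where "g = c - a2 - a3"
  define b where "b = c - a1"
  define R where "R = {-a2..L1}"
  define E where "E r s = r * r - r * s + s * s + (a1 + a2 + a3 - c) * r + (2 * c - (a1 + a2 + a3)) * s" for r s
  define U where "U x r = q powi ((r - x) * (r - - a1)) * G (r - x) * G (r - - a1) * G (L1 - r)" for x r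
  define V where "V x s = q powi ((s - - b) * (s - (x - g))) * G (s - - b) * G (s - (x - g)) * G (L2 - s)" for x s
  define C where "C x = q powi ((x + a2) * (x + a3) - a2 * a3 - b * g) * (G (x + a2) * G (x + a3))" for x
  have term_eq: "q powi (E r s) * G (L1 - r) * G (L2 - s) * kern c a1 a2 a3 r s = (\<Sum>x\<in>R. C x * U x r * V x s)"
    for r s
  proof (cases "r \<le> L1")
    case True
    then have "finite R" "{-a2..r} \<subseteq> R"
      by (auto simp: R_def)
    then have "kern c a1 a2 a3 r s = G (r + a1) * G (s + c - a1)
        * (\<Sum>x\<in>R. q powi ((r - x) * (s + g - x)) * G (x + a2) * G (x + a3) * G (r - x) * G (s + g - x))"
      unfolding g_def by (rule kern_expand)
    then have "q powi (E r s) * G (L1 - r) * G (L2 - s) * kern c a1 a2 a3 r s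
       = (\<Sum>x\<in>R. q powi (E r s) * G (L1 - r) * G (L2 - s) * (G (r + a1) * G (s + c - a1)
          * (q powi ((r - x) * (s + g - x)) * G (x + a2) * G (x + a3) * G (r - x) * G (s + g - x))))"
      by (simp add: sum_distrib_left mult_ac)
    also have "\<dots> = (\<Sum>x\<in>R. C x * U x r * V x s)"
    proof (rule sum.cong[OF refl])
      fix x
      have "E r s + (r - x) * (s + g - x)
          = ((x + a2) * (x + a3) - a2 * a3 - b * g) + ((r - x) * (r - - a1) + (s - - b) * (s - (x - g)))"
        by (simp add: E_def g_def b_def algebra_simps)
      then have pw: "q powi (E r s) * q powi ((r - x) * (s + g - x))
          = q powi ((x + a2) * (x + a3) - a2 * a3 - b * g) * (q powi ((r - x) * (r - - a1)) * q powi ((s - - b) * (s - (x - g))))"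
        by (metis powi_add)
      have eqs: "s + c - a1 = s - - b" "s + g - x = s - (x - g)" "r + a1 = r - - a1"
        by (simp_all add: b_def)
      have "q powi (E r s) * G (L1 - r) * G (L2 - s) * (G (r + a1) * G (s + c - a1)
          * (q powi ((r - x) * (s + g - x)) * G (x + a2) * G (x + a3) * G (r - x) * G (s + g - x)))
        = (q powi (E r s) * q powi ((r - x) * (s + g - x))) * (G (L1 - r) * G (L2 - s) * (G (r + a1) * G (s + c - a1)
          * (G (x + a2) * G (x + a3) * G (r - x) * G (s + g - x))))"
        by (simp only: mult_ac)
      also have "\<dots> = C x * U x r * V x s"
        unfolding pw unfolding C_def U_def V_def eqs by (simp only: mult_ac)
      finally show "q powi (E r s) * G (L1 - r) * G (L2 - s) * (G (r + a1) * G (s + c - a1)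
          * (q powi ((r - x) * (s + g - x)) * G (x + a2) * G (x + a3) * G (r - x) * G (s + g - x)))
          = C x * U x r * V x s" .
    qed
    finally show ?thesis .
  qed (simp add: U_def)
  have "(\<Sum>r\<in>I. \<Sum>s\<in>J. q powi (E r s) * G (L1 - r) * G (L2 - s) * kern c a1 a2 a3 r s)
      = (\<Sum>r\<in>I. \<Sum>s\<in>J. \<Sum>x\<in>R. C x * U x r * V x s)"
    by (simp only: term_eq)
  also have "\<dots> = (\<Sum>r\<in>I. \<Sum>x\<in>R. \<Sum>s\<in>J. C x * U x r * V x s)"
    by (rule sum.cong[OF refl], rule sum.swap)
  also have "\<dots> = (\<Sum>x\<in>R. \<Sum>r\<in>I. \<Sum>s\<in>J. C x * U x r * V x s)"
    by (rule sum.swap)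
  also have "\<dots> = (\<Sum>x\<in>R. C x * (sum (U x) I * sum (V x) J))"
    by (simp only: sum_product) (simp only: sum_distrib_left mult.assoc)
  also have "\<dots> = (\<Sum>x\<in>R. C x * ((G (L1 - x) * G (L1 + a1)) * (G (L2 + b) * G (L2 + g - x))))"
  proof (rule sum.cong[OF refl])
    fix x assume "x \<in> R"
    then have "sum (U x) I = G (L1 - x) * G (L1 - - a1)"
      unfolding U_def by (intro q_chu_vandermonde) (use I in \<open>auto simp: R_def\<close>)
    moreover have "sum (V x) J = G (L2 - - b) * G (L2 - (x - g))"
      unfolding V_def by (intro q_chu_vandermonde) (use J in \<open>auto simp: b_def\<close>)
    ultimately show "C x * (sum (U x) I * sum (V x) J)
       = C x * ((G (L1 - x) * G (L1 + a1)) * (G (L2 + b) * G (L2 + g - x)))"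
      by (simp add: algebra_simps)
  qed
  also have "\<dots> = q powi (- a2 * a3 - b * g) * (G (L1 + a1) * G (L2 + b)
     * (\<Sum>x\<in>R. q powi ((x + a2) * (x + a3)) * G (x + a2) * G (x + a3) * G (L1 - x) * G (L2 + g - x)))"
  proof -
    have "C x = q powi (- a2 * a3 - b * g) * q powi ((x + a2) * (x + a3)) * G (x + a2) * G (x + a3)" for x
    proof -
      have "(x + a2) * (x + a3) - a2 * a3 - b * g = (- a2 * a3 - b * g) + (x + a2) * (x + a3)"
        by simp
      then show ?thesis
        unfolding C_def by (metis powi_add mult.assoc)
    qed
    then show ?thesis
      by (simp add: sum_distrib_left mult_ac)
  qed
  also have "\<dots> = q powi (- a2 * a3 - b * g) * kern c a1 a2 a3 L1 L2"
  proof -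
    have eqs: "L1 + (L2 + g) + a2 + a3 = L1 + L2 + c" "L2 + b = L2 + c - a1"
      "L2 + g + a2 = L2 + c - a3" "L2 + g + a3 = L2 + c - a2"
      by (simp_all add: g_def b_def)
    show ?thesis
      by (subst q_vandermonde) (auto simp: R_def kern_def eqs mult_ac)
  qed
  finally show ?thesis
    by (simp add: E_def g_def b_def)
qed

text \<open>The factor \<open>1 / (q)_(n_1)\<close> and the binomials \<open>[n_i, n_(i+1)]\<close>
  telescope to \<open>1 / (q)_(n_(k-1))\<close> times the product of all
  \<open>1 / (q)_(n_i - n_(i+1))\<close>. Hence a step carries only \<open>G (N - n)\<close> and the
  binomial \<open>[N - n + m, M]\<close>, and the remaining inverse factorial belongs to the seed.
  The bound \<open>2 n\<close> on \<open>m\<close> is inherited from \<open>[2n, m]\<close> in the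
  seed.\<close>

definition one_sided_step :: "int \<Rightarrow> (int \<Rightarrow> int \<Rightarrow> 'a) \<Rightarrow> int \<Rightarrow> int \<Rightarrow> 'a" where
  "one_sided_step e h N M = (\<Sum>n\<in>{0..N}. \<Sum>m\<in>{0..2*n}.
     q powi (n * n - n * m + m * m + m + e * n)
       * (F (N - n + m) * G M * G (N - n + m - M)) * G (N - n) * h n m)"

definition two_sided_step :: "int \<Rightarrow> (int \<Rightarrow> int \<Rightarrow> 'a) \<Rightarrow> int \<Rightarrow> int \<Rightarrow> 'a" where
  "two_sided_step e f L1 L2 = (\<Sum>r\<in>{0..L1}. \<Sum>s\<in>{0..L2}.
     q powi (r * r - r * s + s * s + e * r + s) * G (L1 - r) * G (L2 - s) * f r s)"

definition two_sided :: "(int \<Rightarrow> int \<Rightarrow> 'a) \<Rightarrow> int \<Rightarrow> int \<Rightarrow> 'a" where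
  "two_sided h r s = (\<Sum>m\<in>{0..2*r}. q powi (m * (s + m + 1 - r)) * G s * G (s + m + 1 - r) * h r m)"

text \<open>After interchanging sums, the sum over \<open>M\<close> on the left and the sum over
  \<open>s\<close> on the right are Chu-Vandermonde sums. On the left the factor
  \<open>F (N - n + m)\<close> cancels, and both sides become the sum of the same
  \<open>W n m\<close>.\<close>

lemma two_sided_step_two_sided:
  "two_sided (one_sided_step e h) N S = two_sided_step e (two_sided h) N S"
proof -
  define Q where "Q n m = q powi (n * n - n * m + m * m + m + e * n) * G (N - n) * h n m" for n m
  define W where "W n m = Q n m * (G S * G (S + 1 - n + m))" for n m
  have "two_sided (one_sided_step e h) N S
     = (\<Sum>M\<in>{0..2*N}. \<Sum>n\<in>{0..N}. \<Sum>m\<in>{0..2*n}. (Q n m * G S * F (N - n + m))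
          * (q powi ((M - 0) * (M - (N - 1 - S))) * G (M - 0) * G (M - (N - 1 - S)) * G (N - n + m - M)))"
  proof -
    have eq: "S + M + 1 - N = M - (N - 1 - S)" for M
      by simp
    show ?thesis
      unfolding two_sided_def one_sided_step_def Q_def
      by (simp add: sum_distrib_left eq mult_ac)
  qed
  also have "\<dots> = (\<Sum>n\<in>{0..N}. \<Sum>M\<in>{0..2*N}. \<Sum>m\<in>{0..2*n}. (Q n m * G S * F (N - n + m))
          * (q powi ((M - 0) * (M - (N - 1 - S))) * G (M - 0) * G (M - (N - 1 - S)) * G (N - n + m - M)))"
    by (rule sum.swap)
  also have "\<dots> = (\<Sum>n\<in>{0..N}. \<Sum>m\<in>{0..2*n}. (Q n m * G S * F (N - n + m))
          * (\<Sum>M\<in>{0..2*N}. q powi ((M - 0) * (M - (N - 1 - S))) * G (M - 0) * G (M - (N - 1 - S)) * G (N - n + m - M)))"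
    unfolding sum_distrib_left by (rule sum.cong[OF refl], rule sum.swap)
  also have "\<dots> = (\<Sum>n\<in>{0..N}. \<Sum>m\<in>{0..2*n}. W n m)"
  proof (intro sum.cong refl)
    fix n m assume nm: "n \<in> {0..N}" "m \<in> {0..2*n}"
    have "(\<Sum>M\<in>{0..2*N}. q powi ((M - 0) * (M - (N - 1 - S))) * G (M - 0) * G (M - (N - 1 - S)) * G (N - n + m - M))
        = G (N - n + m - 0) * G (N - n + m - (N - 1 - S))"
      by (rule q_chu_vandermonde) (use nm in auto)
    moreover have "F (N - n + m) * G (N - n + m) = 1"
      using nm by (intro qfac_iqfac) auto
    moreover have "N - n + m - (N - 1 - S) = S + 1 - n + m"
      by simp
    ultimately show "(Q n m * G S * F (N - n + m))
          * (\<Sum>M\<in>{0..2*N}. q powi ((M - 0) * (M - (N - 1 - S))) * G (M - 0) * G (M - (N - 1 - S)) * G (N - n + m - M))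
        = W n m"
      by (simp add: W_def)
  qed
  also have "\<dots> = two_sided_step e (two_sided h) N S"
  proof -
    have "two_sided_step e (two_sided h) N S = (\<Sum>n\<in>{0..N}. \<Sum>s\<in>{0..S}. \<Sum>m\<in>{0..2*n}. Q n m *
       (q powi ((s - 0) * (s - (n - 1 - m))) * G (s - 0) * G (s - (n - 1 - m)) * G (S - s)))"
      unfolding two_sided_step_def two_sided_def sum_distrib_left
    proof (intro sum.cong refl)
      fix n s m
      have "(n * n - n * s + s * s + e * n + s) + m * (s + m + 1 - n)
         = (n * n - n * m + m * m + m + e * n) + (s - 0) * (s - (n - 1 - m))"
        by (simp add: algebra_simps)
      then have "q powi (n * n - n * s + s * s + e * n + s) * q powi (m * (s + m + 1 - n))
         = q powi (n * n - n * m + m * m + m + e * n) * q powi ((s - 0) * (s - (n - 1 - m)))"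
        by (metis powi_add)
      moreover have "s + m + 1 - n = s - (n - 1 - m)"
        by simp
      ultimately show "q powi (n * n - n * s + s * s + e * n + s) * G (N - n) * G (S - s)
           * (q powi (m * (s + m + 1 - n)) * G s * G (s + m + 1 - n) * h n m)
         = Q n m * (q powi ((s - 0) * (s - (n - 1 - m))) * G (s - 0) * G (s - (n - 1 - m)) * G (S - s))"
        unfolding Q_def by (simp only: mult_ac diff_zero)
    qed
    also have "\<dots> = (\<Sum>n\<in>{0..N}. \<Sum>m\<in>{0..2*n}. Q n m * (\<Sum>s\<in>{0..S}.
       q powi ((s - 0) * (s - (n - 1 - m))) * G (s - 0) * G (s - (n - 1 - m)) * G (S - s)))"
      unfolding sum_distrib_left by (rule sum.cong[OF refl], rule sum.swap)
    also have "\<dots> = (\<Sum>n\<in>{0..N}. \<Sum>m\<in>{0..2*n}. W n m)"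
    proof -
      have "(\<Sum>s\<in>{0..S}. q powi ((s - 0) * (s - (n - 1 - m))) * G (s - 0) * G (s - (n - 1 - m)) * G (S - s))
         = G (S - 0) * G (S - (n - 1 - m))" for n m
        by (rule q_chu_vandermonde) auto
      moreover have "S - (n - 1 - m) = S + 1 - n + m" for n m
        by simp
      ultimately show ?thesis
        by (simp add: W_def)
    qed
    finally show ?thesis ..
  qed
  finally show ?thesis .
qed

lemma two_sided_seed:
  assumes "r \<ge> 0"
  shows "two_sided (\<lambda>n m. F (2 * n) * G m * G (2 * n - m) * G n) r s = G r * G s * G (r + s + 1)"
proof -
  have "two_sided (\<lambda>n m. F (2 * n) * G m * G (2 * n - m) * G n) r s
     = G s * G r * F (2 * r) * (\<Sum>m\<in>{0..2*r}. q powi ((m - 0) * (m - (r - 1 - s))) * G (m - 0) * G (m - (r - 1 - s)) * G (2 * r - m))"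
  proof -
    have eq: "s + m + 1 - r = m - (r - 1 - s)" for m
      by simp
    show ?thesis
      unfolding two_sided_def by (simp add: sum_distrib_left eq mult_ac)
  qed
  also have "\<dots> = G s * G r * F (2 * r) * (G (2 * r - 0) * G (2 * r - (r - 1 - s)))"
    by (subst q_chu_vandermonde) auto
  also have "\<dots> = G s * G r * (F (2 * r) * G (2 * r)) * G (r + s + 1)"
    by (simp add: algebra_simps)
  also have "F (2 * r) * G (2 * r) = 1"
    using assms by (intro qfac_iqfac) simp
  finally show ?thesis
    by (simp add: mult_ac)
qed

end

section \<open>Alternating sums over the root lattice\<close>

text \<open>The quadratic character modulo 3. It takes values in any ring because it is used both
  over the rationals and over Laurent series.\<close>

definition chi :: "int \<Rightarrow> 'a::comm_ring_1" where
  "chi n = (if n mod 3 = 1 then 1 else if n mod 3 = 2 then - 1 else 0)"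

lemma chi_add_3: "chi (n + 3 * k) = chi n"
  by (simp add: chi_def)

lemma chi_minus: "chi (- n) = - chi n"
proof -
  have "(- n) mod 3 = (if n mod 3 = 0 then 0 else 3 - n mod 3)" for n :: int
    by presburger
  moreover have "n mod 3 = 0 \<or> n mod 3 = 1 \<or> n mod 3 = 2"
    by presburger
  ultimately show ?thesis
    by (auto simp: chi_def)
qed

text \<open>Vanishing on walls is deduced from \<open>a = - a\<close>, which requires 2 to be
  invertible.\<close>

locale not_root_of_unity_char_neq_2 = not_root_of_unity +
  assumes two_nonzero: "(2 :: 'a) \<noteq> 0"
begin

text \<open>This is the q-binomial coefficient \<open>[N, j]\<close> divided by
  \<open>(q)_N\<close>.\<close>

definition qbin :: "int \<Rightarrow> int \<Rightarrow> 'a" where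
  "qbin N j = G j * G (N - j)"

lemma qbin_nonzeroD: "qbin N j \<noteq> 0 \<Longrightarrow> 0 \<le> j \<and> j \<le> N"
  by (auto simp: qbin_def intro: ccontr)

lemma qbin_step: "(1 - q powi j) * qbin N j = (1 - q powi (N + 1 - j)) * qbin N (j - 1)"
proof -
  have "N + 1 - j - 1 = N - j" "N - (j - 1) = N + 1 - j"
    by simp_all
  then show ?thesis
    using iqfac_step[of "N + 1 - j"] iqfac_step[of j] by (simp only: qbin_def mult_ac)
qed

text \<open>
  A pair \<open>(x, y)\<close> stands for the root lattice vector \<open>(x, y, - x - y)\<close>; \<open>x\<^sup>2 + x y + y\<^sup>2\<close> is half its squared
  length, and \<open>chi (x - y)\<close> is the sign of the permutation that its entries form modulo \<open>3\<close>.
\<close>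

definition lterm where
  "lterm w N j1 j2 j3 m1 m2 m3 = (\<lambda>(x, y). chi (x - y) * w (x * x + x * y + y * y)
     * q powi (m1 * x + m2 * y - m3 * (x + y)) * (qbin N (j1 - x) * qbin N (j2 - y) * qbin N (j3 + (x + y))))"

definition lsupp :: "int \<Rightarrow> int \<Rightarrow> int \<Rightarrow> int \<Rightarrow> (int \<times> int) set" where
  "lsupp N j1 j2 j3 = {(x, y). j1 - N \<le> x \<and> x \<le> j1 \<and> j2 - N \<le> y \<and> y \<le> j2
      \<and> j3 - N \<le> - (x + y) \<and> - (x + y) \<le> j3}"

definition lsum :: "(int \<Rightarrow> 'a) \<Rightarrow> int \<Rightarrow> int \<Rightarrow> int \<Rightarrow> int \<Rightarrow> int \<Rightarrow> int \<Rightarrow> int \<Rightarrow> 'a" where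
  "lsum w N j1 j2 j3 m1 m2 m3 = sum (lterm w N j1 j2 j3 m1 m2 m3) (lsupp N j1 j2 j3)"

lemma finite_lsupp: "finite (lsupp N j1 j2 j3)"
  by (rule finite_subset[of _ "{j1-N..j1} \<times> {j2-N..j2}"]) (auto simp: lsupp_def)

lemma lsum_superset:
  assumes "finite V" "lsupp N j1 j2 j3 \<subseteq> V"
  shows "sum (lterm w N j1 j2 j3 m1 m2 m3) V = lsum w N j1 j2 j3 m1 m2 m3"
  unfolding lsum_def
proof (rule sum.mono_neutral_right)
  show "\<forall>v\<in>V - lsupp N j1 j2 j3. lterm w N j1 j2 j3 m1 m2 m3 v = 0"
    by (auto simp: lsupp_def lterm_def dest!: qbin_nonzeroD)
qed (use assms in auto)

text \<open>\<open>chi\<close> is odd and the quadratic form is symmetric in the three coordinates,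
  so permuting the pairs \<open>(j, m)\<close> acts by the sign of the permutation. Two equal pairs
  therefore put the parameters on a wall, where the sum is 0.\<close>

lemma lsum_swap12: "lsum w N j1 j2 j3 m1 m2 m3 = - lsum w N j2 j1 j3 m2 m1 m3"
  unfolding lsum_def sum_negf[symmetric]
proof (rule sum.reindex_bij_witness[of _ "\<lambda>(x, y). (y, x)" "\<lambda>(x, y). (y, x)"], goal_cases)
  case (5 v)
  obtain x y where v: "v = (x, y)"
    by fastforce
  have "chi (y - x) = (- chi (x - y) :: 'a)"
    using chi_minus[of "x - y"] by simp
  then show ?case
    by (simp add: v lterm_def algebra_simps)
qed (auto simp: lsupp_def algebra_simps)

lemma lsum_swap23: "lsum w N j1 j2 j3 m1 m2 m3 = - lsum w N j1 j3 j2 m1 m3 m2"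
  unfolding lsum_def sum_negf[symmetric]
proof (rule sum.reindex_bij_witness[of _ "\<lambda>(x, y). (x, - (x + y))" "\<lambda>(x, y). (x, - (x + y))"], goal_cases)
  case (5 v)
  obtain x y where v: "v = (x, y)"
    by fastforce
  have "x + (x + y) = - (x - y) + 3 * x"
    by simp
  then have "chi (x + (x + y)) = (- chi (x - y) :: 'a)"
    by (metis chi_add_3 chi_minus)
  moreover have "x * x + x * - (x + y) + - (x + y) * - (x + y) = x * x + x * y + y * y"
    by (simp add: algebra_simps)
  ultimately show ?case
    by (simp add: v lterm_def mult_ac) (simp add: algebra_simps)
qed (auto simp: lsupp_def algebra_simps)

text \<open>The three coordinates of a lattice vector add up to zero, so only the differences of
  \<open>m1\<close>, \<open>m2\<close>, \<open>m3\<close> matter.\<close>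

lemma lsum_shift: "lsum w N j1 j2 j3 (m1 + t) (m2 + t) (m3 + t) = lsum w N j1 j2 j3 m1 m2 m3"
  by (simp add: lsum_def lterm_def algebra_simps)

lemma self_neg_eq_0: "a = - a \<Longrightarrow> a = (0 :: 'a)"
  using two_nonzero by (metis add.right_inverse mult_2 mult_eq_0_iff)

lemma lsum_eq_0_12: "lsum w N j j j3 m m m3 = 0"
  by (rule self_neg_eq_0) (rule lsum_swap12)

lemma lsum_eq_0_23: "lsum w N j1 j j m1 m m = 0"
  by (rule self_neg_eq_0) (rule lsum_swap23)

lemma lsum_eq_0_13: "lsum w N j j2 j m m2 m = 0"
  by (subst lsum_swap12) (simp add: lsum_eq_0_23)

text \<open>Apply \<open>qbin_step\<close> to the factor with lower index \<open>j1 - x\<close> in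
  every term; the powers of \<open>q\<close> that depend on \<open>x\<close> are absorbed by moving
  \<open>m1\<close> by one.\<close>

lemma lsum_pascal1:
  "lsum w N j1 j2 j3 m1 m2 m3 - q powi j1 * lsum w N j1 j2 j3 (m1 - 1) m2 m3
    = lsum w N (j1 - 1) j2 j3 m1 m2 m3
      - q powi (N + 1 - j1) * lsum w N (j1 - 1) j2 j3 (m1 + 1) m2 m3"
proof -
  define V where "V = lsupp N j1 j2 j3 \<union> lsupp N (j1 - 1) j2 j3"
  have fin: "finite V"
    by (simp add: V_def finite_lsupp)
  have "lsupp N j1 j2 j3 \<subseteq> V" "lsupp N (j1 - 1) j2 j3 \<subseteq> V"
    by (auto simp: V_def)
  note sup = this[THEN lsum_superset[OF fin], symmetric]
  have "lterm w N j1 j2 j3 m1 m2 m3 v - q powi j1 * lterm w N j1 j2 j3 (m1 - 1) m2 m3 v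
      = lterm w N (j1 - 1) j2 j3 m1 m2 m3 v
      - q powi (N + 1 - j1) * lterm w N (j1 - 1) j2 j3 (m1 + 1) m2 m3 v" for v
  proof -
    obtain x y where v: "v = (x, y)"
      by fastforce
    define c where "c = chi (x - y) * w (x * x + x * y + y * y) * (qbin N (j2 - y) * qbin N (j3 + (x + y)))"
    define e where "e = m1 * x + m2 * y - m3 * (x + y)"
    have 1: "q powi j1 * q powi ((m1 - 1) * x + m2 * y - m3 * (x + y)) = q powi (j1 - x) * q powi e"
      unfolding powi_add[symmetric] by (simp add: e_def algebra_simps)
    have 2: "q powi (N + 1 - j1) * q powi ((m1 + 1) * x + m2 * y - m3 * (x + y)) = q powi (N + 1 - (j1 - x)) * q powi e"
      unfolding powi_add[symmetric] by (simp add: e_def algebra_simps)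
    have "lterm w N j1 j2 j3 m1 m2 m3 v - q powi j1 * lterm w N j1 j2 j3 (m1 - 1) m2 m3 v
      = c * (qbin N (j1 - x) * (q powi e - q powi j1 * q powi ((m1 - 1) * x + m2 * y - m3 * (x + y))))"
      by (simp add: v lterm_def c_def e_def algebra_simps)
    also have "\<dots> = c * q powi e * ((1 - q powi (j1 - x)) * qbin N (j1 - x))"
      unfolding 1 by (simp add: algebra_simps)
    also have "\<dots> = c * q powi e * ((1 - q powi (N + 1 - (j1 - x))) * qbin N (j1 - x - 1))"
      unfolding qbin_step ..
    also have "\<dots> = c * (qbin N (j1 - x - 1) * (q powi e - q powi (N + 1 - (j1 - x)) * q powi e))"
      by (simp add: ring_distribs mult_ac)
    also have "\<dots> = lterm w N (j1 - 1) j2 j3 m1 m2 m3 v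
      - q powi (N + 1 - j1) * lterm w N (j1 - 1) j2 j3 (m1 + 1) m2 m3 v"
      unfolding 2[symmetric] by (simp add: v lterm_def c_def e_def algebra_simps)
    finally show ?thesis .
  qed
  then show ?thesis
    unfolding sup sum_distrib_left sum_subtractf[symmetric] by (rule sum.cong[OF refl])
qed

lemma lsum_pascal2:
  "lsum w N j1 j2 j3 m1 m2 m3 - q powi j2 * lsum w N j1 j2 j3 m1 (m2 - 1) m3
    = lsum w N j1 (j2 - 1) j3 m1 m2 m3
      - q powi (N + 1 - j2) * lsum w N j1 (j2 - 1) j3 m1 (m2 + 1) m3"
  using lsum_pascal1[of w N j2 j1 j3 m2 m1 m3]
  by (simp add: lsum_swap12[of w N j2] lsum_swap12[of w N "j2 - 1"] algebra_simps)

lemma lsum_pascal3: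
  "lsum w N j1 j2 j3 m1 m2 m3 - q powi j3 * lsum w N j1 j2 j3 m1 m2 (m3 - 1)
    = lsum w N j1 j2 (j3 - 1) m1 m2 m3
      - q powi (N + 1 - j3) * lsum w N j1 j2 (j3 - 1) m1 m2 (m3 + 1)"
  using lsum_pascal2[of w N j1 j3 j2 m1 m3 m2]
  by (simp add: lsum_swap23[of w N j1 j3] lsum_swap23[of w N j1 "j3 - 1"] algebra_simps)

text \<open>
  The division is exact wherever \<open>chi (x - y) \<noteq> 0\<close>.
\<close>

definition seed_weight :: "int \<Rightarrow> 'a" where
  "seed_weight p = q powi ((4 * p - 4) div 3)"

text \<open>
  The rotation of the affine Weyl alcove. Together with \<open>lsum_swap12\<close> and \<open>lsum_swap23\<close> it generates the
  extended affine Weyl group.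
\<close>

lemma lsum_rotate:
  "lsum seed_weight N j1 j2 j3 m1 m2 m3
    = q powi (4 + 2 * m1 - m2 - m3) * lsum seed_weight N (j2 + 1) (j3 + 1) (j1 - 2) m2 m3 (m1 + 4)"
  unfolding lsum_def sum_distrib_left
proof (rule sum.reindex_bij_witness[of _ "\<lambda>(x, y). (- (x + y) + 2, x - 1)" "\<lambda>(x, y). (y + 1, - (x + y) + 1)"], goal_cases)
  case (5 v)
  obtain x y where v: "v = (x, y)"
    by fastforce
  define x' y' where "x' = y + 1" and "y' = - (x + y) + 1"
  have xy: "x = - (x' + y') + 2" "y = x' - 1"
    by (simp_all add: x'_def y'_def)
  have "x' - y' = (x - y) + 3 * y"
    by (simp add: x'_def y'_def)
  then have 1: "chi (x' - y') = (chi (x - y) :: 'a)"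
    by (metis chi_add_3)
  define p p' where "p = x * x + x * y + y * y" and "p' = x' * x' + x' * y' + y' * y'"
  \<comment> \<open>The difference is a multiple of 3, so the quotients differ by a linear form even
    at vectors where the division is not exact. This linear form turns \<open>m1\<close> into
    \<open>m1 + 4\<close>.\<close>
  have "4 * p - 4 = (4 * p' - 4) + (4 - 4 * (x' + y')) * 3"
    by (simp add: p_def p'_def xy algebra_simps)
  then have p: "(4 * p - 4) div 3 = (4 * p' - 4) div 3 + (4 - 4 * (x' + y'))"
    by (simp only: div_mult_self1)
  define e e' where "e = m1 * x + m2 * y - m3 * (x + y)"
    and "e' = m2 * x' + m3 * y' - (m1 + 4) * (x' + y')"
  have "(4 * p - 4) div 3 + e = 4 + 2 * m1 - m2 - m3 + ((4 * p' - 4) div 3 + e')"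
    unfolding p by (simp add: e_def e'_def xy algebra_simps)
  then have 2: "seed_weight p * q powi e = q powi (4 + 2 * m1 - m2 - m3) * (seed_weight p' * q powi e')"
    unfolding seed_weight_def powi_add[symmetric] by simp
  have 3: "qbin N (j1 - x) * qbin N (j2 - y) * qbin N (j3 + (x + y))
     = qbin N (j2 + 1 - x') * qbin N (j3 + 1 - y') * qbin N (j1 - 2 + (x' + y'))"
    by (simp add: x'_def y'_def algebra_simps)
  have "lterm seed_weight N j1 j2 j3 m1 m2 m3 (x, y) = chi (x - y) * (seed_weight p * q powi e)
     * (qbin N (j1 - x) * qbin N (j2 - y) * qbin N (j3 + (x + y)))"
    by (simp add: lterm_def p_def e_def mult_ac)
  also have "\<dots> = q powi (4 + 2 * m1 - m2 - m3) * lterm seed_weight N (j2 + 1) (j3 + 1) (j1 - 2) m2 m3 (m1 + 4) (x', y')"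
    unfolding 2 3 1[symmetric] by (simp add: lterm_def p'_def e'_def mult_ac)
  finally show ?case
    by (simp add: v x'_def y'_def)
qed (auto simp: lsupp_def)

text \<open>
  The eight relations \<open>R1\<close> to \<open>R8\<close> were found by eliminating among all instances of the q-Pascal rule near
  \<open>(R, R, R)\<close> modulo the action of the affine Weyl group.
\<close>

lemma seed_lsum_step:
  "(1 - q powi (R - 1)) * lsum seed_weight N R R R 0 1 2
     = (1 - q powi (N - R)) * lsum seed_weight N (R - 1) (R - 1) (R - 1) 0 1 2"
proof -
  let ?L = "lsum seed_weight N"
  define t where "t = q powi (R - 1)"
  define U where "U = q powi (N - R)"
  define B0 where "B0 = ?L R R R 0 1 2"
  define A where "A = ?L R R (R - 1) 0 1 1"
  define A1 where "A1 = ?L R R (R - 1) 0 1 2"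
  define A2 where "A2 = ?L R R (R - 1) 0 1 3"
  define C where "C = ?L R (R - 1) (R - 1) 0 1 2"
  define C1 where "C1 = ?L R (R - 1) (R - 1) 0 2 3"
  define D where "D = ?L (R + 1) R (R - 1) 0 1 2"
  define D1 where "D1 = ?L (R + 1) R (R - 1) 0 0 2"
  define B1 where "B1 = ?L (R - 1) (R - 1) (R - 1) 0 1 2"
  have T: "q powi R = q * t"
    using powi_add[of 1 "R - 1"] by (simp add: t_def)
  have U': "q powi (N + 1 - R) = q * U"
    using powi_add[of 1 "N - R"] by (simp add: U_def algebra_simps)
  have U'': "q powi (2 + (N - R)) = q * (q * U)"
    using powi_add[of 2 "N - R"] by (simp add: U_def power2_eq_square mult_ac)
  have U''': "q powi (N + 1 - (R + 1)) = U"
    by (simp add: U_def)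
  have T': "q powi (R + 1) = q * (q * t)"
    using powi_add[of 2 "R - 1"] by (simp add: t_def power2_eq_square add.commute mult_ac)
  have R1: "B0 = A1 - q * U * A2"
    using lsum_pascal3[of seed_weight N R R R 0 1 2]
    by (simp add: B0_def A1_def A2_def U' lsum_eq_0_23 mult_ac)
  have R2: "A = q * U * A1"
    using lsum_pascal2[of seed_weight N R R R 0 1 1]
    by (simp add: A_def A1_def U' lsum_eq_0_23 lsum_eq_0_12 lsum_swap23[of _ _ R "R - 1"] mult_ac)
  have R3: "A = q * U * C"
    using lsum_pascal2[of seed_weight N R R "R - 1" 0 1 1]
    by (simp add: A_def C_def U' lsum_eq_0_23 lsum_eq_0_12 lsum_swap23[of _ _ _ _ _ 0 2 1] mult_ac)
  have rotC: "C = q * ?L R R (R - 2) 0 1 3"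
    using lsum_rotate[of N R "R - 1" "R - 1" 0 1 2] lsum_shift[of seed_weight N R R "R - 2" 0 1 1 3]
    by (simp add: C_def)
  have rotC1: "?L R R (R - 2) 0 1 2 = q * C1"
    using lsum_rotate[of N R "R - 1" "R - 1" 0 2 3] lsum_shift[of seed_weight N R R "R - 2" 0 2 1 2] q_nonzero
    by (simp add: C1_def field_simps)
  have R4: "A1 - t * A = q * C1 - q * U * C"
    using lsum_pascal3[of seed_weight N R R "R - 1" 0 1 2] rotC rotC1
    by (simp add: A1_def A_def U'' t_def mult_ac)
  have R5: "B1 = C - q * t * C1"
    using lsum_pascal1[of seed_weight N R "R - 1" "R - 1" 0 2 1] lsum_shift[of seed_weight N R "R - 1" "R - 1" "-1" 1 1 2]
    by (simp add: T B1_def C_def C1_def lsum_swap23[of _ _ _ _ _ 0 2 1] lsum_swap23[of _ _ _ _ _ "-1" 2 1] lsum_eq_0_13 algebra_simps)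
  have rotA2: "?L (R + 1) (R - 1) (R - 1) 0 1 2 = q * A2"
    using lsum_rotate[of N "R + 1" "R - 1" "R - 1" 0 1 2] lsum_shift[of seed_weight N R R "R - 1" 0 1 1 3]
    by (simp add: A2_def)
  have rotD: "D = q * ?L (R + 1) R (R - 1) 0 1 3"
    using lsum_rotate[of N "R + 1" R "R - 1" 0 1 2] lsum_shift[of seed_weight N "R + 1" R "R - 1" 0 1 1 3]
    by (simp add: D_def algebra_simps)
  have rotD': "q * ?L (R + 1) R (R - 1) 0 2 3 = D"
    using lsum_rotate[of N "R + 1" R "R - 1" 0 2 3] lsum_shift[of seed_weight N "R + 1" R "R - 1" 0 2 1 2] q_nonzero
    by (simp add: D_def field_simps)
  have R6: "D - q * t * D1 = q * A2"
    using lsum_pascal2[of seed_weight N "R + 1" R "R - 1" 0 1 2] rotA2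
    by (simp add: D_def D1_def T lsum_eq_0_23)
  have R7: "D1 - q * t * D = U * A1"
    using lsum_pascal1[of seed_weight N "R + 1" R "R - 1" 0 0 2] rotD
      lsum_shift[of seed_weight N "R + 1" R "R - 1" "-1" 1 0 2]
      lsum_shift[of seed_weight N "R + 1" R "R - 1" "-1" 1 0 2]
      lsum_swap12[of seed_weight N R R "R - 1" 1 0 2]
    by (simp add: D1_def A1_def T' U_def lsum_eq_0_12 mult_ac)
  define E where "E = ?L (R + 1) R (R - 1) (-1) 1 2"
  have "D - q * (q * t) * E = A1"
    using lsum_pascal1[of seed_weight N "R + 1" R "R - 1" 0 1 2]
    by (simp add: D_def A1_def E_def T' lsum_eq_0_12 mult_ac)
  moreover have "q * E = D"
    using rotD' lsum_shift[of seed_weight N "R + 1" R "R - 1" "-1" 1 1 2] by (simp add: E_def)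
  moreover have "q * (q * t) * E = q * t * (q * E)"
    by (simp add: mult_ac)
  ultimately have R8: "D - q * t * D = A1"
    by simp
  \<comment> \<open>\<open>R2\<close> and \<open>R3\<close> express \<open>A\<close> in two ways
    with the common factor \<open>q * U\<close>, whence \<open>C = A1\<close>. Everything else is
    then a multiple of \<open>A1\<close>: \<open>B0\<close> with factor
    \<open>(1 - U) (1 - q t U)\<close> and \<open>B1\<close> with factor
    \<open>(1 - t) (1 - q t U)\<close>.\<close>
  have "q * U \<noteq> 0"
    using q_nonzero by (simp add: U_def)
  with R2 R3 have C: "C = A1"
    by simp
  have "q * A2 = A1 + q * t * A1 - q * t * (U * A1)"
    using R6 R7 R8 by algebra
  then have "B0 = A1 * (1 - U) * (1 - q * t * U)"
    using R1 by algebra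
  moreover have "B1 = A1 * (1 - t) * (1 - q * t * U)"
    using R4 R5 R2 C by algebra
  ultimately have "(1 - t) * B0 = (1 - U) * B1"
    by simp
  then show ?thesis
    by (simp add: t_def U_def B0_def B1_def)
qed

text \<open>Iterates \<open>seed_lsum_step\<close>. Its factor \<open>1 - q^(R-1)\<close> vanishes
  at \<open>R = 1\<close>, so the recursion gives no information there and this case is evaluated
  directly.\<close>

lemma seed_lsum:
  assumes "R \<ge> 1"
  shows "q powi 2 * lsum seed_weight N R R R 0 1 2 = G N * G (N - 1) * (G (R - 1) * G (N - R - 1))"
  using assms
proof (induction R rule: int_ge_induct)
  case base
  define V :: "(int \<times> int) set" where
    "V = {(0,0),(1,1),(1,-2),(-2,1),(1,0),(0,1),(1,-1),(-1,1),(0,-1),(-1,0)}"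
  have "lsupp N 1 1 1 \<subseteq> V"
  proof
    fix v assume "v \<in> lsupp N 1 1 1"
    then obtain x y where v: "v = (x, y)" and xy: "x \<le> 1" "y \<le> 1" "- (x + y) \<le> 1"
      by (auto simp: lsupp_def)
    then have "x = 1 \<or> x = 0 \<or> x = -1 \<or> x = -2" "y = 1 \<or> y = 0 \<or> y = -1 \<or> y = -2"
      by auto
    then show "v \<in> V"
      by (elim disjE) (use xy in \<open>simp_all add: v V_def\<close>)
  qed
  moreover have "finite V"
    by (simp add: V_def)
  ultimately have "lsum seed_weight N 1 1 1 0 1 2 = sum (lterm seed_weight N 1 1 1 0 1 2) V"
    by (simp add: lsum_superset)
  \<comment> \<open>Of the ten vectors only the six roots have \<open>chi\<close> nonzero, and they
    all have weight 1. Their alternating sum is, up to a power of \<open>q\<close>, the Weyl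
    denominator of \<open>A2\<close>, which factors as \<open>(1 - q)^2 (1 - q^2)\<close>.\<close>
  also have "\<dots> = (q powi (-2) - 2 * q powi (-1) + 2 * q - q powi 2) * (qbin N 0 * qbin N 1 * qbin N 2)"
    by (simp add: V_def lterm_def chi_def seed_weight_def algebra_simps)
  also have "qbin N 0 * qbin N 1 * qbin N 2 = G N * G (N - 1) * G (N - 2) * (G 1 * G 2)"
    by (simp add: qbin_def mult_ac)
  finally have "q powi 2 * lsum seed_weight N 1 1 1 0 1 2
     = (q powi 2 * (q powi (-2) - 2 * q powi (-1) + 2 * q - q powi 2)) * (G 1 * G 2) * (G N * G (N - 1) * G (N - 2))"
    by (simp add: mult_ac)
  also have "q powi 2 * (q powi (-2) - 2 * q powi (-1) + 2 * q - q powi 2) = (1 - q) * ((1 - q) * (1 - q powi 2))"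
  proof -
    have "q powi 2 = q * q" "q powi (-1) = inverse q" "q powi (-2) = inverse q * inverse q"
      by (simp_all add: power_int_minus power2_eq_square)
    moreover have "inverse q * q = 1"
      using q_nonzero by simp
    ultimately show ?thesis
      by algebra
  qed
  also have "(1 - q) * ((1 - q) * (1 - q powi 2)) * (G 1 * G 2) = (1 - q) * G 1 * ((1 - q) * ((1 - q powi 2) * G 2))"
    by (simp add: mult_ac)
  also have "\<dots> = 1"
    using iqfac_step[of 1] iqfac_step[of 2] by simp
  finally show ?case
    by simp
next
  case (step R)
  have "(1 - q powi R) * lsum seed_weight N (R + 1) (R + 1) (R + 1) 0 1 2
     = (1 - q powi (N - R - 1)) * lsum seed_weight N R R R 0 1 2"
    using seed_lsum_step[of "R + 1" N] by (simp add: diff_diff_eq)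
  then have "(1 - q powi R) * (q powi 2 * lsum seed_weight N (R + 1) (R + 1) (R + 1) 0 1 2)
     = (1 - q powi (N - R - 1)) * (q powi 2 * lsum seed_weight N R R R 0 1 2)"
    by (metis mult.left_commute)
  also have "\<dots> = (1 - q powi R) * (G N * G (N - 1) * (G R * G (N - R - 2)))"
  proof -
    have "G (N - R - 2) = (1 - q powi (N - R - 1)) * G (N - R - 1)"
      using iqfac_step[of "N - R - 1"] by (simp add: algebra_simps)
    then show ?thesis
      unfolding step.IH iqfac_step[of R] by (simp only: mult_ac)
  qed
  finally have "q powi 2 * lsum seed_weight N (R + 1) (R + 1) (R + 1) 0 1 2 = G N * G (N - 1) * (G R * G (N - R - 2))"
    using q_power_neq_1[of R] step.hyps by simp
  then show ?case
    by (simp add: algebra_simps)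
qed

end

section \<open>Expansion of the iterated seed\<close>

context not_root_of_unity_char_neq_2
begin

text \<open>With \<open>z = - x - y\<close> the parameters \<open>1 - x, 1 - y, 1 - z\<close> have
  sum 3, as the step with \<open>e = 1\<close> requires. For \<open>e = 0\<close> the sum must be 1,
  and \<open>kernA\<close> below uses \<open>1 - x, - y, - z\<close>, which singles out the first
  coordinate.\<close>

definition kernB :: "int \<Rightarrow> int \<Rightarrow> int \<Rightarrow> int \<Rightarrow> 'a" where
  "kernB x y = kern 2 (1 - x) (1 - y) (1 + x + y)"

definition kernA :: "int \<Rightarrow> int \<Rightarrow> int \<Rightarrow> int \<Rightarrow> 'a" where
  "kernA x y = kern 1 (1 - x) (- y) (x + y)"

definition ksupp :: "int \<Rightarrow> int \<Rightarrow> (int \<times> int) set" where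
  "ksupp r s = {(x, y). - s - 1 \<le> x \<and> x \<le> r + 1 \<and> - s - 1 \<le> y \<and> y \<le> r + 1
     \<and> - s - 1 \<le> - (x + y) \<and> - (x + y) \<le> r + 1}"

lemma ksupp_eq: "ksupp r s = lsupp (r + s + 2) (r + 1) (r + 1) (r + 1)"
  by (auto simp: ksupp_def lsupp_def)

lemma finite_ksupp: "finite (ksupp r s)"
  by (simp add: ksupp_eq finite_lsupp)

lemma ksupp_mono: "r \<le> r' \<Longrightarrow> s \<le> s' \<Longrightarrow> ksupp r s \<subseteq> ksupp r' s'"
  by (auto simp: ksupp_def)

lemma kernB_eq:
  "kernB x y r s = F (r + s + 2) * (qbin (r + s + 2) (r + 1 - x) * qbin (r + s + 2) (r + 1 - y)
     * qbin (r + s + 2) (r + 1 + (x + y)))"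
  by (simp add: kernB_def kern_def qbin_def algebra_simps)

lemma kernA_eq:
  "kernA x y r s = F (r + s + 1) * ((1 - q powi (r + 1 - y)) * (1 - q powi (r + 1 + x + y)) * (1 - q powi (s + 1 + x)))
     * (qbin (r + s + 2) (r + 1 - x) * qbin (r + s + 2) (r + 1 - y)
     * qbin (r + s + 2) (r + 1 + (x + y)))"
proof -
  have "G (r - y) = (1 - q powi (r + 1 - y)) * G (r + 1 - y)"
    "G (r + x + y) = (1 - q powi (r + 1 + x + y)) * G (r + 1 + x + y)"
    "G (s + x) = (1 - q powi (s + 1 + x)) * G (s + 1 + x)"
    using iqfac_step[of "r + 1 - y"] iqfac_step[of "r + 1 + x + y"] iqfac_step[of "s + 1 + x"]
    by (simp_all add: algebra_simps)
  moreover have "kernA x y r s = F (r + s + 1) * (G (r + 1 - x) * G (r - y) * G (r + x + y))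
     * (G (s + x) * G (s + 1 + y) * G (s + 1 - x - y))"
    by (simp add: kernA_def kern_def algebra_simps)
  moreover have "qbin (r + s + 2) (r + 1 - x) = G (r + 1 - x) * G (s + 1 + x)"
    "qbin (r + s + 2) (r + 1 - y) = G (r + 1 - y) * G (s + 1 + y)"
    "qbin (r + s + 2) (r + 1 + (x + y)) = G (r + 1 + x + y) * G (s + 1 - x - y)"
    by (simp_all add: qbin_def algebra_simps)
  ultimately show ?thesis
    by (simp only: mult_ac)
qed

lemma sum_kernB:
  assumes "finite V" "ksupp r s \<subseteq> V"
  shows "(\<Sum>(x, y)\<in>V. chi (x - y) * w (x * x + x * y + y * y) * q powi (- 2 * x - y) * kernB x y r s)
    = F (r + s + 2) * lsum w (r + s + 2) (r + 1) (r + 1) (r + 1) 0 1 2"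
proof -
  have "lsum w (r + s + 2) (r + 1) (r + 1) (r + 1) 0 1 2 = sum (lterm w (r + s + 2) (r + 1) (r + 1) (r + 1) 0 1 2) V"
    using assms by (intro lsum_superset[symmetric]) (simp_all add: ksupp_eq)
  then show ?thesis
  proof (simp only: sum_distrib_left, intro sum.cong refl, clarify)
    fix x y :: int
    have "0 * x + 1 * y - 2 * (x + y) = - 2 * x - y"
      by simp
    then show "chi (x - y) * w (x * x + x * y + y * y) * q powi (- 2 * x - y) * kernB x y r s
      = F (r + s + 2) * lterm w (r + s + 2) (r + 1) (r + 1) (r + 1) 0 1 2 (x, y)"
      unfolding lterm_def kernB_eq case_prod_conv by (simp only: mult_ac)
  qed
qed

text \<open>
  The quotient of the two kernels expands into eight monomials. Five of them give sums that vanish by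
  antisymmetry, and one cancels against part of the leading term, whatever the weight \<open>w\<close> is.
\<close>

lemma sum_kernA_eq_sum_kernB:
  assumes "finite V" "ksupp r s \<subseteq> V" "r \<ge> 0" "s \<ge> 0"
  shows "(\<Sum>(x, y)\<in>V. chi (x - y) * w (x * x + x * y + y * y) * q powi (- 2 * x - y) * kernA x y r s)
    = (\<Sum>(x, y)\<in>V. chi (x - y) * w (x * x + x * y + y * y) * q powi (- 2 * x - y) * kernB x y r s)"
proof -
  define N where "N = r + s + 2"
  define R where "R = r + 1"
  let ?T = "lterm w N R R R" and ?L = "lsum w N R R R"
  define T where "T = q powi R"
  define U where "U = q powi (s + 1)"
  have TU: "T * U = q powi N"
    unfolding T_def U_def powi_add[symmetric] by (simp add: R_def N_def add_ac)
  have L: "sum (?T m1 m2 m3) V = ?L m1 m2 m3" for m1 m2 m3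
    using assms by (intro lsum_superset) (simp_all add: ksupp_eq N_def R_def)
  have "(\<Sum>(x, y)\<in>V. chi (x - y) * w (x * x + x * y + y * y) * q powi (- 2 * x - y) * kernA x y r s)
     = (\<Sum>v\<in>V. F (N - 1) * (?T 0 1 2 v - T * ?T 0 0 2 v - T * ?T 0 1 1 v + T * T * ?T 0 0 1 v
         - U * ?T 1 1 2 v + T * U * ?T 1 0 2 v + T * U * ?T 1 1 1 v - T * T * U * ?T 1 0 1 v))"
  proof (rule sum.cong[OF refl])
    fix v :: "int \<times> int"
    obtain x y where v: "v = (x, y)"
      by fastforce
    define X where "X = q powi x"
    define Y where "Y = q powi y"
    define i where "i = inverse X"
    define j where "j = inverse Y"
    have nz: "X \<noteq> 0" "Y \<noteq> 0"
      by (simp_all add: X_def Y_def q_nonzero)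
    have q_xy: "q powi (m * x + n * y) = X powi m * Y powi n" for m n
      by (simp add: X_def Y_def powi_add power_int_mult[symmetric] mult.commute)
    have "0 * x + 1 * y - 2 * (x + y) = (-2) * x + (-1) * y" "0 * x + 0 * y - 2 * (x + y) = (-2) * x + (-2) * y"
      "0 * x + 1 * y - 1 * (x + y) = (-1) * x + 0 * y" "0 * x + 0 * y - 1 * (x + y) = (-1) * x + (-1) * y"
      "1 * x + 1 * y - 2 * (x + y) = (-1) * x + (-1) * y" "1 * x + 0 * y - 2 * (x + y) = (-1) * x + (-2) * y"
      "1 * x + 1 * y - 1 * (x + y) = 0 * x + 0 * y" "1 * x + 0 * y - 1 * (x + y) = 0 * x + (-1) * y"
      "- 2 * x - y = (-2) * x + (-1) * y"
      by simp_all
    note exps = this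
    have p: "q powi (0 * x + 1 * y - 2 * (x + y)) = i * i * j"
      "q powi (0 * x + 0 * y - 2 * (x + y)) = i * i * j * j" "q powi (0 * x + 1 * y - 1 * (x + y)) = i"
      "q powi (0 * x + 0 * y - 1 * (x + y)) = i * j" "q powi (1 * x + 1 * y - 2 * (x + y)) = i * j"
      "q powi (1 * x + 0 * y - 2 * (x + y)) = i * j * j" "q powi (1 * x + 1 * y - 1 * (x + y)) = 1"
      "q powi (1 * x + 0 * y - 1 * (x + y)) = j" "q powi (- 2 * x - y) = i * i * j"
      unfolding exps q_xy by (simp_all add: i_def j_def power_int_minus power2_eq_square)
    have c: "q powi (r + 1 - y) = T * j" "q powi (r + 1 + x + y) = T * (X * Y)" "q powi (s + 1 + x) = U * X"
      by (simp_all add: T_def U_def R_def X_def Y_def j_def powi_add power_int_diff q_nonzero divide_inverse)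
    have XY: "i * X = 1" "j * Y = 1"
      using nz by (simp_all add: i_def j_def)
    define b where "b = chi (x - y) * w (x * x + x * y + y * y) * (qbin N (R - x) * qbin N (R - y) * qbin N (R + (x + y)))"
    have "chi (x - y) * w (x * x + x * y + y * y) * q powi (- 2 * x - y) * kernA x y r s
      = F (N - 1) * b * (i * i * j * ((1 - T * j) * (1 - T * (X * Y)) * (1 - U * X)))"
    proof -
      have "r + s + 1 = N - 1" "r + s + 2 = N"
        by (simp_all add: N_def)
      then show ?thesis
        unfolding kernA_eq c p b_def R_def by (simp only: mult_ac)
    qed
    also have "i * i * j * ((1 - T * j) * (1 - T * (X * Y)) * (1 - U * X))
      = i * i * j - T * (i * i * j * j) - T * i + T * T * (i * j) - U * (i * j) + T * U * (i * j * j) + T * U - T * T * U * j"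
      using XY by algebra
    finally show "(case v of (x, y) \<Rightarrow> chi (x - y) * w (x * x + x * y + y * y) * q powi (- 2 * x - y) * kernA x y r s)
      = F (N - 1) * (?T 0 1 2 v - T * ?T 0 0 2 v - T * ?T 0 1 1 v + T * T * ?T 0 0 1 v
         - U * ?T 1 1 2 v + T * U * ?T 1 0 2 v + T * U * ?T 1 1 1 v - T * T * U * ?T 1 0 1 v)"
      unfolding v lterm_def case_prod_conv p b_def by (simp only: algebra_simps mult_1_right mult_1_left)
  qed
  also have "\<dots> = F (N - 1) * (?L 0 1 2 - T * ?L 0 0 2 - T * ?L 0 1 1 + T * T * ?L 0 0 1
         - U * ?L 1 1 2 + T * U * ?L 1 0 2 + T * U * ?L 1 1 1 - T * T * U * ?L 1 0 1)"
    unfolding L[symmetric] by (simp only: sum_distrib_left[symmetric] sum.distrib sum_subtractf)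
  \<comment> \<open>Sums with two equal values among \<open>m1\<close>, \<open>m2\<close>,
    \<open>m3\<close> vanish, which leaves \<open>?L 0 1 2\<close> and
    \<open>?L 1 0 2 = - ?L 0 1 2\<close>. As \<open>T * U = q^N\<close>, the factor
    \<open>1 - q^N\<close> results and raises \<open>F (N - 1)\<close> to
    \<open>F N\<close>.\<close>
  also have "\<dots> = F (N - 1) * (1 - q powi N) * ?L 0 1 2"
    using lsum_swap12[of w N R R R 1 0 2]
    by (simp add: lsum_eq_0_12 lsum_eq_0_23 lsum_eq_0_13 TU algebra_simps)
  also have "F (N - 1) * (1 - q powi N) = F N"
    using assms by (intro qfac_step[symmetric]) (simp add: N_def)
  also have "F N * ?L 0 1 2 = (\<Sum>(x, y)\<in>V. chi (x - y) * w (x * x + x * y + y * y) * q powi (- 2 * x - y) * kernB x y r s)"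
    unfolding N_def R_def by (rule sum_kernB[symmetric]) (use assms in auto)
  finally show ?thesis .
qed

definition seed :: "int \<Rightarrow> int \<Rightarrow> 'a" where
  "seed n m = F (2 * n) * G m * G (2 * n - m) * G n"

text \<open>
  The sum over all lattice vectors is finite, as \<open>K x y r s\<close> vanishes off \<open>ksupp r s\<close>; a finite superset \<open>V\<close> in
  place of the support allows the same index set for all \<open>r\<close> and \<open>s\<close> below given bounds.
\<close>

definition expands :: "(int \<Rightarrow> int \<Rightarrow> 'a) \<Rightarrow> (int \<Rightarrow> int \<Rightarrow> int \<Rightarrow> int \<Rightarrow> 'a) \<Rightarrow> (int \<Rightarrow> int \<Rightarrow> 'a) \<Rightarrow> bool" where
  "expands h K c \<longleftrightarrow> (\<forall>r s V. r \<ge> 0 \<longrightarrow> s \<ge> 0 \<longrightarrow> finite V \<longrightarrow> ksupp r s \<subseteq> V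
     \<longrightarrow> two_sided h r s = (\<Sum>(x, y)\<in>V. c x y * K x y r s))"

text \<open>Combines \<open>two_sided_seed\<close> with \<open>seed_lsum\<close> for
  \<open>N = r + s + 2\<close> and \<open>R = r + 1\<close>, where the factor \<open>F N\<close> of
  \<open>kernB\<close> cancels \<open>G N\<close>.\<close>

lemma seed_expands:
  "expands seed kernB (\<lambda>x y. chi (x - y) * q powi ((4 * (x * x + x * y + y * y) - 4) div 3 + (2 - 2 * x - y)))"
  unfolding expands_def
proof (intro allI impI)
  fix r s :: int and V :: "(int \<times> int) set"
  assume *: "r \<ge> 0" "s \<ge> 0" "finite V" "ksupp r s \<subseteq> V"
  have "q powi 2 * (\<Sum>(x, y)\<in>V. chi (x - y) * seed_weight (x * x + x * y + y * y) * q powi (- 2 * x - y) * kernB x y r s)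
     = F (r + s + 2) * (q powi 2 * lsum seed_weight (r + s + 2) (r + 1) (r + 1) (r + 1) 0 1 2)"
    by (subst sum_kernB) (use * in \<open>simp_all add: mult_ac\<close>)
  also have "\<dots> = F (r + s + 2) * (G (r + s + 2) * G (r + s + 2 - 1) * (G (r + 1 - 1) * G (r + s + 2 - (r + 1) - 1)))"
    using * by (subst seed_lsum) simp_all
  also have "\<dots> = (F (r + s + 2) * G (r + s + 2)) * (G r * G s * G (r + s + 1))"
    by (simp add: mult_ac add_ac)
  also have "\<dots> = two_sided seed r s"
    using two_sided_seed[of r s] * by (simp add: qfac_iqfac seed_def[abs_def])
  finally have "two_sided seed r s
    = (\<Sum>(x, y)\<in>V. q powi 2 * (chi (x - y) * seed_weight (x * x + x * y + y * y) * q powi (- 2 * x - y) * kernB x y r s))"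
    by (simp add: sum_distrib_left case_prod_unfold)
  also have "\<dots> = (\<Sum>(x, y)\<in>V. chi (x - y) * q powi ((4 * (x * x + x * y + y * y) - 4) div 3 + (2 - 2 * x - y)) * kernB x y r s)"
  proof (rule sum.cong[OF refl], clarify)
    fix x y :: int
    have "2 - 2 * x - y = 2 + (- 2 * x - y)"
      by simp
    then have "q powi (2 - 2 * x - y) = q powi 2 * q powi (- 2 * x - y)"
      by (metis powi_add)
    then show "q powi 2 * (chi (x - y) * seed_weight (x * x + x * y + y * y) * q powi (- 2 * x - y) * kernB x y r s)
      = chi (x - y) * q powi ((4 * (x * x + x * y + y * y) - 4) div 3 + (2 - 2 * x - y)) * kernB x y r s"
      unfolding seed_weight_def powi_add by (simp only: mult_ac)
  qed
  finally show "two_sided seed r s = (\<Sum>(x, y)\<in>V. chi (x - y)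
      * q powi ((4 * (x * x + x * y + y * y) - 4) div 3 + (2 - 2 * x - y)) * kernB x y r s)" .
qed

text \<open>The eigenvalue identity wants summation ranges that start at \<open>- a2\<close> and
  \<open>a1 - c\<close>, the operator sums from 0. Both agree once the kernel is supported in the
  nonnegative quadrant.\<close>

lemma kern_eigenfunction_nonneg:
  assumes nonneg: "\<And>r s. kern c a1 a2 a3 r s \<noteq> 0 \<Longrightarrow> 0 \<le> r \<and> 0 \<le> s"
    and e: "a1 + a2 + a3 - c = e" "2 * c - (a1 + a2 + a3) = 1"
  shows "two_sided_step e (kern c a1 a2 a3) L1 L2
    = q powi (- a2 * a3 - (c - a1) * (c - a2 - a3)) * kern c a1 a2 a3 L1 L2"
proof -
  define I where "I = {0..L1} \<union> {-a2..L1}"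
  define J where "J = {0..L2} \<union> {a1-c..L2}"
  define f where "f r s = q powi (r * r - r * s + s * s + e * r + s) * G (L1 - r) * G (L2 - s) * kern c a1 a2 a3 r s" for r s
  have "two_sided_step e (kern c a1 a2 a3) L1 L2 = (\<Sum>r\<in>{0..L1}. \<Sum>s\<in>{0..L2}. f r s)"
    by (simp add: two_sided_step_def f_def)
  also have "\<dots> = (\<Sum>r\<in>{0..L1}. \<Sum>s\<in>J. f r s)"
  proof (rule sum.cong[OF refl], rule sum.mono_neutral_left)
    fix r show "\<forall>s\<in>J - {0..L2}. f r s = 0"
      using nonneg by (auto simp: J_def f_def)
  qed (auto simp: J_def)
  also have "\<dots> = (\<Sum>r\<in>I. \<Sum>s\<in>J. f r s)"
  proof (rule sum.mono_neutral_left)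
    show "\<forall>r\<in>I - {0..L1}. (\<Sum>s\<in>J. f r s) = 0"
      using nonneg by (auto simp: I_def f_def intro!: sum.neutral)
  qed (auto simp: I_def)
  also have "\<dots> = q powi (- a2 * a3 - (c - a1) * (c - a2 - a3)) * kern c a1 a2 a3 L1 L2"
  proof -
    have "finite I" "{-a2..L1} \<subseteq> I" "finite J" "{a1-c..L2} \<subseteq> J"
      by (auto simp: I_def J_def)
    from kern_eigenfunction[OF this, of a3] show ?thesis
      unfolding f_def e by simp
  qed
  finally show ?thesis .
qed

text \<open>The operator is linear, and a set containing \<open>ksupp L1 L2\<close> contains every
  smaller support, so one \<open>V\<close> serves all \<open>r\<close> and \<open>s\<close> that
  occur. The eigenfunction property is asked only where \<open>c x y\<close> is nonzero, because the
  argument for \<open>kernB\<close> excludes the zero vector.\<close>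

lemma expands_step:
  assumes "expands h K c"
    and K: "\<And>x y. c x y \<noteq> 0 \<Longrightarrow> two_sided_step e (K x y) = (\<lambda>r s. q powi (g x y) * K x y r s)"
  shows "expands (one_sided_step e h) K (\<lambda>x y. c x y * q powi g x y)"
  unfolding expands_def
proof (intro allI impI)
  fix L1 L2 :: int and V :: "(int \<times> int) set"
  assume *: "L1 \<ge> 0" "L2 \<ge> 0" "finite V" "ksupp L1 L2 \<subseteq> V"
  define f where "f r s = q powi (r * r - r * s + s * s + e * r + s) * G (L1 - r) * G (L2 - s)" for r s
  have "two_sided (one_sided_step e h) L1 L2 = (\<Sum>r\<in>{0..L1}. \<Sum>s\<in>{0..L2}. f r s * two_sided h r s)"
    by (simp add: two_sided_step_two_sided two_sided_step_def f_def)
  also have "\<dots> = (\<Sum>r\<in>{0..L1}. \<Sum>s\<in>{0..L2}. \<Sum>v\<in>V. c (fst v) (snd v) * (f r s * K (fst v) (snd v) r s))"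
  proof (intro sum.cong refl)
    fix r s assume rs: "r \<in> {0..L1}" "s \<in> {0..L2}"
    then have "ksupp r s \<subseteq> V"
      using ksupp_mono[of r L1 s L2] * by auto
    then have "two_sided h r s = (\<Sum>(x, y)\<in>V. c x y * K x y r s)"
      using assms(1) rs * unfolding expands_def by simp
    then show "f r s * two_sided h r s = (\<Sum>v\<in>V. c (fst v) (snd v) * (f r s * K (fst v) (snd v) r s))"
      by (simp add: sum_distrib_left case_prod_unfold mult_ac)
  qed
  also have "\<dots> = (\<Sum>r\<in>{0..L1}. \<Sum>v\<in>V. \<Sum>s\<in>{0..L2}. c (fst v) (snd v) * (f r s * K (fst v) (snd v) r s))"
    by (rule sum.cong[OF refl], rule sum.swap)
  also have "\<dots> = (\<Sum>v\<in>V. \<Sum>r\<in>{0..L1}. \<Sum>s\<in>{0..L2}. c (fst v) (snd v) * (f r s * K (fst v) (snd v) r s))"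
    by (rule sum.swap)
  also have "\<dots> = (\<Sum>v\<in>V. c (fst v) (snd v) * two_sided_step e (K (fst v) (snd v)) L1 L2)"
    by (simp only: two_sided_step_def f_def sum_distrib_left mult.assoc)
  also have "\<dots> = (\<Sum>v\<in>V. c (fst v) (snd v) * q powi g (fst v) (snd v) * K (fst v) (snd v) L1 L2)"
  proof (intro sum.cong refl)
    fix v
    show "c (fst v) (snd v) * two_sided_step e (K (fst v) (snd v)) L1 L2
      = c (fst v) (snd v) * q powi g (fst v) (snd v) * K (fst v) (snd v) L1 L2"
      using K[of "fst v" "snd v"] by (cases "c (fst v) (snd v) = 0") (simp_all add: mult_ac)
  qed
  finally show "two_sided (one_sided_step e h) L1 L2 = (\<Sum>(x, y)\<in>V. c x y * q powi g x y * K x y L1 L2)"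
    by (simp add: case_prod_unfold)
qed

text \<open>A nonzero vector with sum zero has an entry at least 1, which forces
  \<open>r >= 0\<close> on the support of the kernel, and an entry at most -1, which forces
  \<open>s >= 0\<close>. A nonzero \<open>chi\<close> excludes the zero vector.\<close>

lemma kernB_step:
  assumes "chi (x - y) \<noteq> (0 :: 'a)"
  shows "two_sided_step 1 (kernB x y) = (\<lambda>r s. q powi (x * x + x * y + y * y - 1) * kernB x y r s)"
proof (intro ext)
  fix r s
  have xy: "\<not> (x = 0 \<and> y = 0)"
    using assms by (auto simp: chi_def)
  have "0 \<le> r \<and> 0 \<le> s" if "kern 2 (1 - x) (1 - y) (1 + x + y) r s \<noteq> 0" for r s
  proof -
    have "G (r + (1 - x)) \<noteq> 0" "G (r + (1 - y)) \<noteq> 0" "G (r + (1 + x + y)) \<noteq> 0"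
      "G (s + 2 - (1 - x)) \<noteq> 0" "G (s + 2 - (1 - y)) \<noteq> 0" "G (s + 2 - (1 + x + y)) \<noteq> 0"
      using that by (auto simp: kern_def)
    then have "\<not> r + (1 - x) < 0" "\<not> r + (1 - y) < 0" "\<not> r + (1 + x + y) < 0"
      "\<not> s + 2 - (1 - x) < 0" "\<not> s + 2 - (1 - y) < 0" "\<not> s + 2 - (1 + x + y) < 0"
      using iqfac_neg by blast+
    with xy show ?thesis
      by linarith
  qed
  then have "two_sided_step 1 (kernB x y) r s
    = q powi (- (1 - y) * (1 + x + y) - (2 - (1 - x)) * (2 - (1 - y) - (1 + x + y))) * kernB x y r s"
    unfolding kernB_def by (intro kern_eigenfunction_nonneg) auto
  also have "- (1 - y) * (1 + x + y) - (2 - (1 - x)) * (2 - (1 - y) - (1 + x + y)) = x * x + x * y + y * y - 1"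
    by (simp add: algebra_simps)
  finally show "two_sided_step 1 (kernB x y) r s = q powi (x * x + x * y + y * y - 1) * kernB x y r s" .
qed

text \<open>On the support of the kernel, adding the three lower bounds for \<open>r\<close> gives
  \<open>3 r + 1 >= 0\<close> and adding those for \<open>s\<close> gives
  \<open>3 s + 2 >= 0\<close>. Over the integers both variables are thus nonnegative, for every
  lattice vector.\<close>

lemma kernA_step: "two_sided_step 0 (kernA x y) = (\<lambda>r s. q powi (x * x + x * y + y * y - x) * kernA x y r s)"
proof (intro ext)
  fix r s
  have "0 \<le> r \<and> 0 \<le> s" if "kern 1 (1 - x) (- y) (x + y) r s \<noteq> 0" for r s
  proof -
    have "G (r + (1 - x)) \<noteq> 0" "G (r + - y) \<noteq> 0" "G (r + (x + y)) \<noteq> 0"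
      "G (s + 1 - (1 - x)) \<noteq> 0" "G (s + 1 - - y) \<noteq> 0" "G (s + 1 - (x + y)) \<noteq> 0"
      using that by (auto simp: kern_def)
    then have "\<not> r + (1 - x) < 0" "\<not> r + - y < 0" "\<not> r + (x + y) < 0"
      "\<not> s + 1 - (1 - x) < 0" "\<not> s + 1 - - y < 0" "\<not> s + 1 - (x + y) < 0"
      using iqfac_neg by blast+
    then show ?thesis
      by linarith
  qed
  then have "two_sided_step 0 (kernA x y) r s
    = q powi (- (- y) * (x + y) - (1 - (1 - x)) * (1 - (- y) - (x + y))) * kernA x y r s"
    unfolding kernA_def by (intro kern_eigenfunction_nonneg) auto
  also have "- (- y) * (x + y) - (1 - (1 - x)) * (1 - (- y) - (x + y)) = x * x + x * y + y * y - x"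
    by (simp add: algebra_simps)
  finally show "two_sided_step 0 (kernA x y) r s = q powi (x * x + x * y + y * y - x) * kernA x y r s" .
qed

definition coeff_exponent :: "nat \<Rightarrow> nat \<Rightarrow> int \<Rightarrow> int \<Rightarrow> int" where
  "coeff_exponent a b x y = (4 * (x * x + x * y + y * y) - 4) div 3 + (2 - 2 * x - y)
     + int a * (x * x + x * y + y * y - 1) + int b * (x * x + x * y + y * y - x)"

lemma expands_iterate_B:
  "expands ((one_sided_step 1 ^^ a) seed) kernB (\<lambda>x y. chi (x - y) * q powi coeff_exponent a 0 x y)"
proof (induction a)
  case 0
  then show ?case
    using seed_expands by (simp add: coeff_exponent_def)
next
  case (Suc a)
  have "expands (one_sided_step 1 ((one_sided_step 1 ^^ a) seed)) kernB
     (\<lambda>x y. chi (x - y) * q powi coeff_exponent a 0 x y * q powi (x * x + x * y + y * y - 1))"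
    by (rule expands_step[OF Suc.IH]) (rule kernB_step, auto)
  moreover have "chi (x - y) * q powi coeff_exponent a 0 x y * q powi (x * x + x * y + y * y - 1)
      = chi (x - y) * q powi coeff_exponent (Suc a) 0 x y" for x y
    unfolding mult.assoc powi_add[symmetric] by (simp add: coeff_exponent_def algebra_simps)
  ultimately show ?case
    by simp
qed

text \<open>The kernel is exchanged at \<open>b = 0\<close>. The eigenvalues for
  \<open>e = 1\<close> depend on \<open>p = x^2 + x y + y^2\<close> alone, so the coefficients still
  have the form \<open>chi (x - y) * w p * q^(-2x-y)\<close> that the exchange demands. An
  eigenvalue \<open>q^(p-x)\<close> for \<open>e = 0\<close> destroys this form, hence the exchange
  precedes these steps.\<close>

theorem expands_iterate:
  "expands ((one_sided_step 0 ^^ b) ((one_sided_step 1 ^^ a) seed)) kernA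
     (\<lambda>x y. chi (x - y) * q powi coeff_exponent a b x y)"
proof (induction b)
  case 0
  show ?case
    unfolding expands_def
  proof (intro allI impI)
    fix r s :: int and V :: "(int \<times> int) set"
    assume *: "r \<ge> 0" "s \<ge> 0" "finite V" "ksupp r s \<subseteq> V"
    define w where "w p = q powi ((4 * p - 4) div 3 + 2 + int a * (p - 1))" for p
    have w: "chi (x - y) * q powi coeff_exponent a 0 x y
       = (chi (x - y) * w (x * x + x * y + y * y) * q powi (- 2 * x - y) :: 'a)" for x y
      unfolding w_def mult.assoc powi_add[symmetric] by (simp add: coeff_exponent_def algebra_simps)
    have "two_sided ((one_sided_step 1 ^^ a) seed) r s
      = (\<Sum>(x, y)\<in>V. chi (x - y) * q powi coeff_exponent a 0 x y * kernB x y r s)"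
      using expands_iterate_B[of a] * unfolding expands_def by blast
    also have "\<dots> = (\<Sum>(x, y)\<in>V. chi (x - y) * q powi coeff_exponent a 0 x y * kernA x y r s)"
      unfolding w by (rule sum_kernA_eq_sum_kernB[symmetric]) (use * in auto)
    finally show "two_sided ((one_sided_step 0 ^^ 0) ((one_sided_step 1 ^^ a) seed)) r s
      = (\<Sum>(x, y)\<in>V. chi (x - y) * q powi coeff_exponent a 0 x y * kernA x y r s)"
      by simp
  qed
next
  case (Suc b)
  have "expands (one_sided_step 0 ((one_sided_step 0 ^^ b) ((one_sided_step 1 ^^ a) seed))) kernA
     (\<lambda>x y. chi (x - y) * q powi coeff_exponent a b x y * q powi (x * x + x * y + y * y - x))"
    by (rule expands_step[OF Suc.IH]) (rule kernA_step)
  moreover have "chi (x - y) * q powi coeff_exponent a b x y * q powi (x * x + x * y + y * y - x)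
      = chi (x - y) * q powi coeff_exponent a (Suc b) x y" for x y
    unfolding mult.assoc powi_add[symmetric] by (simp add: coeff_exponent_def algebra_simps)
  ultimately show ?case
    by simp
qed

end

section \<open>Infinite products of formal power series\<close>

definition fps_agree :: "nat \<Rightarrow> rat fps \<Rightarrow> rat fps \<Rightarrow> bool" where
  "fps_agree d f g \<longleftrightarrow> (\<forall>i\<le>d. f $ i = g $ i)"

lemma fps_agree_refl [simp]: "fps_agree d f f"
  by (simp add: fps_agree_def)

lemma fps_agree_sym: "fps_agree d f g \<Longrightarrow> fps_agree d g f"
  by (simp add: fps_agree_def)

lemma fps_agree_trans [trans]: "fps_agree d f g \<Longrightarrow> fps_agree d g h \<Longrightarrow> fps_agree d f h"
  by (simp add: fps_agree_def)

lemma fps_agree_mult: "fps_agree d f g \<Longrightarrow> fps_agree d f' g' \<Longrightarrow> fps_agree d (f * f') (g * g')"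
  by (auto simp: fps_agree_def fps_mult_nth intro!: sum.cong)

lemma fps_agree_sum: "(\<And>i. i \<in> I \<Longrightarrow> fps_agree d (f i) (g i)) \<Longrightarrow> fps_agree d (sum f I) (sum g I)"
  by (auto simp: fps_agree_def fps_sum_nth intro!: sum.cong)

lemma fps_agree_X_power_mult_0: "n > d \<Longrightarrow> fps_agree d (fps_X ^ n * f) 0"
  by (simp add: fps_agree_def fps_X_power_mult_nth)

lemma fps_eqI_agree: "(\<And>d. fps_agree d f g) \<Longrightarrow> f = g"
  by (auto simp: fps_agree_def fps_eq_iff)

definition qprod :: "nat \<Rightarrow> nat \<Rightarrow> nat \<Rightarrow> rat fps" where
  "qprod e K n = (\<Prod>i<n. 1 - fps_X ^ (e + K * i))"

lemma qprod_0 [simp]: "qprod e K 0 = 1"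
  by (simp add: qprod_def)

lemma qprod_Suc: "qprod e K (Suc n) = qprod e K n * (1 - fps_X ^ (e + K * n))"
  by (simp add: qprod_def)

lemma qprod_add: "qprod e K (m + n) = qprod e K m * qprod (e + K * m) K n"
  by (induction n) (simp_all add: qprod_Suc algebra_simps)

lemma qprod_nth_0: "e > 0 \<Longrightarrow> qprod e K n $ 0 = 1"
  by (induction n) (simp_all add: qprod_Suc)

lemma qprod_agree_1: "e > d \<Longrightarrow> fps_agree d (qprod e K n) 1"
proof (induction n)
  case (Suc n)
  have "fps_agree d (1 - fps_X ^ (e + K * n)) 1"
    using Suc.prems by (simp add: fps_agree_def)
  with Suc show ?case
    unfolding qprod_Suc using fps_agree_mult[of d "qprod e K n" 1] by fastforce
qed simp

lemma qprod_agree_qprod: "e + K * n > d \<Longrightarrow> n \<le> m \<Longrightarrow> fps_agree d (qprod e K m) (qprod e K n)"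
  using qprod_agree_1[of d "e + K * n" K "m - n"] qprod_add[of e K n "m - n"]
    fps_agree_mult[of d "qprod e K n" "qprod e K n" "qprod (e + K * n) K (m - n)" 1]
  by simp

abbreviation (input) qinf :: "nat \<Rightarrow> nat \<Rightarrow> rat fps" where
  "qinf e K \<equiv> qpoch_inf (fps_X ^ e) (fps_X ^ K)"

text \<open>The factor with index \<open>i\<close> differs from 1 only from order
  \<open>e + K * i\<close> on, so each coefficient of the partial products stabilises.
  \<open>P\<close> collects the stable values: the product of \<open>d + 1\<close> factors already
  has the final coefficient of order \<open>d\<close>.\<close>

lemma qinf_agree_qprod:
  assumes "e > 0" "K > 0" "e + K * n > d"
  shows "fps_agree d (qinf e K) (qprod e K n)"
proof -
  define P where "P = Abs_fps (\<lambda>d. qprod e K (Suc d) $ d)"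
  have P: "P $ i = qprod e K m $ i" if "e + K * m > i" for i m
  proof -
    have "e + K * Suc i > i"
      using assms by (cases K) auto
    then have "qprod e K (max m (Suc i)) $ i = qprod e K (Suc i) $ i"
      using qprod_agree_qprod[of i e K "Suc i" "max m (Suc i)"] by (simp add: fps_agree_def)
    moreover have "qprod e K (max m (Suc i)) $ i = qprod e K m $ i"
      using qprod_agree_qprod[of i e K m "max m (Suc i)"] that by (simp add: fps_agree_def)
    ultimately show ?thesis
      by (simp add: P_def)
  qed
  have "(\<lambda>m. \<Prod>i\<le>m. 1 - fps_X ^ e * (fps_X ^ K) ^ (i + 0)) \<longlonglongrightarrow> P"
  proof (rule tendsto_fpsI)
    fix i
    have "(\<Prod>j\<le>m. 1 - fps_X ^ e * (fps_X ^ K) ^ (j + 0)) = qprod e K (Suc m)" for m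
      by (simp add: qprod_def lessThan_Suc_atMost power_add power_mult)
    moreover have "P $ i = qprod e K (Suc m) $ i" if "m \<ge> i" for m
    proof (rule P)
      have "1 * Suc m \<le> K * Suc m"
        using assms by (intro mult_le_mono1) simp
      with that have "i < K * Suc m"
        by (metis le_imp_less_Suc less_le_trans mult_1)
      then show "e + K * Suc m > i"
        by (rule trans_less_add2)
    qed
    ultimately show "\<forall>\<^sub>F m in sequentially. (\<Prod>j\<le>m. 1 - fps_X ^ e * (fps_X ^ K) ^ (j + 0)) $ i = P $ i"
      unfolding eventually_sequentially by metis
  qed
  \<comment> \<open>\<open>raw_has_prod\<close> demands a nonzero limit; its index offset is the
    \<open>+ 0\<close> in the partial products above.\<close>
  moreover have "P \<noteq> 0"
    using P[of 0 0] assms by (metis add_pos_nonneg fps_zero_nth qprod_nth_0 zero_le zero_neq_one)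
  ultimately have "(\<lambda>i. 1 - fps_X ^ e * (fps_X ^ K) ^ i) has_prod P"
    by (simp add: has_prod_def raw_has_prod_def)
  then have "qinf e K = P"
    unfolding qpoch_inf_def by (rule has_prod_unique[symmetric])
  with P assms show ?thesis
    unfolding fps_agree_def by (metis le_less_trans)
qed

lemma qinf_agree_1: "e > d \<Longrightarrow> K > 0 \<Longrightarrow> fps_agree d (qinf e K) 1"
  using qinf_agree_qprod[of e K d 0] by simp

lemma qinf_split:
  assumes "e > 0" "K > 0"
  shows "qinf e K = qprod e K n * qinf (e + K * n) K"
proof (rule fps_eqI_agree)
  fix d
  have "d \<le> K * d"
    using assms by simp
  then have *: "e + K * (n + d) > d" "e + K * n + K * d > d"
    using assms unfolding distrib_left by linarith+
  have "fps_agree d (qinf e K) (qprod e K (n + d))"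
    using assms * by (intro qinf_agree_qprod)
  also have "qprod e K (n + d) = qprod e K n * qprod (e + K * n) K d"
    by (rule qprod_add)
  also have "fps_agree d \<dots> (qprod e K n * qinf (e + K * n) K)"
    using assms * by (intro fps_agree_mult fps_agree_refl fps_agree_sym[OF qinf_agree_qprod]) auto
  finally show "fps_agree d (qinf e K) (qprod e K n * qinf (e + K * n) K)" .
qed

lemma qinf_nth_0: "e > 0 \<Longrightarrow> K > 0 \<Longrightarrow> qinf e K $ 0 = 1"
  using qinf_agree_qprod[of e K 0 0] by (simp add: fps_agree_def)

lemma qinf_nonzero: "e > 0 \<Longrightarrow> K > 0 \<Longrightarrow> qinf e K \<noteq> 0"
  using qinf_nth_0[of e K] by auto

lemma inverse_qprod_mult_qinf:
  assumes "e > 0" "K > 0"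
  shows "inverse (qprod e K n) * qinf e K = qinf (e + K * n) K"
proof -
  have "inverse (qprod e K n) * qprod e K n = 1"
    using assms by (intro inverse_mult_eq_1) (simp add: qprod_nth_0)
  then have "inverse (qprod e K n) * (qprod e K n * qinf (e + K * n) K) = qinf (e + K * n) K"
    by (metis mult.assoc mult_1_left)
  then show ?thesis
    using qinf_split[OF assms, of n] by simp
qed

text \<open>Sorts the factors by their index modulo 3. Together with the triple product for modulus
  \<open>3 * K\<close> it yields Euler's pentagonal number theorem in the variable
  \<open>q^K\<close>.\<close>

lemma qinf_split_3:
  assumes "K > 0"
  shows "qinf K (3 * K) * qinf (2 * K) (3 * K) * qinf (3 * K) (3 * K) = qinf K K"
proof (rule fps_eqI_agree)
  fix d
  have "d \<le> K * d"
    using assms by simp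
  moreover have "(3 * K) * d = 3 * (K * d)" "K * (3 * d) = 3 * (K * d)"
    by simp_all
  ultimately have *: "e + (3 * K) * d > d" "K + K * (3 * d) > d" if "e > 0" for e
    using assms that by linarith+
  have eq: "qprod K (3 * K) n * qprod (2 * K) (3 * K) n * qprod (3 * K) (3 * K) n = qprod K K (3 * n)" for n
  proof (induction n)
    case (Suc n)
    have "3 * Suc n = Suc (Suc (Suc (3 * n)))"
      by simp
    then show ?case
      by (simp only: qprod_Suc Suc[symmetric]) (simp add: algebra_simps)
  qed simp
  have "fps_agree d (qinf K (3 * K) * qinf (2 * K) (3 * K) * qinf (3 * K) (3 * K))
     (qprod K (3 * K) d * qprod (2 * K) (3 * K) d * qprod (3 * K) (3 * K) d)"
    using assms * by (intro fps_agree_mult qinf_agree_qprod) auto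
  also have "fps_agree d \<dots> (qinf K K)"
    unfolding eq using assms * by (intro fps_agree_sym[OF qinf_agree_qprod]) auto
  finally show "fps_agree d (qinf K (3 * K) * qinf (2 * K) (3 * K) * qinf (3 * K) (3 * K)) (qinf K K)" .
qed

text \<open>
  The formal sum of the monomials \<open>c i q\<^bsup>e i\<^esup>\<close>, meaningful for \<open>admissible c e\<close>.
\<close>

definition mseries :: "('i \<Rightarrow> rat) \<Rightarrow> ('i \<Rightarrow> int) \<Rightarrow> rat fps" where
  "mseries c e = Abs_fps (\<lambda>d. \<Sum>i | c i \<noteq> 0 \<and> e i = int d. c i)"

definition admissible :: "('i \<Rightarrow> rat) \<Rightarrow> ('i \<Rightarrow> int) \<Rightarrow> bool" where
  "admissible c e \<longleftrightarrow> (\<forall>i. c i \<noteq> 0 \<longrightarrow> e i \<ge> 0) \<and> (\<forall>d. finite {i. c i \<noteq> 0 \<and> e i \<le> d})"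

lemma admissible_finite: "admissible c e \<Longrightarrow> finite {i. c i \<noteq> 0 \<and> e i = d}"
  unfolding admissible_def by (elim conjE allE[of _ d]) (erule rev_finite_subset, auto)

lemma admissible_times:
  assumes "admissible c e" "admissible c' e'"
  shows "admissible (\<lambda>(i, j). c i * c' j) (\<lambda>(i, j). e i + e' j)"
  unfolding admissible_def
proof safe
  fix i j assume "c i * c' j \<noteq> 0"
  then show "0 \<le> e i + e' j"
    using assms by (auto simp: admissible_def)
next
  fix d
  have "{x. (case x of (i, j) \<Rightarrow> c i * c' j) \<noteq> 0 \<and> (case x of (i, j) \<Rightarrow> e i + e' j) \<le> d}
     \<subseteq> {i. c i \<noteq> 0 \<and> e i \<le> d} \<times> {j. c' j \<noteq> 0 \<and> e' j \<le> d}"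
    using assms unfolding admissible_def by (fastforce dest: spec)
  then show "finite {x. (case x of (i, j) \<Rightarrow> c i * c' j) \<noteq> 0 \<and> (case x of (i, j) \<Rightarrow> e i + e' j) \<le> d}"
    by (rule finite_subset) (use assms in \<open>auto simp: admissible_def\<close>)
qed

lemma mseries_mult:
  assumes "admissible c e" "admissible c' e'"
  shows "mseries c e * mseries c' e' = mseries (\<lambda>(i, j). c i * c' j) (\<lambda>(i, j). e i + e' j)"
proof (rule fps_ext)
  fix d
  define A where "A k = {i. c i \<noteq> 0 \<and> e i = int k}" for k
  define B where "B k = {j. c' j \<noteq> 0 \<and> e' j = int k}" for k
  have fin: "finite (A k)" "finite (B k)" for k
    unfolding A_def B_def using assms by (simp_all add: admissible_finite)
  have "(mseries c e * mseries c' e') $ d = (\<Sum>k\<in>{0..d}. \<Sum>(i, j)\<in>A k \<times> B (d - k). c i * c' j)"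
    by (simp add: fps_mult_nth mseries_def A_def[symmetric] B_def[symmetric] sum_product sum.cartesian_product)
  also have "\<dots> = (\<Sum>(i, j)\<in>(\<Union>k\<in>{0..d}. A k \<times> B (d - k)). c i * c' j)"
    by (rule sum.UNION_disjoint[symmetric]) (auto simp: fin, auto simp: A_def)
  also have "(\<Union>k\<in>{0..d}. A k \<times> B (d - k)) = {x. (case x of (i, j) \<Rightarrow> c i * c' j) \<noteq> 0 \<and> (case x of (i, j) \<Rightarrow> e i + e' j) = int d}"
  proof safe
    fix i j assume ij: "c i * c' j \<noteq> 0" "e i + e' j = int d"
    then have "e i \<ge> 0" "e' j \<ge> 0"
      using assms by (auto simp: admissible_def)
    with ij show "(i, j) \<in> (\<Union>k\<in>{0..d}. A k \<times> B (d - k))"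
      by (intro UN_I[of "nat (e i)"]) (auto simp: A_def B_def)
  qed (auto simp: A_def B_def)
  finally show "(mseries c e * mseries c' e') $ d = mseries (\<lambda>(i, j). c i * c' j) (\<lambda>(i, j). e i + e' j) $ d"
    by (simp add: mseries_def case_prod_unfold)
qed

section \<open>The Jacobi triple product\<close>

definition tri :: "int \<Rightarrow> int" where
  "tri j = j * (j - 1) div 2"

lemma tri_double: "2 * tri j = j * (j - 1)"
proof -
  have "even (j * (j - 1))"
    by simp
  then show ?thesis
    unfolding tri_def by (rule dvd_mult_div_cancel)
qed

lemma prod_lessThan_add: "(\<Prod>i<m + n. f i) = (\<Prod>i<m. f i) * (\<Prod>i<n. f (m + i) :: 'a::comm_monoid_mult)"
  for m n :: nat
  by (induction n) (simp_all add: mult.assoc)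

context not_root_of_unity
begin

lemma q_pascal:
  assumes "n \<ge> 0"
  shows "F (n + 1) * G k * G (n + 1 - k)
    = F n * G k * G (n - k) + q powi (n + 1 - k) * (F n * G (k - 1) * G (n - (k - 1)))"
proof -
  have "F (n + 1) = F n * (1 - q powi (n + 1))"
    using assms qfac_step[of "n + 1"] by simp
  moreover have "q powi (n + 1) = q powi (n + 1 - k) * q powi k"
    unfolding powi_add[symmetric] by simp
  moreover have "G (n - k) = (1 - q powi (n + 1 - k)) * G (n + 1 - k)"
    using iqfac_step[of "n + 1 - k"] by simp
  moreover have "n - (k - 1) = n + 1 - k"
    by simp
  ultimately show ?thesis
    by (simp only: iqfac_step[of k]) (simp only: algebra_simps mult_1_left mult_1_right)
qed

lemma cauchy_binomial:
  assumes "w \<noteq> 0"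
  shows "(\<Prod>i<N. 1 - w * q powi int i)
    = (\<Sum>k\<in>{0..int N}. (-1) powi k * q powi tri k * w powi k * (F (int N) * G k * G (int N - k)))"
proof (induction N)
  case 0
  show ?case
    by (simp add: tri_def)
next
  case (Suc N)
  define n where "n = int N"
  define f where "f k = (-1) powi k * q powi tri k * w powi k * (F n * G k * G (n - k))" for k
  have "(\<Sum>k\<in>{0..n+1}. (-1) powi k * q powi tri k * w powi k * (F (n + 1) * G k * G (n + 1 - k)))
    = (\<Sum>k\<in>{0..n+1}. f k - w * q powi n * f (k - 1))"
  proof (rule sum.cong[OF refl])
    fix k assume "k \<in> {0..n+1}"
    have "2 * (tri k + (n + 1 - k)) = 2 * (tri (k - 1) + n)"
      using tri_double[of k] tri_double[of "k - 1"] by (simp add: algebra_simps)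
    then have "tri k + (n + 1 - k) = n + tri (k - 1)"
      by simp
    then have "q powi tri k * q powi (n + 1 - k) = q powi n * q powi tri (k - 1)"
      by (metis powi_add)
    moreover have "w powi k = w * w powi (k - 1)"
      using power_int_add[of w 1 "k - 1"] assms by simp
    moreover have "(-1 :: 'a) powi k = - ((-1) powi (k - 1))"
      using power_int_add[of "-1 :: 'a" 1 "k - 1"] by simp
    moreover have "(-1) powi k * q powi tri k * w powi k * (F (n + 1) * G k * G (n + 1 - k))
        = f k + ((-1) powi k * w powi k * (q powi tri k * q powi (n + 1 - k))) * (F n * G (k - 1) * G (n - (k - 1)))"
      using q_pascal[of n k] by (simp add: f_def n_def algebra_simps)
    ultimately show "(-1) powi k * q powi tri k * w powi k * (F (n + 1) * G k * G (n + 1 - k)) = f k - w * q powi n * f (k - 1)"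
      by (simp add: f_def mult_ac)
  qed
  also have "\<dots> = sum f {0..n+1} - w * q powi n * (\<Sum>k\<in>{0..n+1}. f (k - 1))"
    by (simp add: sum_subtractf sum_distrib_left)
  also have "sum f {0..n+1} = sum f {0..n}"
    by (rule sum.mono_neutral_right) (auto simp: f_def)
  also have "(\<Sum>k\<in>{0..n+1}. f (k - 1)) = sum f {-1..n}"
    by (rule sum.reindex_bij_witness[of _ "\<lambda>k. k + 1" "\<lambda>k. k - 1"]) auto
  also have "\<dots> = sum f {0..n}"
    by (rule sum.mono_neutral_right) (auto simp: f_def)
  also have "sum f {0..n} = (\<Prod>i<N. 1 - w * q powi int i)"
    unfolding Suc f_def n_def ..
  finally have "(\<Sum>k\<in>{0..n+1}. (-1) powi k * q powi tri k * w powi k * (F (n + 1) * G k * G (n + 1 - k)))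
     = (\<Prod>i<N. 1 - w * q powi int i) * (1 - w * q powi n)"
    by (simp add: algebra_simps)
  then show ?case
    by (simp add: n_def add.commute)
qed

text \<open>The Cauchy binomial theorem with \<open>2 n\<close> factors and
  \<open>w = z q^(-n)\<close>. The first \<open>n\<close> factors, reversed, are
  \<open>1 - z q^(-i-1)\<close>; pulling out their monomials leaves \<open>1 - q^(i+1) / z\<close>
  and the constant \<open>c\<close>, which also appears on the other side when the index is centred
  at \<open>n\<close>.\<close>

lemma finite_jacobi_triple_product:
  assumes "z \<noteq> 0"
  shows "(\<Prod>i<n. 1 - z * q powi int i) * (\<Prod>i<n. 1 - q powi (int i + 1) / z)
    = (\<Sum>j\<in>{-int n..int n}. (-1) powi j * q powi tri j * z powi j * (F (2 * int n) * G (int n + j) * G (int n - j)))"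
proof -
  define w where "w = z * q powi (- int n)"
  define c where "c = (-1) powi int n * z powi int n * q powi (- tri (int n + 1))"
  have w: "w \<noteq> 0" and c: "c \<noteq> 0"
    using assms q_nonzero by (simp_all add: w_def c_def)
  have "(\<Prod>i<n. 1 - w * q powi int i) = (\<Prod>i<n. 1 - z * q powi (- (int i + 1)))"
  proof (rule prod.reindex_bij_witness[of _ "\<lambda>i. n - 1 - i" "\<lambda>i. n - 1 - i"])
    fix i assume "i \<in> {..<n}"
    then have "- (int (n - 1 - i) + 1) = - int n + int i"
      by (auto simp: of_nat_diff)
    then show "1 - z * q powi (- (int (n - 1 - i) + 1)) = 1 - w * q powi int i"
      by (simp only: powi_add w_def mult.assoc)
  qed auto
  also have "\<dots> = (\<Prod>i<n. - z * q powi (- (int i + 1))) * (\<Prod>i<n. 1 - q powi (int i + 1) / z)"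
    unfolding prod.distrib[symmetric]
  proof (rule prod.cong[OF refl])
    fix i :: nat
    have "q powi (- (int i + 1)) * q powi (int i + 1) = 1"
      unfolding powi_add[symmetric] by simp
    then show "1 - z * q powi (- (int i + 1)) = - z * q powi (- (int i + 1)) * (1 - q powi (int i + 1) / z)"
      using assms by (simp add: right_diff_distrib)
  qed
  also have "(\<Prod>i<n. - z * q powi (- (int i + 1))) = c"
    unfolding c_def
  proof (induction n)
    case 0
    show ?case by (simp add: tri_def)
  next
    case (Suc n)
    have "2 * (- tri (int (Suc n) + 1)) = 2 * (- tri (int n + 1) - (int n + 1))"
      using tri_double[of "int n + 1"] tri_double[of "int (Suc n) + 1"] by (simp add: algebra_simps)
    then have "- tri (int (Suc n) + 1) = - tri (int n + 1) + - (int n + 1)"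
      by simp
    then have "q powi (- tri (int (Suc n) + 1)) = q powi (- tri (int n + 1)) * q powi (- (int n + 1))"
      by (metis powi_add)
    then show ?case
      unfolding prod.lessThan_Suc Suc power_int_of_nat power_Suc by (simp add: mult_ac)
  qed
  finally have 1: "(\<Prod>i<n. 1 - w * q powi int i) = c * (\<Prod>i<n. 1 - q powi (int i + 1) / z)" .
  have 2: "(\<Prod>i<n. 1 - w * q powi int (n + i)) = (\<Prod>i<n. 1 - z * q powi int i)"
    unfolding w_def mult.assoc powi_add[symmetric] by simp
  have "c * ((\<Prod>i<n. 1 - z * q powi int i) * (\<Prod>i<n. 1 - q powi (int i + 1) / z)) = (\<Prod>i<n + n. 1 - w * q powi int i)"
    unfolding prod_lessThan_add 1 2 by (simp add: mult_ac)
  also have "\<dots> = (\<Sum>k\<in>{0..int (n + n)}. (-1) powi k * q powi tri k * w powi k * (F (int (n + n)) * G k * G (int (n + n) - k)))"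
    by (rule cauchy_binomial[OF w])
  also have "\<dots> = (\<Sum>j\<in>{-int n..int n}. c * ((-1) powi j * q powi tri j * z powi j * (F (2 * int n) * G (int n + j) * G (int n - j))))"
  proof (rule sum.reindex_bij_witness[of _ "\<lambda>j. int n + j" "\<lambda>k. k - int n"])
    fix k assume "k \<in> {0..int (n + n)}"
    define j where "j = k - int n"
    have k: "k = int n + j"
      by (simp add: j_def)
    have "2 * (tri k + (- int n) * k) = 2 * (- tri (int n + 1) + tri j)"
      unfolding distrib_left mult_minus_right tri_double by (simp add: k algebra_simps)
    then have "tri k + (- int n) * k = - tri (int n + 1) + tri j"
      by simp
    then have "q powi tri k * q powi ((- int n) * k) = q powi (- tri (int n + 1)) * q powi tri j"
      by (metis powi_add)
    moreover have "w powi k = z powi k * q powi ((- int n) * k)"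
      by (simp only: w_def power_int_mult_distrib power_int_mult)
    moreover have "z powi k = z powi int n * z powi j"
      unfolding k by (rule power_int_add) (use assms in simp)
    moreover have "(-1 :: 'a) powi k = (-1) powi int n * (-1) powi j"
      unfolding k by (rule power_int_add) simp
    moreover have "int (n + n) = 2 * int n" "2 * int n - k = int n - j"
      by (simp_all add: k)
    ultimately show "c * ((-1) powi (k - int n) * q powi tri (k - int n) * z powi (k - int n) * (F (2 * int n) * G (int n + (k - int n)) * G (int n - (k - int n))))
      = (-1) powi k * q powi tri k * w powi k * (F (int (n + n)) * G k * G (int (n + n) - k))"
      unfolding c_def j_def[symmetric] by (simp add: k mult_ac)
  qed auto
  finally show ?thesis
    using c by (simp add: sum_distrib_left[symmetric])
qed

end

lemma fps_to_fls_sum: "fps_to_fls (sum f A) = (\<Sum>x\<in>A. fps_to_fls (f x))"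
  by (induction A rule: infinite_finite_induct) simp_all

lemma fps_to_fls_prod:
  fixes f :: "'b \<Rightarrow> rat fps"
  shows "fps_to_fls (prod f A) = (\<Prod>x\<in>A. fps_to_fls (f x))"
  by (induction A rule: infinite_finite_induct) (simp_all add: fls_times_fps_to_fls)

text \<open>General \<open>K\<close> serves the triple product in base \<open>q^K\<close>, and
  \<open>K = 1\<close> serves the multisum.\<close>

lemma fls_X_power_not_root_of_unity:
  assumes "K > 0"
  shows "not_root_of_unity_char_neq_2 (fls_X ^ K :: rat fls)"
proof
  show "fls_X ^ K \<noteq> (0 :: rat fls)"
    by simp
  show "(fls_X ^ K) powi i \<noteq> (1 :: rat fls)" if i: "i > 0" for i
  proof -
    obtain n where n: "i = int n" "n > 0"
      using zero_less_imp_eq_int[OF i] by blast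
    have "(fls_X ^ K) powi i = fps_to_fls (fps_X ^ (K * n) :: rat fps)"
      by (simp only: n power_int_of_nat power_mult fps_to_fls_power fps_X_to_fls)
    moreover have "fps_X ^ (K * n) \<noteq> (1 :: rat fps)"
      using assms n by (auto simp: fps_eq_iff fps_X_power_nth intro!: exI[of _ 0])
    ultimately show ?thesis
      by (metis fps_to_fls_eq_1_iff)
  qed
  show "(2 :: rat fls) \<noteq> 0"
    by (metis fps_to_fls_numeral fps_to_fls_eq_0_iff zero_neq_numeral)
qed

lemma qfac_fls_X_power:
  assumes "K > 0"
  shows "qfac (fls_X ^ K) (int n) = fps_to_fls (qprod K K n)"
proof (induction n)
  case 0
  show ?case by (simp add: qfac_def)
next
  case (Suc n)
  interpret not_root_of_unity_char_neq_2 "fls_X ^ K :: rat fls"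
    by (rule fls_X_power_not_root_of_unity[OF assms])
  have "(fls_X ^ K :: rat fls) powi int (Suc n) = fps_to_fls (fps_X ^ (K + K * n))"
    by (simp only: power_int_of_nat fps_to_fls_power fps_X_to_fls power_add power_mult power_Suc fls_times_fps_to_fls)
  then have "1 - (fls_X ^ K :: rat fls) powi int (Suc n) = fps_to_fls (1 - fps_X ^ (K + K * n))"
    by (simp only: fps_to_fls_minus fps_one_to_fls)
  then show ?case
    using qfac_step[of "int (Suc n)"] Suc by (simp add: qprod_Suc fls_times_fps_to_fls)
qed

lemma iqfac_fls_X_power:
  assumes "K > 0"
  shows "iqfac (fls_X ^ K) (int n) = fps_to_fls (inverse (qprod K K n))"
proof -
  have "qprod K K n $ 0 = 1"
    using assms by (simp add: qprod_nth_0)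
  then have "subdegree (qprod K K n) = 0"
    by (simp add: subdegree_eq_0_iff)
  then show ?thesis
    by (simp add: iqfac_def qfac_fls_X_power[OF assms] fls_inverse_fps_to_fls)
qed

definition sgn_pow :: "int \<Rightarrow> rat" where
  "sgn_pow j = (-1) powi j"

lemma sgn_pow_eq: "sgn_pow j = (if even j then 1 else -1)"
  by (simp add: sgn_pow_def power_int_minus_left)

lemma tri_exponent_bounds:
  fixes j K u :: int
  assumes "0 < u" "u < K"
  shows "\<bar>j\<bar> \<le> K * tri j + u * j"
proof (cases "j > 0")
  case True
  have "2 * tri j \<ge> 0"
    unfolding tri_double using True by simp
  then have "K * tri j \<ge> 0"
    using assms by simp
  moreover have "1 * j \<le> u * j"
    using assms True by (intro mult_right_mono) auto
  ultimately show ?thesis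
    using True by linarith
next
  case False
  have "2 * (tri j + j) = j * (j + 1)"
    unfolding distrib_left tri_double by (simp add: algebra_simps)
  moreover have "j * (j + 1) \<ge> 0"
    using False by (cases "j = 0") (auto intro!: mult_nonpos_nonpos)
  ultimately have "tri j + j \<ge> 0"
    by simp
  then have "K * (tri j + j) \<ge> 0"
    using assms by simp
  moreover have "K * tri j + u * j = K * (tri j + j) + (K - u) * (- j)"
    by (simp add: algebra_simps)
  moreover have "1 * (- j) \<le> (K - u) * (- j)"
    using assms False by (intro mult_right_mono) auto
  ultimately show ?thesis
    using False by linarith
qed

lemma tri_admissible:
  fixes K u :: int
  assumes "0 < u" "u < K"
  shows "admissible sgn_pow (\<lambda>j. K * tri j + u * j)"
proof -
  have *: "\<bar>j\<bar> \<le> K * tri j + u * j" for j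
    using assms by (rule tri_exponent_bounds)
  have "{j. sgn_pow j \<noteq> 0 \<and> K * tri j + u * j \<le> d} \<subseteq> {-\<bar>d\<bar>..\<bar>d\<bar>}" for d
  proof
    fix j assume "j \<in> {j. sgn_pow j \<noteq> 0 \<and> K * tri j + u * j \<le> d}"
    with *[of j] show "j \<in> {-\<bar>d\<bar>..\<bar>d\<bar>}"
      by auto
  qed
  then have "finite {j. sgn_pow j \<noteq> 0 \<and> K * tri j + u * j \<le> d}" for d
    by (rule finite_subset) simp
  moreover have "K * tri j + u * j \<ge> 0" for j
    using *[of j] by linarith
  ultimately show ?thesis
    by (simp add: admissible_def)
qed

text \<open>Compares coefficients up to order \<open>d\<close> with the finite version for
  \<open>n = 2 d + 1\<close>. Terms of exponent at most \<open>d\<close> have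
  \<open>|j| <= d\<close>, so \<open>n + j\<close> and \<open>n - j\<close> are at least
  \<open>d\<close> and the factorial quotient times \<open>P\<close> agrees with 1; all other terms
  have too high an order.\<close>

lemma jacobi_triple_product:
  assumes u: "0 < u" "u < K"
  shows "qinf u K * qinf (K - u) K * qinf K K = mseries sgn_pow (\<lambda>j. int K * tri j + int u * j)"
proof -
  define e where "e j = int K * tri j + int u * j" for j
  have K: "K > 0"
    using u by simp
  have e_ge: "\<bar>j\<bar> \<le> e j" for j
    unfolding e_def using u by (intro tri_exponent_bounds) auto
  define P where "P = qinf K K"
  define I where "I n = inverse (qprod K K n)" for n
  define t where "t n j = fps_const (sgn_pow j) * (fps_X ^ nat (e j) * (qprod K K (2 * n) * I (nat (int n + j)) * I (nat (int n - j))))"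
    for n j
  have finite_version: "qprod u K n * qprod (K - u) K n = (\<Sum>j\<in>{-int n..int n}. t n j)" for n
  proof -
    interpret not_root_of_unity_char_neq_2 "fls_X ^ K :: rat fls"
      by (rule fls_X_power_not_root_of_unity[OF K])
    let ?Q = "fls_X ^ K :: rat fls" and ?z = "fls_X ^ u :: rat fls"
    have "fps_to_fls (qprod u K n * qprod (K - u) K n)
      = (\<Prod>i<n. 1 - ?z * ?Q powi int i) * (\<Prod>i<n. 1 - ?Q powi (int i + 1) / ?z)"
    proof -
      have "fps_to_fls (qprod u K n) = (\<Prod>i<n. 1 - ?z * ?Q powi int i)" for n
        by (induction n) (simp_all add: qprod_Suc fls_times_fps_to_fls fps_to_fls_power power_add power_mult)
      moreover have "fps_to_fls (qprod (K - u) K n) = (\<Prod>i<n. 1 - ?Q powi (int i + 1) / ?z)" for n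
      proof (induction n)
        case (Suc n)
        have "?Q powi (int n + 1) = ?Q ^ Suc n"
          by (metis Suc_eq_plus1 of_nat_1 of_nat_add power_int_of_nat)
        also have "\<dots> = fls_X ^ (K - u + K * n) * ?z"
          using u by (simp add: power_mult[symmetric] power_add[symmetric])
        finally have "?Q powi (int n + 1) / ?z = fls_X ^ (K - u + K * n) * ?z / ?z"
          by (rule arg_cong)
        also have "\<dots> = fps_to_fls (fps_X ^ (K - u + K * n))"
          unfolding fps_to_fls_power fps_X_to_fls by (rule nonzero_mult_div_cancel_right) simp
        finally have "?Q powi (int n + 1) / ?z = fps_to_fls (fps_X ^ (K - u + K * n))" .
        then show ?case
          by (simp add: qprod_Suc fls_times_fps_to_fls Suc)
      qed simp
      ultimately show ?thesis
        by (simp only: fls_times_fps_to_fls)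
    qed
    also have "\<dots> = (\<Sum>j\<in>{-int n..int n}. (-1) powi j * ?Q powi tri j * ?z powi j * (F (2 * int n) * G (int n + j) * G (int n - j)))"
      by (rule finite_jacobi_triple_product) simp
    also have "\<dots> = (\<Sum>j\<in>{-int n..int n}. fps_to_fls (t n j))"
    proof (rule sum.cong[OF refl])
      fix j assume j: "j \<in> {-int n..int n}"
      have "?Q powi tri j * ?z powi j = fls_X powi (int K * tri j) * fls_X powi (int u * j)"
        by (simp add: power_int_power)
      also have "\<dots> = fls_X powi (e j)"
        unfolding e_def by (rule power_int_add[symmetric]) simp
      also have "\<dots> = fps_to_fls (fps_X ^ nat (e j))"
        using e_ge[of j] by (simp add: power_int_def fps_to_fls_power)
      finally have 1: "?Q powi tri j * ?z powi j = fps_to_fls (fps_X ^ nat (e j))" .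
      have 2: "F (2 * int n) = fps_to_fls (qprod K K (2 * n))"
        using qfac_fls_X_power[OF K, of "2 * n"] by simp
      have 3: "G (int n + j) = fps_to_fls (I (nat (int n + j)))" "G (int n - j) = fps_to_fls (I (nat (int n - j)))"
        using j iqfac_fls_X_power[OF K, of "nat (int n + j)"] iqfac_fls_X_power[OF K, of "nat (int n - j)"]
        by (simp_all add: I_def)
      have 4: "(-1 :: rat fls) powi j = fps_to_fls (fps_const (sgn_pow j))"
        by (simp add: sgn_pow_eq power_int_minus_left)
      show "(-1) powi j * ?Q powi tri j * ?z powi j * (F (2 * int n) * G (int n + j) * G (int n - j)) = fps_to_fls (t n j)"
        unfolding t_def fls_times_fps_to_fls 2 3 4 1[symmetric] by (simp only: mult_ac)
    qed
    also have "\<dots> = fps_to_fls (\<Sum>j\<in>{-int n..int n}. t n j)"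
      by (simp add: fps_to_fls_sum)
    finally show ?thesis
      by simp
  qed
  show ?thesis
  proof (rule fps_eqI_agree)
    fix d :: nat
    define n where "n = 2 * d + 1"
    have n_large: "x + K * m > d" if "m \<ge> d" "x > 0" for m x :: nat
    proof -
      have "1 * m \<le> K * m"
        using K by (intro mult_le_mono1) simp
      then show ?thesis
        using that by linarith
    qed
    have un: "d < u + K * n" "d < K - u + K * n"
      by (rule n_large; use u in \<open>simp add: n_def\<close>)+
    have IP: "fps_agree d (I m * P) 1" if "m \<ge> d" for m
      unfolding I_def P_def inverse_qprod_mult_qinf[OF K K] using that K n_large by (intro qinf_agree_1) auto
    have t: "fps_agree d (t n j * P) (if e j \<le> int d then fps_const (sgn_pow j) * fps_X ^ nat (e j) else 0)"
      if "j \<in> {-int n..int n}" for j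
    proof (cases "e j \<le> int d")
      case True
      then have "\<bar>j\<bar> \<le> int d"
        using e_ge[of j] by linarith
      then have large: "nat (int n + j) \<ge> d" "nat (int n - j) \<ge> d"
        by (auto simp: n_def)
      have "fps_agree d (qprod K K (2 * n) * I (nat (int n - j))) (P * I (nat (int n - j)))"
        unfolding P_def using K n_large
        by (intro fps_agree_mult fps_agree_refl fps_agree_sym[OF qinf_agree_qprod]) (auto simp: n_def)
      also have "fps_agree d \<dots> 1"
        using IP[OF large(2)] by (simp add: mult.commute)
      finally have "fps_agree d ((qprod K K (2 * n) * I (nat (int n - j))) * (I (nat (int n + j)) * P)) (1 * 1)"
        using IP[OF large(1)] by (rule fps_agree_mult)
      then have "fps_agree d (fps_const (sgn_pow j) * fps_X ^ nat (e j) * ((qprod K K (2 * n) * I (nat (int n - j))) * (I (nat (int n + j)) * P)))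
         (fps_const (sgn_pow j) * fps_X ^ nat (e j) * (1 * 1))"
        by (rule fps_agree_mult[OF fps_agree_refl])
      then show ?thesis
        using True by (simp add: t_def mult_ac)
    next
      case False
      then have "nat (e j) > d"
        by linarith
      then have "fps_agree d (fps_X ^ nat (e j) * (fps_const (sgn_pow j) * (qprod K K (2 * n) * I (nat (int n + j)) * I (nat (int n - j))) * P)) 0"
        by (rule fps_agree_X_power_mult_0)
      then show ?thesis
        using False by (simp add: t_def mult_ac)
    qed
    have "fps_agree d (qinf u K * qinf (K - u) K * qinf K K) (qprod u K n * qprod (K - u) K n * P)"
      unfolding P_def using u K un
      by (intro fps_agree_mult fps_agree_refl qinf_agree_qprod) auto
    also have "\<dots> = (\<Sum>j\<in>{-int n..int n}. t n j * P)"
      by (simp add: finite_version sum_distrib_right)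
    also have "fps_agree d \<dots> (\<Sum>j\<in>{-int n..int n}. if e j \<le> int d then fps_const (sgn_pow j) * fps_X ^ nat (e j) else 0)"
      by (rule fps_agree_sum) (rule t)
    also have "fps_agree d \<dots> (mseries sgn_pow e)"
      unfolding fps_agree_def
    proof (intro allI impI)
      fix i assume "i \<le> d"
      have "(\<Sum>j\<in>{-int n..int n}. if e j \<le> int d then fps_const (sgn_pow j) * fps_X ^ nat (e j) else 0) $ i
        = (\<Sum>j\<in>{-int n..int n}. if e j = int i then sgn_pow j else 0)"
        unfolding fps_sum_nth
      proof (rule sum.cong[OF refl])
        fix j
        have "e j \<ge> 0"
          using e_ge[of j] by linarith
        then show "(if e j \<le> int d then fps_const (sgn_pow j) * fps_X ^ nat (e j) else 0) $ i = (if e j = int i then sgn_pow j else 0)"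
          using \<open>i \<le> d\<close> by (auto simp: fps_X_power_nth)
      qed
      also have "\<dots> = (\<Sum>j\<in>{j \<in> {-int n..int n}. e j = int i}. sgn_pow j)"
        by (rule sum.inter_filter[symmetric]) simp
      also have "{j \<in> {-int n..int n}. e j = int i} = {j. sgn_pow j \<noteq> 0 \<and> e j = int i}"
      proof safe
        fix j assume "e j = int i"
        then have "\<bar>j\<bar> \<le> int n"
          using e_ge[of j] \<open>i \<le> d\<close> by (simp add: n_def)
        then show "j \<in> {-int n..int n}"
          by auto
      qed (simp add: sgn_pow_eq split: if_splits)
      finally show "(\<Sum>j\<in>{-int n..int n}. if e j \<le> int d then fps_const (sgn_pow j) * fps_X ^ nat (e j) else 0) $ i
        = mseries sgn_pow e $ i"
        by (simp add: mseries_def)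
    qed
    finally show "fps_agree d (qinf u K * qinf (K - u) K * qinf K K) (mseries sgn_pow (\<lambda>j. int K * tri j + int u * j))"
      by (simp add: e_def[abs_def])
  qed
qed

section \<open>The product side\<close>

definition theta_exponent :: "nat \<Rightarrow> nat \<Rightarrow> nat \<Rightarrow> int \<times> int \<Rightarrow> int" where
  "theta_exponent K u w = (\<lambda>(x, y). int K * ((x * x + x * y + y * y - 1) div 3) + int u * (1 - x) + int w * (1 - x - y))"

definition triple_exponent :: "nat \<Rightarrow> nat \<Rightarrow> nat \<Rightarrow> (int \<times> int) \<times> int \<Rightarrow> int" where
  "triple_exponent K u w = (\<lambda>((i, j), l). int K * (tri i + tri j + tri l) + int u * (i + l) + int w * (j + l))"

definition triple_sign :: "(int \<times> int) \<times> int \<Rightarrow> rat" where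
  "triple_sign = (\<lambda>((i, j), l). sgn_pow i * sgn_pow j * sgn_pow l)"

text \<open>
  In the product of three triple products the monomial of \<open>(i, j, l)\<close> depends on \<open>i + l\<close> and \<open>j + l\<close> up to a
  power of \<open>q\<close> quadratic in \<open>l\<close>. Completing the square in \<open>l\<close> leaves a pentagonal number series when
  \<open>i + j + 2l \<noteq> 2\<close> modulo \<open>3\<close>, and otherwise a series that the reflection \<open>triple_refl\<close> below shows to be \<open>0\<close>.
\<close>

definition to_triple :: "(int \<times> int) \<times> int \<Rightarrow> (int \<times> int) \<times> int" where
  "to_triple = (\<lambda>((x, y), l). let s = 2 - 2 * x - y; m = (if s mod 3 = 0 then s div 3 + l else s div 3 - l)
     in ((1 - x - m, 1 - x - y - m), m))"

text \<open>The exponents of \<open>q^u\<close> and \<open>q^w\<close> determine the lattice vector: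
  \<open>i + m = 1 - x\<close> and \<open>j + m = 1 - x - y\<close>. With these fixed,
  \<open>s = i + j + 2 m\<close> is fixed and the exponent is quadratic in \<open>m\<close> with
  vertex \<open>s/3 - 1/6\<close>. For \<open>s = 3 c\<close> and \<open>s = 3 c + 1\<close> the
  vertex is \<open>c - 1/6\<close> and \<open>c + 1/6\<close>, so \<open>m = c + l\<close> and
  \<open>m = c - l\<close> lead to the same pentagonal exponent in \<open>l\<close>.\<close>

definition from_triple :: "(int \<times> int) \<times> int \<Rightarrow> (int \<times> int) \<times> int" where
  "from_triple = (\<lambda>((i, j), m). let s = i + j + 2 * m
     in ((1 - i - m, i - j), if s mod 3 = 0 then m - s div 3 else s div 3 - m))"

lemma from_to_triple: "from_triple (to_triple t) = t"
proof -
  obtain x y l where t: "t = ((x, y), l)"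
    by (metis prod.collapse)
  have s: "(1 - x - m) + (1 - x - y - m) + 2 * m = 2 - 2 * x - y" for m
    by simp
  show ?thesis
    unfolding t to_triple_def from_triple_def Let_def case_prod_conv s by simp
qed

lemma to_from_triple: "to_triple (from_triple t) = t"
proof -
  obtain i j m where t: "t = ((i, j), m)"
    by (metis prod.collapse)
  have s: "2 - 2 * (1 - i - m) - (i - j) = i + j + 2 * m"
    by simp
  show ?thesis
    unfolding t to_triple_def from_triple_def Let_def case_prod_conv s by simp
qed

lemma chi_nonzero_iff: "chi (x - y) \<noteq> (0 :: rat) \<longleftrightarrow> (2 - 2 * x - y) mod 3 \<noteq> 2"
proof -
  have "(x - y) mod 3 = 0 \<longleftrightarrow> (2 - 2 * x - y) mod 3 = 2" "(x - y) mod 3 = 0 \<or> (x - y) mod 3 = 1 \<or> (x - y) mod 3 = 2"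
    by presburger+
  then show ?thesis
    by (auto simp: chi_def)
qed

lemma to_triple:
  assumes "chi (x - y) \<noteq> (0 :: rat)"
  shows "triple_exponent K u w (to_triple ((x, y), l)) = theta_exponent K u w (x, y) + int (3 * K) * tri l + int (2 * K) * l"
    and "triple_sign (to_triple ((x, y), l)) = chi (x - y) * sgn_pow l"
proof -
  define s where "s = 2 - 2 * x - y"
  define c where "c = s div 3"
  define m where "m = (if s mod 3 = 0 then c + l else c - l)"
  have tt: "to_triple ((x, y), l) = ((1 - x - m, 1 - x - y - m), m)"
    by (simp add: to_triple_def Let_def s_def c_def m_def)
  have "s mod 3 \<noteq> 2"
    using assms by (simp add: chi_nonzero_iff s_def)
  then have "s mod 3 = 0 \<or> s mod 3 = 1"
    by presburger
  then consider "s mod 3 = 0" | "s mod 3 = 1"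
    by blast
  then have *: "tri (1 - x - m) + tri (1 - x - y - m) + tri m = (x * x + x * y + y * y - 1) div 3 + (3 * tri l + 2 * l)
    \<and> triple_sign (to_triple ((x, y), l)) = chi (x - y) * sgn_pow l"
  proof cases
    case 1
    then have s: "s = 3 * c"
      unfolding c_def using div_mult_mod_eq[of s 3] by linarith
    from 1 have m: "m = c + l"
      by (simp add: m_def)
    have y: "y = 2 - 2 * x - 3 * c"
      using s by (simp add: s_def)
    have p: "x * x + x * y + y * y - 1 = 3 * (c * (3 * c - 1) - (1 - x) * (1 - x - y))"
      by (simp add: y algebra_simps)
    then have d: "(x * x + x * y + y * y - 1) div 3 = c * (3 * c - 1) - (1 - x) * (1 - x - y)"
      by simp
    have "2 * (tri (1 - x - m) + tri (1 - x - y - m) + tri m) = 2 * ((x * x + x * y + y * y - 1) div 3 + (3 * tri l + 2 * l))"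
      unfolding d distrib_left tri_double mult.left_commute[of 2 3] by (simp add: y m algebra_simps)
    then have "tri (1 - x - m) + tri (1 - x - y - m) + tri m = (x * x + x * y + y * y - 1) div 3 + (3 * tri l + 2 * l)"
      by (metis mult_left_cancel zero_neq_numeral)
    moreover have "(x - y) mod 3 = 1"
      by (simp add: y) presburger
    then have "chi (x - y) = (1 :: rat)"
      by (simp add: chi_def)
    then have "triple_sign (to_triple ((x, y), l)) = chi (x - y) * sgn_pow l"
      unfolding tt by (auto simp: triple_sign_def sgn_pow_eq y m)
    ultimately show ?thesis
      by blast
  next
    case 2
    then have s: "s = 3 * c + 1"
      unfolding c_def using div_mult_mod_eq[of s 3] by linarith
    from 2 have m: "m = c - l"
      by (simp add: m_def)
    have y: "y = 1 - 2 * x - 3 * c"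
      using s by (simp add: s_def)
    have p: "x * x + x * y + y * y - 1 = 3 * (c * (3 * c + 1) - (1 - x) * (1 - x - y))"
      by (simp add: y algebra_simps)
    then have d: "(x * x + x * y + y * y - 1) div 3 = c * (3 * c + 1) - (1 - x) * (1 - x - y)"
      by simp
    have "2 * (tri (1 - x - m) + tri (1 - x - y - m) + tri m) = 2 * ((x * x + x * y + y * y - 1) div 3 + (3 * tri l + 2 * l))"
      unfolding d distrib_left tri_double mult.left_commute[of 2 3] by (simp add: y m algebra_simps)
    then have "tri (1 - x - m) + tri (1 - x - y - m) + tri m = (x * x + x * y + y * y - 1) div 3 + (3 * tri l + 2 * l)"
      by (metis mult_left_cancel zero_neq_numeral)
    moreover have "(x - y) mod 3 = 2"
      by (simp add: y) presburger
    then have "chi (x - y) = (-1 :: rat)"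
      by (simp add: chi_def)
    then have "triple_sign (to_triple ((x, y), l)) = chi (x - y) * sgn_pow l"
      unfolding tt by (auto simp: triple_sign_def sgn_pow_eq y m)
    ultimately show ?thesis
      by blast
  qed
  then have "int K * (tri (1 - x - m) + tri (1 - x - y - m) + tri m) = int K * ((x * x + x * y + y * y - 1) div 3 + (3 * tri l + 2 * l))"
    by simp
  then show "triple_exponent K u w (to_triple ((x, y), l)) = theta_exponent K u w (x, y) + int (3 * K) * tri l + int (2 * K) * l"
    by (simp add: tt triple_exponent_def theta_exponent_def algebra_simps)
  from * show "triple_sign (to_triple ((x, y), l)) = chi (x - y) * sgn_pow l"
    by simp
qed

text \<open>For \<open>s = i + j + 2 m = 3 c + 2\<close> the vertex is the half-integer
  \<open>c + 1/2\<close>. Reflection in it, \<open>m -> 2 c + 1 - m\<close>, keeps the exponent and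
  changes the parity of \<open>m\<close>, hence the sign.\<close>

definition triple_refl :: "(int \<times> int) \<times> int \<Rightarrow> (int \<times> int) \<times> int" where
  "triple_refl = (\<lambda>((i, j), m). let n = 1 + 2 * ((i + j + 2 * m) div 3) - m in ((i + m - n, j + m - n), n))"

lemma triple_refl_involution: "triple_refl (triple_refl t) = t"
proof -
  obtain i j m where t: "t = ((i, j), m)"
    by (metis prod.collapse)
  have s: "(i + m - n) + (j + m - n) + 2 * n = i + j + 2 * m" for n
    by simp
  show ?thesis
    unfolding t triple_refl_def Let_def case_prod_conv s by simp
qed

lemma triple_refl:
  assumes "(i + j + 2 * m) mod 3 = 2"
  shows "triple_exponent K u w (triple_refl ((i, j), m)) = triple_exponent K u w ((i, j), m)"
    and "triple_sign (triple_refl ((i, j), m)) = - triple_sign ((i, j), m)"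
proof -
  define c where "c = (i + j + 2 * m) div 3"
  define n where "n = 1 + 2 * c - m"
  have tt: "triple_refl ((i, j), m) = ((i + m - n, j + m - n), n)"
    by (simp add: triple_refl_def Let_def c_def n_def)
  have "i + j + 2 * m = 3 * c + 2"
    using assms unfolding c_def by presburger
  then have j: "j = 3 * c + 2 - i - 2 * m"
    by simp
  have "2 * (tri (i + m - n) + tri (j + m - n) + tri n) = 2 * (tri i + tri j + tri m)"
    unfolding distrib_left tri_double by (simp add: j n_def algebra_simps)
  then have "tri (i + m - n) + tri (j + m - n) + tri n = tri i + tri j + tri m"
    by simp
  then show "triple_exponent K u w (triple_refl ((i, j), m)) = triple_exponent K u w ((i, j), m)"
    by (simp add: tt triple_exponent_def)
  show "triple_sign (triple_refl ((i, j), m)) = - triple_sign ((i, j), m)"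
    unfolding tt by (auto simp: triple_sign_def sgn_pow_eq j n_def)
qed

text \<open>The three triple products contribute three factors \<open>qinf K K\<close>. The sum over
  \<open>l\<close> splits off as the pentagonal series, which is again \<open>qinf K K\<close>;
  cancelling it leaves the square.\<close>

lemma theta_product:
  assumes "0 < u" "0 < w" "u + w < K"
  shows "qinf K K ^ 2 * ((qinf u K * qinf (K - u) K) * (qinf w K * qinf (K - w) K) * (qinf (u + w) K * qinf (K - (u + w)) K))
      = mseries (\<lambda>(x, y). chi (x - y)) (theta_exponent K u w)"
    and "admissible (\<lambda>(x, y). chi (x - y) :: rat) (theta_exponent K u w)"
proof -
  let ?c = "\<lambda>(x, y). chi (x - y) :: rat"
  have K: "K > 0"
    using assms by simp
  define E where "E v = (\<lambda>j. int K * tri j + int v * j)" for v :: nat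
  have jtp: "qinf v K * qinf (K - v) K * qinf K K = mseries sgn_pow (E v)" "admissible sgn_pow (E v)"
    if "v \<in> {u, w, u + w}" for v
  proof -
    have "0 < v" "v < K"
      using that assms by auto
    then show "qinf v K * qinf (K - v) K * qinf K K = mseries sgn_pow (E v)" "admissible sgn_pow (E v)"
      unfolding E_def by (rule jacobi_triple_product) (intro tri_admissible, use \<open>0 < v\<close> \<open>v < K\<close> in simp_all)
  qed
  then have adm: "admissible sgn_pow (E u)" "admissible sgn_pow (E w)" "admissible sgn_pow (E (u + w))"
    by simp_all
  have sign: "(\<lambda>(ij, l). (case ij of (i, j) \<Rightarrow> sgn_pow i * sgn_pow j) * sgn_pow l) = triple_sign"
    by (auto simp: triple_sign_def fun_eq_iff)
  have expo: "(\<lambda>(ij, l). (case ij of (i, j) \<Rightarrow> E u i + E w j) + E (u + w) l) = triple_exponent K u w"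
    by (auto simp: triple_exponent_def E_def fun_eq_iff algebra_simps)
  note adm2 = admissible_times[OF adm(1,2)]
  have "(qinf u K * qinf (K - u) K * qinf K K) * (qinf w K * qinf (K - w) K * qinf K K)
      * (qinf (u + w) K * qinf (K - (u + w)) K * qinf K K) = mseries sgn_pow (E u) * mseries sgn_pow (E w) * mseries sgn_pow (E (u + w))"
    by (simp only: jtp(1) insert_iff simp_thms)
  also have "\<dots> = mseries triple_sign (triple_exponent K u w)"
    unfolding mseries_mult[OF adm(1,2)] mseries_mult[OF adm2 adm(3)] sign expo ..
  finally have triple: "(qinf u K * qinf (K - u) K * qinf K K) * (qinf w K * qinf (K - w) K * qinf K K)
      * (qinf (u + w) K * qinf (K - (u + w)) K * qinf K K) = mseries triple_sign (triple_exponent K u w)" .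
  have adm3: "admissible triple_sign (triple_exponent K u w)"
    using admissible_times[OF adm2 adm(3)] by (simp only: sign expo)
  have sign_nz: "triple_sign t \<noteq> 0" for t
    by (auto simp: triple_sign_def sgn_pow_eq split: prod.splits)
  \<comment> \<open>Lattice terms are the slice \<open>l = 0\<close> of the triple terms.
    Nonnegativity and finiteness, not evident from \<open>theta_exponent\<close>, are inherited from
    there.\<close>
  have theta_eq: "theta_exponent K u w v = triple_exponent K u w (to_triple (v, 0))" if "?c v \<noteq> 0" for v
  proof -
    obtain x y where v: "v = (x, y)"
      by fastforce
    show ?thesis
      using that to_triple(1)[of x y K u w 0] unfolding v by (simp add: tri_def)
  qed
  show adm_theta: "admissible ?c (theta_exponent K u w)"
    unfolding admissible_def
  proof (intro conjI allI impI)
    fix v assume "?c v \<noteq> 0"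
    moreover have "triple_exponent K u w t \<ge> 0" for t
      using adm3 sign_nz unfolding admissible_def by blast
    ultimately show "theta_exponent K u w v \<ge> 0"
      using theta_eq by simp
  next
    fix d
    have "{v. ?c v \<noteq> 0 \<and> theta_exponent K u w v \<le> d} \<subseteq> (fst \<circ> from_triple) ` {t. triple_sign t \<noteq> 0 \<and> triple_exponent K u w t \<le> d}"
    proof
      fix v assume "v \<in> {v. ?c v \<noteq> 0 \<and> theta_exponent K u w v \<le> d}"
      then show "v \<in> (fst \<circ> from_triple) ` {t. triple_sign t \<noteq> 0 \<and> triple_exponent K u w t \<le> d}"
        by (intro image_eqI[of _ _ "to_triple (v, 0)"]) (auto simp: from_to_triple theta_eq sign_nz simp del: case_prod_conv)
    qed
    moreover have "finite {t. triple_sign t \<noteq> 0 \<and> triple_exponent K u w t \<le> d}"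
      using adm3 by (simp add: admissible_def)
    ultimately show "finite {v. ?c v \<noteq> 0 \<and> theta_exponent K u w v \<le> d}"
      by (meson finite_imageI finite_subset)
  qed
  define e where "e l = int (3 * K) * tri l + int (2 * K) * l" for l
  have adm_e: "admissible sgn_pow e"
    unfolding e_def[abs_def] using K by (intro tri_admissible) auto
  have pent: "qinf K K = mseries sgn_pow e"
    using jacobi_triple_product[of "2 * K" "3 * K"] qinf_split_3[OF K] K by (simp add: e_def[abs_def] mult_ac)
  have "mseries triple_sign (triple_exponent K u w) = mseries (\<lambda>(v, l). ?c v * sgn_pow l) (\<lambda>(v, l). theta_exponent K u w v + e l)"
  proof (rule fps_ext)
    fix d
    define T where "T = {t. triple_sign t \<noteq> 0 \<and> triple_exponent K u w t = int d}"
    define R where "R = {((i, j), m). (i + j + 2 * m) mod 3 = (2 :: int)}"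
    define V where "V = {t. (case t of (v, l) \<Rightarrow> ?c v * sgn_pow l) \<noteq> 0 \<and> (case t of (v, l) \<Rightarrow> theta_exponent K u w v + e l) = int d}"
    have fin: "finite T"
      unfolding T_def by (rule admissible_finite[OF adm3])
    have "sum triple_sign (T \<inter> R) = (\<Sum>t\<in>T \<inter> R. - triple_sign t)"
    proof (rule sum.reindex_bij_witness[of _ triple_refl triple_refl])
      fix t assume t: "t \<in> T \<inter> R"
      obtain i j m where ijm: "t = ((i, j), m)"
        by (metis prod.collapse)
      have r: "(i + j + 2 * m) mod 3 = 2"
        using t by (simp add: R_def ijm)
      then have "triple_refl t \<in> R"
        by (simp add: R_def ijm triple_refl_def Let_def algebra_simps)
      then show "triple_refl t \<in> T \<inter> R"
        using t triple_refl[OF r] sign_nz by (simp add: T_def ijm)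
      show "- triple_sign (triple_refl t) = triple_sign t"
        using triple_refl(2)[OF r] by (simp add: ijm)
    next
      fix t assume t: "t \<in> T \<inter> R"
      obtain i j m where ijm: "t = ((i, j), m)"
        by (metis prod.collapse)
      have r: "(i + j + 2 * m) mod 3 = 2"
        using t by (simp add: R_def ijm)
      then have "triple_refl t \<in> R"
        by (simp add: R_def ijm triple_refl_def Let_def algebra_simps)
      then show "triple_refl t \<in> T \<inter> R"
        using t triple_refl[OF r] sign_nz by (simp add: T_def ijm)
    qed (simp_all add: triple_refl_involution)
    then have 0: "sum triple_sign (T \<inter> R) = 0"
      by (simp add: sum_negf)
    have nonR: "t \<notin> R \<longleftrightarrow> ?c (fst (from_triple t)) \<noteq> 0" for t
    proof -
      obtain i j m where ijm: "t = ((i, j), m)"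
        by (metis prod.collapse)
      have eq: "2 - 2 * (1 - i - m) - (i - j) = i + j + 2 * m"
        by simp
      have "chi ((1 - i - m) - (i - j)) \<noteq> (0 :: rat) \<longleftrightarrow> (i + j + 2 * m) mod 3 \<noteq> 2"
        using chi_nonzero_iff[of "1 - i - m" "i - j"] unfolding eq .
      moreover have "?c (fst (from_triple t)) = chi ((1 - i - m) - (i - j))"
        by (simp only: ijm from_triple_def Let_def case_prod_conv fst_conv)
      moreover have "t \<in> R \<longleftrightarrow> (i + j + 2 * m) mod 3 = 2"
        by (simp only: ijm R_def mem_Collect_eq case_prod_conv)
      ultimately show ?thesis
        by simp
    qed
    have conv: "triple_exponent K u w (to_triple (v, l)) = theta_exponent K u w v + e l"
      "triple_sign (to_triple (v, l)) = ?c v * sgn_pow l" if "?c v \<noteq> 0" for v l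
    proof -
      obtain x y where v: "v = (x, y)"
        by fastforce
      show "triple_exponent K u w (to_triple (v, l)) = theta_exponent K u w v + e l"
        "triple_sign (to_triple (v, l)) = ?c v * sgn_pow l"
        using that to_triple(1)[of x y K u w l] to_triple(2)[of x y l] unfolding v by (simp_all add: e_def)
    qed
    have "sum triple_sign (T - R) = (\<Sum>t\<in>V. case t of (v, l) \<Rightarrow> ?c v * sgn_pow l)"
    proof (rule sum.reindex_bij_witness[of _ to_triple from_triple])
      fix t assume t: "t \<in> T - R"
      define v l where "v = fst (from_triple t)" and "l = snd (from_triple t)"
      have vl: "from_triple t = (v, l)" "t = to_triple (v, l)"
        by (simp_all add: v_def l_def to_from_triple)
      have "?c v \<noteq> 0"
        using t nonR unfolding v_def by blast
      note c = conv[OF this, of l]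
      show "from_triple t \<in> V"
        using t sign_nz[of t] c unfolding vl(1) V_def T_def vl(2) by (simp only: mem_Collect_eq case_prod_conv Diff_iff) (simp add: from_to_triple)
      show "(case from_triple t of (v, l) \<Rightarrow> ?c v * sgn_pow l) = triple_sign t"
        using c(2) unfolding vl(1) by (simp only: case_prod_conv vl(2))
    next
      fix t assume t: "t \<in> V"
      obtain v l where vl: "t = (v, l)"
        by fastforce
      have nz: "?c v \<noteq> 0"
        using t unfolding vl V_def by auto
      moreover have "fst (from_triple (to_triple t)) = v"
        by (simp add: from_to_triple vl)
      ultimately have "to_triple t \<notin> R"
        using nonR[of "to_triple t"] by simp
      then show "to_triple t \<in> T - R"
        using t conv[OF nz, of l] sign_nz[of "to_triple t"] unfolding T_def V_def vl by simp
    qed (simp_all add: from_to_triple to_from_triple)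
    moreover have "sum triple_sign T = sum triple_sign (T - R)"
      by (subst sum.Int_Diff[OF fin, where B = R]) (simp add: 0)
    ultimately show "mseries triple_sign (triple_exponent K u w) $ d
      = mseries (\<lambda>(v, l). ?c v * sgn_pow l) (\<lambda>(v, l). theta_exponent K u w v + e l) $ d"
      by (simp add: mseries_def T_def V_def)
  qed
  also have "\<dots> = mseries ?c (theta_exponent K u w) * qinf K K"
    unfolding pent by (rule mseries_mult[OF adm_theta adm_e, symmetric])
  finally have "qinf K K * (qinf K K ^ 2 * ((qinf u K * qinf (K - u) K) * (qinf w K * qinf (K - w) K) * (qinf (u + w) K * qinf (K - (u + w)) K)))
      = qinf K K * mseries ?c (theta_exponent K u w)"
    unfolding triple[symmetric] by (simp add: power2_eq_square mult_ac)
  then show "qinf K K ^ 2 * ((qinf u K * qinf (K - u) K) * (qinf w K * qinf (K - w) K) * (qinf (u + w) K * qinf (K - (u + w)) K))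
      = mseries ?c (theta_exponent K u w)"
    using qinf_nonzero[OF K K] by simp
qed

section \<open>The multisum side\<close>

lemma sum_PiE_insert:
  assumes "i \<notin> I"
  shows "(\<Sum>f\<in>PiE (insert i I) A. h f) = (\<Sum>x\<in>A i. \<Sum>f\<in>PiE I A. h (f(i := x)))"
proof -
  have inj: "inj_on (\<lambda>(x, f). f(i := x)) (A i \<times> PiE I A)"
    using inj_combinator[OF assms, of A] by (simp add: case_prod_unfold)
  have "(\<Sum>f\<in>PiE (insert i I) A. h f) = (\<Sum>(x, f)\<in>A i \<times> PiE I A. h (f(i := x)))"
    unfolding PiE_insert_eq sum.reindex[OF inj] by (simp add: case_prod_unfold comp_def)
  then show ?thesis
    by (simp add: sum.cartesian_product)
qed

lemma sum_int_atLeastAtMost: "(\<Sum>n\<in>{0..int x}. g n) = (\<Sum>n\<le>x. g (int n))"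
  by (rule sum.reindex_bij_witness[of _ int nat]) auto

context not_root_of_unity_char_neq_2
begin

text \<open>\<open>chain e k j\<close> has summed the pairs with indices \<open>k - j\<close> to
  \<open>k - 1\<close> and is a function of the pair with index \<open>k - 1 - j\<close>. For
  \<open>j = k - 1\<close> this is a fictitious outer pair \<open>(n_0, m_0)\<close>, later set to
  \<open>(L, 0)\<close>.\<close>

primrec chain :: "(nat \<Rightarrow> int) \<Rightarrow> nat \<Rightarrow> nat \<Rightarrow> int \<Rightarrow> int \<Rightarrow> 'a" where
  "chain e k 0 = seed"
| "chain e k (Suc j) = one_sided_step (e (k - 1 - j)) (chain e k j)"

lemma chain_eq_0: "m > 2 * n \<Longrightarrow> chain e k j n m = 0"
proof (cases j)
  case (Suc i)
  have "G (n - n' + m' - m) = 0" if "m > 2 * n" "n' \<in> {0..n}" "m' \<in> {0..2*n'}" for n' m'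
    using that by (intro iqfac_neg) auto
  then show "m > 2 * n \<Longrightarrow> chain e k j n m = 0"
    unfolding Suc chain.simps one_sided_step_def by (intro sum.neutral ballI) simp
qed (simp add: seed_def)

definition step_exponent :: "int \<Rightarrow> nat \<Rightarrow> nat \<Rightarrow> int" where
  "step_exponent e n m = int n * int n - int n * int m + int m * int m + int m + e * int n"

definition link :: "nat \<Rightarrow> nat \<Rightarrow> nat \<Rightarrow> nat \<Rightarrow> 'a" where
  "link N M n m = F (int N - int n + int m) * G (int M) * G (int N - int n + int m - int M) * G (int N - int n)"

lemma chain_Suc:
  assumes "x \<le> L"
  shows "chain e k (Suc j) (int x) (int y) = (\<Sum>n\<le>L. \<Sum>m\<le>2*L.
    q powi step_exponent (e (k - 1 - j)) n m * link x y n m * chain e k j (int n) (int m))"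
proof -
  let ?t = "\<lambda>n m. q powi step_exponent (e (k - 1 - j)) n m * link x y n m * chain e k j (int n) (int m)"
  have "chain e k (Suc j) (int x) (int y) = (\<Sum>n\<le>x. \<Sum>m\<in>{0..2*int n}.
     q powi (int n * int n - int n * m + m * m + m + e (k - 1 - j) * int n)
       * (F (int x - int n + m) * G (int y) * G (int x - int n + m - int y)) * G (int x - int n) * chain e k j (int n) m)"
    unfolding chain.simps one_sided_step_def sum_int_atLeastAtMost ..
  also have "\<dots> = (\<Sum>n\<le>x. \<Sum>m\<le>2*n. ?t n m)"
  proof (rule sum.cong[OF refl])
    fix n
    have "2 * int n = int (2 * n)"
      by simp
    then show "(\<Sum>m\<in>{0..2*int n}.
     q powi (int n * int n - int n * m + m * m + m + e (k - 1 - j) * int n)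
       * (F (int x - int n + m) * G (int y) * G (int x - int n + m - int y)) * G (int x - int n) * chain e k j (int n) m)
      = (\<Sum>m\<le>2*n. ?t n m)"
      unfolding step_exponent_def link_def by (simp only: sum_int_atLeastAtMost mult.assoc)
  qed
  also have "\<dots> = (\<Sum>n\<le>x. \<Sum>m\<le>2*L. ?t n m)"
  proof (rule sum.cong[OF refl], rule sum.mono_neutral_left)
    fix n assume "n \<in> {..x}"
    then show "{..2*n} \<subseteq> {..2*L}"
      using assms by auto
    show "\<forall>m\<in>{..2*L} - {..2*n}. ?t n m = 0"
      by (auto simp: chain_eq_0)
  qed auto
  also have "\<dots> = (\<Sum>n\<le>L. \<Sum>m\<le>2*L. ?t n m)"
  proof (rule sum.mono_neutral_left)
    show "\<forall>n\<in>{..L} - {..x}. (\<Sum>m\<le>2*L. ?t n m) = 0"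
      by (auto simp: link_def intro!: sum.neutral)
  qed (use assms in auto)
  finally show ?thesis .
qed

definition weight :: "(nat \<Rightarrow> int) \<Rightarrow> nat \<Rightarrow> nat \<Rightarrow> (nat \<Rightarrow> nat) \<Rightarrow> (nat \<Rightarrow> nat) \<Rightarrow> 'a" where
  "weight e k i f g = (\<Prod>l\<in>{Suc i..k-1}. q powi step_exponent (e l) (f l) (g l))
     * (\<Prod>l\<in>{i..<k-1}. link (f l) (g l) (f (Suc l)) (g (Suc l))) * seed (int (f (k - 1))) (int (g (k - 1)))"

lemma weight_cong:
  assumes "\<And>l. i \<le> l \<Longrightarrow> l \<le> k - 1 \<Longrightarrow> f l = f' l" "\<And>l. i \<le> l \<Longrightarrow> l \<le> k - 1 \<Longrightarrow> g l = g' l" "i \<le> k - 1"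
  shows "weight e k i f g = weight e k i f' g'"
  unfolding weight_def using assms by (intro arg_cong2[of _ _ _ _ "(*)"] prod.cong) auto

lemma weight_Suc:
  assumes "Suc i \<le> k - 1"
  shows "weight e k i f g = q powi step_exponent (e (Suc i)) (f (Suc i)) (g (Suc i))
     * link (f i) (g i) (f (Suc i)) (g (Suc i)) * weight e k (Suc i) f g"
proof -
  have "{Suc i..k-1} = insert (Suc i) {Suc (Suc i)..k-1}" "{i..<k-1} = insert i {Suc i..<k-1}"
    using assms by auto
  then show ?thesis
    by (simp add: weight_def mult_ac)
qed

text \<open>Since the inverse factorials and the chain vanish outside the true ranges, all ranges
  can be widened to one box independent of the outer indices. Only then do the nested sums merge
  into a sum over functions.\<close>

lemma chain_expand:
  assumes "j \<le> k - 1" "k \<ge> 1" "x \<le> L"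
  shows "chain e k j (int x) (int y) = (\<Sum>f\<in>PiE {k-j..k-1} (\<lambda>_. {..L}). \<Sum>g\<in>PiE {k-j..k-1} (\<lambda>_. {..2*L}).
     weight e k (k - 1 - j) (f(k - 1 - j := x)) (g(k - 1 - j := y)))"
  using assms
proof (induction j arbitrary: x y)
  case 0
  have "{k..k - 1} = {}"
    using 0 by auto
  then show ?case
    by (simp add: weight_def)
next
  case (Suc j)
  define i where "i = k - 1 - Suc j"
  have i: "k - 1 - j = Suc i" "k - j = Suc (Suc i)" "k - Suc j = Suc i" "Suc i \<le> k - 1"
    using Suc.prems by (auto simp: i_def)
  define I where "I = {Suc (Suc i)..k-1}"
  have I: "{Suc i..k-1} = insert (Suc i) I" "Suc i \<notin> I"
    using i(4) by (auto simp: I_def)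
  define h where "h f g = weight e k i (f(i := x)) (g(i := y))" for f g
  define A where "A = PiE I (\<lambda>_. {..L})"
  define B where "B = PiE I (\<lambda>_. {..2*L})"
  have "chain e k (Suc j) (int x) (int y) = (\<Sum>n\<le>L. \<Sum>m\<le>2*L. \<Sum>f\<in>A. \<Sum>g\<in>B. h (f(Suc i := n)) (g(Suc i := m)))"
    unfolding chain_Suc[OF Suc.prems(3)]
  proof (intro sum.cong refl)
    fix n m assume "n \<in> {..L}" "m \<in> {..2*L}"
    then have "j \<le> k - 1" "n \<le> L"
      using Suc.prems by auto
    from Suc.IH[OF this(1) Suc.prems(2) this(2), of m]
    have "chain e k j (int n) (int m) = (\<Sum>f\<in>A. \<Sum>g\<in>B. weight e k (Suc i) (f(Suc i := n)) (g(Suc i := m)))"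
      unfolding i A_def B_def I_def .
    moreover have "q powi step_exponent (e (Suc i)) n m * link x y n m * weight e k (Suc i) (f(Suc i := n)) (g(Suc i := m))
        = h (f(Suc i := n)) (g(Suc i := m))" for f g
    proof -
      have "weight e k (Suc i) (f(Suc i := n, i := x)) (g(Suc i := m, i := y)) = weight e k (Suc i) (f(Suc i := n)) (g(Suc i := m))"
        using i(4) by (intro weight_cong) auto
      then show ?thesis
        unfolding h_def weight_Suc[OF i(4)] by simp
    qed
    ultimately show "q powi step_exponent (e (k - 1 - j)) n m * link x y n m * chain e k j (int n) (int m)
      = (\<Sum>f\<in>A. \<Sum>g\<in>B. h (f(Suc i := n)) (g(Suc i := m)))"
      unfolding i by (simp add: sum_distrib_left)
  qed
  also have "\<dots> = (\<Sum>n\<le>L. \<Sum>f\<in>A. \<Sum>m\<le>2*L. \<Sum>g\<in>B. h (f(Suc i := n)) (g(Suc i := m)))"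
    by (rule sum.cong[OF refl], rule sum.swap)
  also have "\<dots> = (\<Sum>f\<in>PiE (insert (Suc i) I) (\<lambda>_. {..L}). \<Sum>g\<in>PiE (insert (Suc i) I) (\<lambda>_. {..2*L}). h f g)"
    unfolding sum_PiE_insert[OF I(2)] A_def B_def ..
  finally show ?case
    unfolding i(3) I(1) i_def[symmetric] h_def .
qed

lemma chain_eq_funpow:
  assumes "1 \<le> s" "s \<le> k"
  shows "chain (\<lambda>l. if s \<le> l then 1 else 0) k (k - 1) = (one_sided_step 0 ^^ (s - 1)) ((one_sided_step 1 ^^ (k - s)) seed)"
proof -
  let ?e = "\<lambda>l. if s \<le> l then 1 else (0 :: int)"
  have 1: "j \<le> k - s \<Longrightarrow> chain ?e k j = (one_sided_step 1 ^^ j) seed" for j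
  proof (induction j)
    case (Suc j)
    then have "s \<le> k - 1 - j"
      by linarith
    then have e: "?e (k - 1 - j) = 1"
      by simp
    have "chain ?e k j = (one_sided_step 1 ^^ j) seed"
      using Suc by simp
    with e show ?case
      by (simp only: chain.simps funpow.simps comp_def)
  qed simp
  have 2: "b \<le> s - 1 \<Longrightarrow> chain ?e k (k - s + b) = (one_sided_step 0 ^^ b) ((one_sided_step 1 ^^ (k - s)) seed)" for b
  proof (induction b)
    case (Suc b)
    then have "\<not> s \<le> k - 1 - (k - s + b)"
      using assms by linarith
    then have e: "?e (k - 1 - (k - s + b)) = 0"
      by simp
    have "chain ?e k (k - s + b) = (one_sided_step 0 ^^ b) ((one_sided_step 1 ^^ (k - s)) seed)"
      using Suc by simp
    with e show ?case
      by (simp only: add_Suc_right chain.simps funpow.simps comp_def)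
  qed (simp add: 1)
  have "k - s + (s - 1) = k - 1"
    using assms by simp
  with 2[of "s - 1"] show ?thesis
    by simp
qed

lemma qfac_telescope:
  "K \<ge> 1 \<Longrightarrow> G (int (n 1)) * (\<Prod>l\<in>{1..<K}. F (int (n l)) * G (int (n (Suc l)))) = G (int (n K))"
proof (induction K rule: dec_induct)
  case (step K)
  have "{1..<Suc K} = insert K {1..<K}"
    using step by auto
  then have "G (int (n 1)) * (\<Prod>l\<in>{1..<Suc K}. F (int (n l)) * G (int (n (Suc l))))
     = (F (int (n K)) * G (int (n K))) * G (int (n (Suc K)))"
    using step.IH[symmetric] by (simp add: mult_ac)
  then show ?case
    by (simp add: qfac_iqfac)
qed simp

end

lemma (in not_root_of_unity) powi_sum: "(\<Prod>l\<in>I. q powi f l) = q powi sum f I"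
  by (induction I rule: infinite_finite_induct) (simp_all add: powi_add)

section \<open>Transfer of the multisum from Laurent series to power series\<close>

interpretation X: not_root_of_unity_char_neq_2 "fls_X :: rat fls"
  using fls_X_power_not_root_of_unity[of 1] by simp

definition fps_qfac :: "int \<Rightarrow> rat fps" where
  "fps_qfac n = (if n < 0 then 0 else qprod 1 1 (nat n))"

definition fps_iqfac :: "int \<Rightarrow> rat fps" where
  "fps_iqfac n = (if n < 0 then 0 else inverse (qprod 1 1 (nat n)))"

lemma qfac_fls_X: "X.F n = fps_to_fls (fps_qfac n)"
  using qfac_fls_X_power[of 1 "nat n"] by (auto simp: fps_qfac_def)

lemma iqfac_fls_X: "X.G n = fps_to_fls (fps_iqfac n)"
  using iqfac_fls_X_power[of 1 "nat n"] by (auto simp: fps_iqfac_def)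

lemma powi_fls_X: "n \<ge> 0 \<Longrightarrow> fls_X powi n = fps_to_fls (fps_X ^ nat n :: rat fps)"
  unfolding power_int_def by (simp only: if_True fps_to_fls_power fps_X_to_fls)

lemma range_fps_to_fls_mult:
  "a \<in> range fps_to_fls \<Longrightarrow> b \<in> range fps_to_fls \<Longrightarrow> a * b \<in> range (fps_to_fls :: rat fps \<Rightarrow> _)"
  by (auto simp: fls_times_fps_to_fls[symmetric])

lemma range_fps_to_fls_add:
  "a \<in> range fps_to_fls \<Longrightarrow> b \<in> range fps_to_fls \<Longrightarrow> a + b \<in> range (fps_to_fls :: rat fps \<Rightarrow> _)"
  by (elim rangeE) (metis fps_to_fls_plus rangeI)

lemma range_fps_to_fls_sum:
  "(\<And>x. x \<in> A \<Longrightarrow> f x \<in> range fps_to_fls) \<Longrightarrow> sum f A \<in> range (fps_to_fls :: rat fps \<Rightarrow> _)"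
  by (induction A rule: infinite_finite_induct)
    (auto simp: range_fps_to_fls_add simp flip: fps_zero_to_fls)

lemma range_fps_to_fls_prod:
  "(\<And>x. x \<in> A \<Longrightarrow> f x \<in> range fps_to_fls) \<Longrightarrow> prod f A \<in> range (fps_to_fls :: rat fps \<Rightarrow> _)"
  by (induction A rule: infinite_finite_induct)
    (auto simp: range_fps_to_fls_mult simp flip: fps_one_to_fls)

lemma step_exponent_bounds:
  assumes "e \<in> {0, 1}"
  shows "X.step_exponent e n m \<ge> 0" and "3 * (int n * int n) \<le> 4 * X.step_exponent e n m"
proof -
  define a where "a = (int n - 2 * int m) * (int n - 2 * int m)"
  define b where "b = int m + e * int n"
  have "4 * X.step_exponent e n m = 3 * (int n * int n) + a + 4 * b"
    by (simp add: X.step_exponent_def a_def b_def algebra_simps)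
  moreover have "a \<ge> 0"
    by (simp add: a_def)
  moreover have "b \<ge> 0"
    using assms by (auto simp: b_def)
  ultimately show *: "3 * (int n * int n) \<le> 4 * X.step_exponent e n m"
    by linarith
  moreover have "int n * int n \<ge> 0"
    by simp
  ultimately show "X.step_exponent e n m \<ge> 0"
    by linarith
qed

text \<open>Every exponent in the expanded chain is nonnegative. This allows its values to be
  compared order by order as power series in the limit argument.\<close>

lemma chain_in_range:
  assumes "j \<le> k - 1" "k \<ge> 1" "\<And>l. e l \<in> {0, 1}"
  shows "X.chain e k j (int x) (int y) \<in> range fps_to_fls"
  unfolding X.chain_expand[OF assms(1,2) order_refl] X.weight_def X.link_def X.seed_def qfac_fls_X iqfac_fls_X
    powi_fls_X[OF step_exponent_bounds(1)[OF assms(3)]]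
  by (intro range_fps_to_fls_sum range_fps_to_fls_mult range_fps_to_fls_prod rangeI)

lemma qpoch_eq_qprod: "qpoch fps_X fps_X n = qprod 1 1 n"
proof -
  have "qpoch_inf fps_X fps_X = qprod 1 1 n * qpoch_inf (fps_X * fps_X ^ n) fps_X"
    using qinf_split[of 1 1 n] by simp
  moreover have "qpoch_inf (fps_X * fps_X ^ n) fps_X \<noteq> 0"
    using qinf_nonzero[of "Suc n" 1] by simp
  ultimately show ?thesis
    by (simp add: qpoch_def)
qed

lemma qbinom_fls: "fps_to_fls (qbinom A (int m)) = X.F A * X.G (int m) * X.G (A - int m)"
proof (cases "int m \<le> A")
  case True
  then have "qbinom A (int m) = qprod 1 1 (nat A) / (qprod 1 1 m * qprod 1 1 (nat (A - int m)))"
    by (simp add: qbinom_def qpoch_eq_qprod)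
  also have "\<dots> = qprod 1 1 (nat A) * (inverse (qprod 1 1 m) * inverse (qprod 1 1 (nat (A - int m))))"
    by (simp add: fps_divide_unit fps_inverse_mult qprod_nth_0)
  finally show ?thesis
    using True by (simp add: qfac_fls_X iqfac_fls_X fps_qfac_def fps_iqfac_def fls_times_fps_to_fls mult_ac)
qed (simp add: qbinom_def)

lemma qbinom_nonzeroD: "qbinom A (int m) \<noteq> 0 \<Longrightarrow> int m \<le> A"
  by (auto simp: qbinom_def split: if_splits)

definition summand :: "nat \<Rightarrow> nat \<Rightarrow> (nat \<Rightarrow> nat) \<Rightarrow> (nat \<Rightarrow> nat) \<Rightarrow> rat fps" where
  "summand k s n m = fps_X ^ summand_exponent k s n m / qpoch fps_X fps_X (n 1)
             * qbinom (2 * int (n (k - 1))) (int (m (k - 1)))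
             * (\<Prod>i=1..k-2.
                  qbinom (int (n i)) (int (n (i + 1)))
                  * qbinom (int (n i) - int (n (i + 1)) + int (m (i + 1))) (int (m i)))"

definition indicator_from :: "nat \<Rightarrow> nat \<Rightarrow> int" where
  "indicator_from s l = (if s \<le> l then 1 else 0)"

lemma indicator_from_cases: "indicator_from s l \<in> {0, 1}"
  by (simp add: indicator_from_def)

lemma summand_exponent_eq:
  assumes "1 \<le> s"
  shows "int (summand_exponent k s n m) = (\<Sum>l\<in>{1..k-1}. X.step_exponent (indicator_from s l) (n l) (m l))"
proof -
  have "(\<Sum>l\<in>{s..k-1}. int (n l)) = (\<Sum>l\<in>{1..k-1}. indicator_from s l * int (n l))"
    by (rule sum.mono_neutral_cong_left) (use assms in \<open>auto simp: indicator_from_def\<close>)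
  then have "(\<Sum>i=1..k-1. int (n i) ^ 2 - int (n i) * int (m i) + int (m i) ^ 2 + int (m i)) + (\<Sum>i=s..k-1. int (n i))
     = (\<Sum>l\<in>{1..k-1}. X.step_exponent (indicator_from s l) (n l) (m l))"
    by (simp add: sum.distrib[symmetric] X.step_exponent_def power2_eq_square)
  moreover have "(\<Sum>l\<in>{1..k-1}. X.step_exponent (indicator_from s l) (n l) (m l)) \<ge> 0"
    by (intro sum_nonneg step_exponent_bounds indicator_from_cases)
  ultimately show ?thesis
    by (simp add: summand_exponent_def)
qed

lemma summand_fls:
  assumes "k \<ge> 2" "1 \<le> s"
  shows "fps_to_fls (summand k s n m)
    = fls_X powi X.step_exponent (indicator_from s 1) (n 1) (m 1) * X.weight (indicator_from s) k 1 n m"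
proof -
  let ?E = "\<lambda>l. X.step_exponent (indicator_from s l) (n l) (m l)"
  define A where "A l = int (n l) - int (n (Suc l)) + int (m (Suc l))" for l
  have int_1: "{1..k-2} = {1..<k-1}"
    using assms by auto
  have "{1..k-1} = insert 1 {Suc 1..k-1}"
    using assms by auto
  then have E: "(\<Sum>l\<in>{1..k-1}. ?E l) = ?E 1 + (\<Sum>l\<in>{Suc 1..k-1}. ?E l)"
    by simp
  have "fps_to_fls (fps_X ^ summand_exponent k s n m) = (fls_X :: rat fls) powi int (summand_exponent k s n m)"
    by (simp only: fps_to_fls_power fps_X_to_fls power_int_of_nat)
  then have 1: "fps_to_fls (fps_X ^ summand_exponent k s n m) = (fls_X :: rat fls) powi ?E 1 * (\<Prod>l\<in>{Suc 1..k-1}. fls_X powi ?E l)"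
    unfolding summand_exponent_eq[OF assms(2)] E X.powi_add
    by (simp only: X.powi_sum[of ?E "{Suc 1..k-1}"])
  have "fps_X ^ summand_exponent k s n m / qpoch fps_X fps_X (n 1) = fps_X ^ summand_exponent k s n m * fps_iqfac (int (n 1))"
    by (simp add: qpoch_eq_qprod fps_iqfac_def fps_divide_unit qprod_nth_0)
  then have "fps_to_fls (summand k s n m) = fps_to_fls (fps_X ^ summand_exponent k s n m) * X.G (int (n 1))
     * (X.F (2 * int (n (k - 1))) * X.G (int (m (k - 1))) * X.G (2 * int (n (k - 1)) - int (m (k - 1))))
     * (\<Prod>l\<in>{1..<k-1}. (X.F (int (n l)) * X.G (int (n (Suc l))) * X.G (int (n l) - int (n (Suc l))))
          * (X.F (A l) * X.G (int (m l)) * X.G (A l - int (m l))))"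
    unfolding summand_def int_1 by (simp add: fls_times_fps_to_fls fps_to_fls_prod qbinom_fls iqfac_fls_X[symmetric] A_def)
  also have "\<dots> = fls_X powi ?E 1 * ((\<Prod>l\<in>{Suc 1..k-1}. fls_X powi ?E l)
     * (\<Prod>l\<in>{1..<k-1}. X.F (A l) * X.G (int (m l)) * X.G (A l - int (m l)) * X.G (int (n l) - int (n (Suc l))))
     * (X.F (2 * int (n (k - 1))) * X.G (int (m (k - 1))) * X.G (2 * int (n (k - 1)) - int (m (k - 1)))
        * (X.G (int (n 1)) * (\<Prod>l\<in>{1..<k-1}. X.F (int (n l)) * X.G (int (n (Suc l)))))))"
    unfolding 1 prod.distrib by (simp only: mult_ac)
  also have "X.G (int (n 1)) * (\<Prod>l\<in>{1..<k-1}. X.F (int (n l)) * X.G (int (n (Suc l)))) = X.G (int (n (k - 1)))"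
    by (rule X.qfac_telescope) (use assms in simp)
  finally show ?thesis
    unfolding X.weight_def X.link_def X.seed_def A_def .
qed

text \<open>The exponent of the first pair alone gives \<open>3 n_1^2 <= 4 d\<close>. Nonvanishing
  binomials make the \<open>n_i\<close> decreasing, and
  \<open>m_i <= n_i - n_(i+1) + m_(i+1)\<close> telescopes, starting from
  \<open>m_(k-1) <= 2 n_(k-1)\<close>, to \<open>m_i <= n_i + n_(k-1)\<close>.\<close>

lemma summand_support:
  assumes k: "k \<ge> 2" and s: "1 \<le> s" and nz: "summand k s n m $ d \<noteq> 0" and l: "l \<in> {1..k-1}"
  shows "n 1 \<le> d + 1" and "n l \<le> n 1" and "m l \<le> 2 * n 1"
proof -
  define r where "r = inverse (qprod 1 1 (n 1)) * qbinom (2 * int (n (k - 1))) (int (m (k - 1)))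
             * (\<Prod>i=1..k-2.
                  qbinom (int (n i)) (int (n (i + 1)))
                  * qbinom (int (n i) - int (n (i + 1)) + int (m (i + 1))) (int (m i)))"
  have eq: "summand k s n m = fps_X ^ summand_exponent k s n m * r"
    by (simp add: summand_def r_def qpoch_eq_qprod fps_divide_unit qprod_nth_0 mult.assoc)
  have "summand_exponent k s n m \<le> d"
    using nz unfolding eq by (simp add: fps_X_power_mult_nth split: if_splits)
  moreover have "X.step_exponent (indicator_from s 1) (n 1) (m 1) \<le> int (summand_exponent k s n m)"
    unfolding summand_exponent_eq[OF s]
    by (rule member_le_sum) (use k in \<open>auto intro!: step_exponent_bounds indicator_from_cases\<close>)
  ultimately have le: "3 * (int (n 1) * int (n 1)) \<le> 4 * int d"
    using step_exponent_bounds(2)[OF indicator_from_cases, of "n 1" s 1 "m 1"] by linarith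
  show "n 1 \<le> d + 1"
  proof (rule ccontr)
    assume "\<not> n 1 \<le> d + 1"
    then have "int d + 2 \<le> int (n 1)"
      by simp
    then have "(int d + 2) * (int d + 2) \<le> int (n 1) * int (n 1)"
      by (intro mult_mono) auto
    moreover have "(int d + 2) * (int d + 2) = int d * int d + 4 * int d + 4" "int d * int d \<ge> 0"
      by (simp_all add: algebra_simps)
    ultimately show False
      using le by linarith
  qed
  have "r \<noteq> 0"
    using nz eq by auto
  then have last: "m (k - 1) \<le> 2 * n (k - 1)"
    and nz': "\<And>i. i \<in> {1..k-2} \<Longrightarrow> qbinom (int (n i)) (int (n (i + 1))) \<noteq> 0
        \<and> qbinom (int (n i) - int (n (i + 1)) + int (m (i + 1))) (int (m i)) \<noteq> 0"
    using qbinom_nonzeroD[of "2 * int (n (k - 1))" "m (k - 1)"] by (auto simp: r_def)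
  have step: "n (Suc i) \<le> n i" "int (m i) \<le> int (n i) - int (n (Suc i)) + int (m (Suc i))" if "1 \<le> i" "i < k - 1" for i
    using nz'[of i] that qbinom_nonzeroD[of "int (n i)" "n (Suc i)"] qbinom_nonzeroD[of _ "m i"] by auto
  have mono: "n (k - 1) \<le> n i \<and> int (m i) \<le> int (n i) + int (n (k - 1))" if "1 \<le> i" "i \<le> k - 1" for i
    using that(2,1)
  proof (induction rule: inc_induct)
    case base
    then show ?case
      using last by simp
  next
    case (step i)
    then show ?case
      using \<open>\<And>i. \<lbrakk>1 \<le> i; i < k - 1\<rbrakk> \<Longrightarrow> n (Suc i) \<le> n i\<close>[of i]
        \<open>\<And>i. \<lbrakk>1 \<le> i; i < k - 1\<rbrakk> \<Longrightarrow> int (m i) \<le> int (n i) - int (n (Suc i)) + int (m (Suc i))\<close>[of i] by simp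
  qed
  have "1 \<le> l" "l \<le> k - 1"
    using l by auto
  then show n: "n l \<le> n 1"
  proof (induction l rule: dec_induct)
    case (step i)
    then show ?case
      using \<open>\<And>i. \<lbrakk>1 \<le> i; i < k - 1\<rbrakk> \<Longrightarrow> n (Suc i) \<le> n i\<close>[of i] by simp
  qed simp
  show "m l \<le> 2 * n 1"
    using mono[of l] mono[of l] n \<open>1 \<le> l\<close> \<open>l \<le> k - 1\<close> by linarith
qed

lemma fps_iqfac_agree: "n \<ge> int d \<Longrightarrow> fps_agree d (fps_iqfac n * qinf 1 1) 1"
proof -
  assume n: "n \<ge> int d"
  then have "fps_iqfac n * qinf 1 1 = qinf (1 + 1 * nat n) 1"
    using inverse_qprod_mult_qinf[of 1 1 "nat n"] by (simp only: fps_iqfac_def) auto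
  moreover have "fps_agree d (qinf (1 + 1 * nat n) 1) 1"
    using n by (intro qinf_agree_1) auto
  ultimately show ?thesis
    by simp
qed

lemma fps_qfac_agree: "n \<ge> int d \<Longrightarrow> fps_agree d (fps_qfac n) (qinf 1 1)"
proof -
  assume n: "n \<ge> int d"
  then have "fps_agree d (qinf 1 1) (qprod 1 1 (nat n))"
    by (intro qinf_agree_qprod) auto
  with n show ?thesis
    by (simp add: fps_qfac_def fps_agree_sym)
qed

definition fps_kern :: "int \<Rightarrow> int \<times> int \<Rightarrow> rat fps" where
  "fps_kern L = (\<lambda>(x, y). fps_qfac (3 * L + 1) * (fps_iqfac (L + 1 - x) * fps_iqfac (L - y) * fps_iqfac (L + x + y))
     * (fps_iqfac (2 * L + x) * fps_iqfac (2 * L + 1 + y) * fps_iqfac (2 * L + 1 - x - y)))"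

lemma kernA_fls: "X.kernA x y L (2 * L) = fps_to_fls (fps_kern L (x, y))"
  by (simp add: X.kernA_def X.kern_def fps_kern_def qfac_fls_X iqfac_fls_X fls_times_fps_to_fls algebra_simps)

text \<open>The kernel has one factorial in the numerator and six in the denominator, so it tends to
  the power -5 of \<open>(q)_\<infinity>\<close>. The bound keeps every factorial argument at least
  \<open>d\<close>.\<close>

lemma fps_kern_agree:
  assumes "\<bar>x\<bar> + \<bar>y\<bar> + int d \<le> L"
  shows "fps_agree d (fps_kern L (x, y) * qinf 1 1 ^ 5) 1"
proof -
  define P where "P = qinf 1 1"
  have G: "fps_agree d (fps_iqfac n * P) 1" if "n \<ge> int d" for n
    unfolding P_def using that by (rule fps_iqfac_agree)
  define g where "g = fps_iqfac (L + 1 - x) * fps_iqfac (L - y) * fps_iqfac (L + x + y)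
     * (fps_iqfac (2 * L + x) * fps_iqfac (2 * L + 1 + y) * fps_iqfac (2 * L + 1 - x - y))"
  have "fps_agree d (fps_qfac (3 * L + 1)) P"
    unfolding P_def using assms by (intro fps_qfac_agree) linarith
  then have "fps_agree d (fps_qfac (3 * L + 1) * (g * P ^ 5)) (P * (g * P ^ 5))"
    by (rule fps_agree_mult[OF _ fps_agree_refl])
  also have "P * (g * P ^ 5) = (fps_iqfac (L + 1 - x) * P) * (fps_iqfac (L - y) * P) * (fps_iqfac (L + x + y) * P)
     * ((fps_iqfac (2 * L + x) * P) * (fps_iqfac (2 * L + 1 + y) * P) * (fps_iqfac (2 * L + 1 - x - y) * P))"
    by (simp add: g_def power_numeral_reduce mult_ac)
  also have "fps_agree d \<dots> (1 * 1 * 1 * (1 * 1 * 1))"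
    using assms by (intro fps_agree_mult G) linarith+
  finally show ?thesis
    by (simp add: fps_kern_def g_def P_def mult_ac)
qed

text \<open>A nonzero \<open>chi\<close> means \<open>x^2 + x y + y^2 = 3 Q + 1\<close>. The
  multiples of \<open>Q\<close> add up to \<open>4 + 3 (k - 1) = 3 k + 1\<close>, and the linear
  parts to \<open>s (1 - x) + (1 - x - y)\<close>.\<close>

lemma coeff_exponent_eq:
  assumes "chi (x - y) \<noteq> (0 :: rat)" "1 \<le> s" "s \<le> k"
  shows "X.coeff_exponent (k - s) (s - 1) x y = theta_exponent (3 * k + 1) s 1 (x, y)"
proof -
  define Q where "Q = (x * x + x * y + y * y - 1) div 3"
  have "(x * x + x * y + y * y - 1) mod 3 = 0"
  proof -
    define t where "t = (x - y) div 3"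
    have "(x - y) mod 3 \<noteq> 0"
      using assms(1) by (auto simp: chi_def)
    then have "x = y + 3 * t + 1 \<or> x = y + 3 * t + 2"
      unfolding t_def by presburger
    then have "x * x + x * y + y * y - 1 = 3 * (y * y + 3 * t * y + 3 * t * t + 2 * t + y)
      \<or> x * x + x * y + y * y - 1 = 3 * (y * y + 3 * t * y + 3 * t * t + 4 * t + 2 * y + 1)"
      by (elim disjE) (simp_all add: algebra_simps)
    then show ?thesis
      by (elim disjE) (simp_all only: mod_mult_self1_is_0)
  qed
  then have Q: "x * x + x * y + y * y = 3 * Q + 1"
    unfolding Q_def using div_mult_mod_eq[of "x * x + x * y + y * y - 1" 3] by linarith
  have "int (k - s) = int k - int s" "int (s - 1) = int s - 1"
    using assms by auto
  then show ?thesis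
    unfolding X.coeff_exponent_def theta_exponent_def case_prod_conv Q by (simp add: algebra_simps)
qed

section \<open>The limit\<close>

text \<open>
  Only the term \<open>m = 0\<close> of \<open>two_sided\<close> survives in the limit, which is taken along \<open>(r, s) = (L, 2L)\<close>.
\<close>

lemma sum_summand_agree:
  assumes k: "k \<ge> 2" and s: "1 \<le> s" "s \<le> k" and L0: "\<And>x y. chi (x - y) \<noteq> (0 :: rat)
      \<Longrightarrow> theta_exponent (3 * k + 1) s 1 (x, y) \<le> int d \<Longrightarrow> \<bar>x\<bar> + \<bar>y\<bar> + int d \<le> int L"
    and L: "L \<ge> 2 * d + 1"
  shows "fps_agree d (qinf 1 1 ^ 2 * (\<Sum>f\<in>PiE {1..k-1} (\<lambda>_. {..L}). \<Sum>g\<in>PiE {1..k-1} (\<lambda>_. {..2*L}). summand k s f g))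
     (mseries (\<lambda>(x, y). chi (x - y)) (theta_exponent (3 * k + 1) s 1))"
proof -
  let ?\<Theta> = "mseries (\<lambda>(x, y). chi (x - y)) (theta_exponent (3 * k + 1) s 1)"
  define P where "P = qinf 1 1"
  define e where "e = indicator_from s"
  define A where "A = PiE {1..k-1} (\<lambda>_. {..L})"
  define B where "B = PiE {1..k-1} (\<lambda>_. {..2*L})"
  define H where "H = X.chain e k (k - 1)"
  have e: "e l \<in> {0, 1}" for l
    unfolding e_def by (rule indicator_from_cases)
  have "\<exists>h. \<forall>m. H (int L) (int m) = fps_to_fls (h m)"
    unfolding H_def using chain_in_range[of "k - 1" k e L] k e by (intro choice) (auto simp: image_iff)
  then obtain h where h: "H (int L) (int m) = fps_to_fls (h m)" for m
    by blast
  \<comment> \<open>At the outer pair \<open>(L, 0)\<close> the binomial of the outermost link is 1,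
    so the link adds only \<open>1 / (q)_(L - n_1)\<close> to the summand.\<close>
  have "H (int L) (int 0) = (\<Sum>f\<in>A. \<Sum>g\<in>B. X.weight e k 0 (f(0 := L)) (g(0 := 0)))"
    unfolding H_def A_def B_def using k by (subst X.chain_expand[of _ _ L L]) auto
  also have "\<dots> = (\<Sum>f\<in>A. \<Sum>g\<in>B. fps_to_fls (summand k s f g * fps_iqfac (int L - int (f 1))))"
  proof (intro sum.cong refl)
    fix f g assume fg: "f \<in> A" "g \<in> B"
    have f1: "f 1 \<le> L"
      using fg k by (auto simp: A_def)
    have "X.weight e k (Suc 0) (f(0 := L)) (g(0 := 0)) = X.weight e k 1 f g"
      using k by (subst X.weight_cong[of "Suc 0" k _ f _ g]) auto
    then have "X.weight e k 0 (f(0 := L)) (g(0 := 0)) = fls_X powi X.step_exponent (e 1) (f 1) (g 1) * X.link L 0 (f 1) (g 1) * X.weight e k 1 f g"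
      using k by (subst X.weight_Suc) auto
    also have "X.link L 0 (f 1) (g 1) = X.G (int L - int (f 1))"
      using f1 by (simp add: X.link_def X.qfac_iqfac)
    also have "fls_X powi X.step_exponent (e 1) (f 1) (g 1) * X.G (int L - int (f 1)) * X.weight e k 1 f g
       = fps_to_fls (summand k s f g) * X.G (int L - int (f 1))"
      unfolding summand_fls[OF k s(1)] e_def by (simp only: mult_ac)
    also have "\<dots> = fps_to_fls (summand k s f g * fps_iqfac (int L - int (f 1)))"
      by (simp only: iqfac_fls_X fls_times_fps_to_fls)
    finally show "X.weight e k 0 (f(0 := L)) (g(0 := 0)) = \<dots>" .
  qed
  finally have h0: "h 0 = (\<Sum>f\<in>A. \<Sum>g\<in>B. summand k s f g * fps_iqfac (int L - int (f 1)))"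
    unfolding h by (simp add: fps_to_fls_sum[symmetric])
  have 1: "fps_agree d (\<Sum>f\<in>A. \<Sum>g\<in>B. summand k s f g) (P * h 0)"
  proof -
    have "fps_agree d (summand k s f g) (summand k s f g * (fps_iqfac (int L - int (f 1)) * P))" for f g
    proof (cases "f 1 \<le> d + 1")
      case True
      then have "fps_agree d (fps_iqfac (int L - int (f 1)) * P) 1"
        unfolding P_def using L by (intro fps_iqfac_agree) auto
      then show ?thesis
        using fps_agree_mult[OF fps_agree_refl[of d "summand k s f g"]] by (metis fps_agree_sym mult_1_right)
    next
      case False
      then have "fps_agree d (summand k s f g) 0"
        using summand_support(1)[OF k s(1), of f g _ 1] k unfolding fps_agree_def by fastforce
      then show ?thesis
        using fps_agree_mult[of d "summand k s f g" 0 "fps_iqfac (int L - int (f 1)) * P" "fps_iqfac (int L - int (f 1)) * P"]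
        by (metis fps_agree_refl fps_agree_sym fps_agree_trans mult_zero_left)
    qed
    then show ?thesis
      unfolding h0 sum_distrib_left by (intro fps_agree_sum) (simp add: mult_ac)
  qed
  \<comment> \<open>The choice \<open>s = 2 L\<close>, \<open>r = L\<close> turns the exponent
    \<open>m (s + m + 1 - r)\<close> into \<open>m (L + m + 1)\<close>, which exceeds
    \<open>d\<close> for every \<open>m >= 1\<close>. It is the growing difference
    \<open>s - r\<close> that isolates \<open>m = 0\<close>.\<close>
  define T where "T = (\<Sum>m\<le>2*L. fps_X ^ (m * (L + m + 1)) * (fps_iqfac (2 * int L) * fps_iqfac (int L + int m + 1) * h m))"
  have T: "X.two_sided H (int L) (2 * int L) = fps_to_fls T"
  proof -
    have "2 * int L = int (2 * L)"
      by simp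
    then have "X.two_sided H (int L) (2 * int L) = (\<Sum>m\<le>2*L. fls_X powi (int m * (2 * int L + int m + 1 - int L))
       * X.G (2 * int L) * X.G (2 * int L + int m + 1 - int L) * H (int L) (int m))"
      unfolding X.two_sided_def by (simp only: sum_int_atLeastAtMost)
    also have "\<dots> = fps_to_fls T"
      unfolding T_def fps_to_fls_sum
    proof (rule sum.cong[OF refl])
      fix m
      have "int m * (2 * int L + int m + 1 - int L) = int (m * (L + m + 1))" "2 * int L + int m + 1 - int L = int L + int m + 1"
        by (simp_all add: algebra_simps)
      then show "fls_X powi (int m * (2 * int L + int m + 1 - int L))
       * X.G (2 * int L) * X.G (2 * int L + int m + 1 - int L) * H (int L) (int m)
        = fps_to_fls (fps_X ^ (m * (L + m + 1)) * (fps_iqfac (2 * int L) * fps_iqfac (int L + int m + 1) * h m))"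
        by (simp only: h iqfac_fls_X fls_times_fps_to_fls fps_to_fls_power fps_X_to_fls power_int_of_nat mult_ac)
    qed
    finally show ?thesis .
  qed
  have 2: "fps_agree d (P ^ 2 * T) (h 0)"
  proof -
    let ?t = "\<lambda>m. P ^ 2 * (fps_X ^ (m * (L + m + 1)) * (fps_iqfac (2 * int L) * fps_iqfac (int L + int m + 1) * h m))"
    have "fps_agree d (?t m) (if m = 0 then h 0 else 0)" for m
    proof (cases m)
      case 0
      have "fps_agree d ((fps_iqfac (2 * int L) * P) * (fps_iqfac (int L + 1) * P) * h 0) (1 * 1 * h 0)"
        unfolding P_def using L by (intro fps_agree_mult fps_iqfac_agree fps_agree_refl) auto
      then show ?thesis
        by (simp add: 0 power2_eq_square mult_ac)
    next
      case (Suc m')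
      have "d < L + m + 1"
        using L by simp
      also have "\<dots> \<le> m * (L + m + 1)"
        by (simp add: Suc)
      finally have "fps_agree d (fps_X ^ (m * (L + m + 1)) * (P ^ 2 * (fps_iqfac (2 * int L) * fps_iqfac (int L + int m + 1) * h m))) 0"
        by (rule fps_agree_X_power_mult_0)
      then show ?thesis
        by (simp add: Suc mult_ac)
    qed
    then have "fps_agree d (\<Sum>m\<le>2*L. ?t m) (\<Sum>m\<le>2*L. if m = 0 then h 0 else 0)"
      by (intro fps_agree_sum)
    then show ?thesis
      by (simp add: T_def sum_distrib_left)
  qed
  define c :: "int \<times> int \<Rightarrow> rat" where "c = (\<lambda>(x, y). chi (x - y))"
  define E where "E = theta_exponent (3 * k + 1) s 1"
  have adm: "admissible c E"
    unfolding c_def E_def using k s by (intro theta_product(2)) auto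
  \<comment> \<open>The first set is what \<open>expands\<close> requires; the second makes sure
    that no theta term of order at most \<open>d\<close> is missed.\<close>
  define V where "V = X.ksupp (int L) (2 * int L) \<union> {v. c v \<noteq> 0 \<and> E v \<le> int d}"
  have V: "finite V" "X.ksupp (int L) (2 * int L) \<subseteq> V"
    using adm by (simp_all add: V_def X.finite_ksupp admissible_def)
  have T': "T = (\<Sum>v\<in>V. fps_const (c v) * fps_X ^ nat (E v) * fps_kern (int L) v)"
  proof -
    have H_eq: "H = (X.one_sided_step 0 ^^ (s - 1)) ((X.one_sided_step 1 ^^ (k - s)) X.seed)"
      unfolding H_def e_def indicator_from_def[abs_def] by (rule X.chain_eq_funpow[OF s])
    have "fps_to_fls T = (\<Sum>(x, y)\<in>V. chi (x - y) * fls_X powi X.coeff_exponent (k - s) (s - 1) x y * X.kernA x y (int L) (2 * int L))"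
      unfolding T[symmetric] H_eq
      using X.expands_iterate[of "s - 1" "k - s"] V unfolding X.expands_def by fastforce
    also have "\<dots> = (\<Sum>v\<in>V. fps_to_fls (fps_const (c v) * fps_X ^ nat (E v) * fps_kern (int L) v))"
    proof (rule sum.cong[OF refl])
      fix v :: "int \<times> int"
      obtain x y where v: "v = (x, y)"
        by fastforce
      have chi: "(chi (x - y) :: rat fls) = fps_to_fls (fps_const (c v))"
        by (simp add: v c_def chi_def)
      show "(case v of (x, y) \<Rightarrow> chi (x - y) * fls_X powi X.coeff_exponent (k - s) (s - 1) x y * X.kernA x y (int L) (2 * int L))
        = fps_to_fls (fps_const (c v) * fps_X ^ nat (E v) * fps_kern (int L) v)"
      proof (cases "c v = 0")
        case True
        then show ?thesis
          unfolding v case_prod_conv chi[unfolded v] by simp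
      next
        case False
        then have "X.coeff_exponent (k - s) (s - 1) x y = E v" "E v \<ge> 0"
          using coeff_exponent_eq[of x y s k] s adm by (auto simp: v c_def E_def admissible_def)
        then show ?thesis
          unfolding v case_prod_conv chi[unfolded v] kernA_fls
          by (simp only: powi_fls_X fls_times_fps_to_fls)
      qed
    qed
    finally show ?thesis
      by (simp add: fps_to_fls_sum[symmetric])
  qed
  have 3: "fps_agree d (P ^ 5 * T) ?\<Theta>"
  proof -
    have "fps_agree d (P ^ 5 * (fps_const (c v) * fps_X ^ nat (E v) * fps_kern (int L) v))
      (if c v \<noteq> 0 \<and> E v \<le> int d then fps_const (c v) * fps_X ^ nat (E v) else 0)" for v
    proof (cases "c v \<noteq> 0 \<and> E v \<le> int d")
      case True
      obtain x y where v: "v = (x, y)"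
        by fastforce
      have "fps_agree d (fps_kern (int L) v * P ^ 5) 1"
        unfolding P_def v using True L0[of x y] by (intro fps_kern_agree) (auto simp: v c_def E_def)
      then have "fps_agree d (fps_const (c v) * fps_X ^ nat (E v) * (fps_kern (int L) v * P ^ 5)) (fps_const (c v) * fps_X ^ nat (E v) * 1)"
        by (rule fps_agree_mult[OF fps_agree_refl])
      then show ?thesis
        using True by (simp add: mult_ac)
    next
      case False
      show ?thesis
      proof (cases "c v = 0")
        case nz: False
        with False have "d < nat (E v)"
          by linarith
        then have "fps_agree d (fps_X ^ nat (E v) * (P ^ 5 * fps_const (c v) * fps_kern (int L) v)) 0"
          by (rule fps_agree_X_power_mult_0)
        then show ?thesis
          unfolding if_not_P[OF False] by (simp add: mult_ac)
      qed simp
    qed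
    then have "fps_agree d (P ^ 5 * T) (\<Sum>v\<in>V. if c v \<noteq> 0 \<and> E v \<le> int d then fps_const (c v) * fps_X ^ nat (E v) else 0)"
      unfolding T' sum_distrib_left by (intro fps_agree_sum)
    also have "fps_agree d \<dots> (mseries c E)"
      unfolding fps_agree_def
    proof (intro allI impI)
      fix i assume i: "i \<le> d"
      have "(\<Sum>v\<in>V. if c v \<noteq> 0 \<and> E v \<le> int d then fps_const (c v) * fps_X ^ nat (E v) else 0) $ i
        = (\<Sum>v\<in>V. if c v \<noteq> 0 \<and> E v = int i then c v else 0)"
        unfolding fps_sum_nth
      proof (rule sum.cong[OF refl])
        fix v
        have "c v \<noteq> 0 \<Longrightarrow> E v \<ge> 0"
          using adm unfolding admissible_def by blast
        then show "(if c v \<noteq> 0 \<and> E v \<le> int d then fps_const (c v) * fps_X ^ nat (E v) else 0) $ i = (if c v \<noteq> 0 \<and> E v = int i then c v else 0)"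
          using i by (auto simp: fps_X_power_nth)
      qed
      also have "\<dots> = (\<Sum>v\<in>{v \<in> V. c v \<noteq> 0 \<and> E v = int i}. c v)"
        by (rule sum.inter_filter[symmetric]) (rule V)
      also have "{v \<in> V. c v \<noteq> 0 \<and> E v = int i} = {v. c v \<noteq> 0 \<and> E v = int i}"
        using i by (auto simp: V_def)
      finally show "(\<Sum>v\<in>V. if c v \<noteq> 0 \<and> E v \<le> int d then fps_const (c v) * fps_X ^ nat (E v) else 0) $ i = mseries c E $ i"
        by (simp add: mseries_def)
    qed
    finally show ?thesis
      unfolding c_def E_def .
  qed
  \<comment> \<open>Count of the factors \<open>P\<close>: one replaces the multisum by
    \<open>h 0\<close>, two replace \<open>h 0\<close> by \<open>T\<close>, and two are left over.
    Together they are the five that normalise the kernel.\<close>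
  have "fps_agree d (P ^ 2 * (\<Sum>f\<in>A. \<Sum>g\<in>B. summand k s f g)) (P ^ 2 * (P * h 0))"
    by (rule fps_agree_mult[OF fps_agree_refl 1])
  also have "fps_agree d \<dots> (P ^ 2 * (P * (P ^ 2 * T)))"
    by (intro fps_agree_mult[OF fps_agree_refl] fps_agree_sym[OF 2])
  also have "P ^ 2 * (P * (P ^ 2 * T)) = P ^ 5 * T"
    by (simp add: power_numeral_reduce mult_ac)
  also note 3
  finally show ?thesis
    by (simp add: P_def A_def B_def)
qed

lemma theta_fps_X_power:
  assumes "1 \<le> a" "a \<le> K"
  shows "theta (fps_X ^ a) (fps_X ^ K) = qinf a K * qinf (K - a) K"
proof -
  have "fps_X ^ K / fps_X ^ a = (fps_X ^ (K - a) :: rat fps)"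
  proof -
    have "fps_X ^ K = fps_X ^ (K - a) * (fps_X ^ a :: rat fps)"
      using assms by (simp add: power_add[symmetric])
    then show ?thesis
      by (metis fps_X_neq_zero nonzero_mult_div_cancel_right power_not_zero)
  qed
  then show ?thesis
    by (simp add: theta_def)
qed

text \<open>Each coefficient receives contributions from only finitely many index pairs, all inside
  one box. Convergence and value therefore follow coefficientwise from the truncated identity on a
  sufficiently large box.\<close>

theorem A2_Andrews_Gordon:
  assumes k: "k \<ge> 2" and s: "1 \<le> s" "s \<le> k"
  shows "((\<lambda>(n, m). summand k s n m)
          has_sum
            (qpoch_inf (fps_X ^ (3 * k + 1)) (fps_X ^ (3 * k + 1)) ^ 2 / qpoch_inf fps_X fps_X ^ 2
             * thetas [fps_X, fps_X ^ s, fps_X ^ (s + 1)] (fps_X ^ (3 * k + 1))))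
         (({1..k-1} \<rightarrow>\<^sub>E (UNIV :: nat set)) \<times> ({1..k-1} \<rightarrow>\<^sub>E (UNIV :: nat set)))"
proof -
  let ?K = "3 * k + 1"
  define P where "P = qinf 1 1"
  define \<Theta> where "\<Theta> = mseries (\<lambda>(x, y). chi (x - y)) (theta_exponent ?K s 1)"
  define S where "S = (\<lambda>(n, m). summand k s n m)"
  define \<Omega> where "\<Omega> = ({1..k-1} \<rightarrow>\<^sub>E (UNIV :: nat set)) \<times> ({1..k-1} \<rightarrow>\<^sub>E (UNIV :: nat set))"
  define Box where "Box L = PiE {1..k-1} (\<lambda>_. {..L}) \<times> PiE {1..k-1} (\<lambda>_. {..2*L})" for L :: nat
  have P: "inverse P * P = 1"
    unfolding P_def using qinf_nth_0[of 1 1] by (intro inverse_mult_eq_1) simp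
  have rhs: "qpoch_inf (fps_X ^ ?K) (fps_X ^ ?K) ^ 2 / qpoch_inf fps_X fps_X ^ 2
             * thetas [fps_X, fps_X ^ s, fps_X ^ (s + 1)] (fps_X ^ ?K) = inverse P ^ 2 * \<Theta>"
  proof -
    have "thetas [fps_X, fps_X ^ s, fps_X ^ (s + 1)] (fps_X ^ ?K)
      = (qinf s ?K * qinf (?K - s) ?K) * (qinf 1 ?K * qinf (?K - 1) ?K) * (qinf (s + 1) ?K * qinf (?K - (s + 1)) ?K)"
      using theta_fps_X_power[of 1 ?K] theta_fps_X_power[of s ?K] theta_fps_X_power[of "s + 1" ?K] s
      by (simp add: thetas_def mult_ac)
    then have "qpoch_inf (fps_X ^ ?K) (fps_X ^ ?K) ^ 2 * thetas [fps_X, fps_X ^ s, fps_X ^ (s + 1)] (fps_X ^ ?K) = \<Theta>"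
      unfolding \<Theta>_def using theta_product(1)[of s 1 ?K] s by simp
    moreover have "f / qpoch_inf fps_X fps_X ^ 2 = f * inverse P ^ 2" for f
      using qinf_nth_0[of 1 1] by (simp add: P_def fps_divide_unit fps_nth_power_0 fps_inverse_power)
    ultimately show ?thesis
      by (simp add: mult_ac)
  qed
  have support: "{x \<in> \<Omega>. S x $ d \<noteq> 0} \<subseteq> Box L" if "L \<ge> d + 1" for d L
  proof
    fix x assume "x \<in> {x \<in> \<Omega>. S x $ d \<noteq> 0}"
    then obtain f g where x: "x = (f, g)" and fg: "f \<in> {1..k-1} \<rightarrow>\<^sub>E UNIV" "g \<in> {1..k-1} \<rightarrow>\<^sub>E UNIV"
      and nz: "summand k s f g $ d \<noteq> 0"
      by (auto simp: \<Omega>_def S_def)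
    have "f l \<le> L" "g l \<le> 2 * L" if "l \<in> {1..k-1}" for l
      using summand_support[OF k s(1) nz that] \<open>L \<ge> d + 1\<close> by auto
    with fg show "x \<in> Box L"
      unfolding x Box_def by (auto simp: PiE_iff)
  qed
  have fin: "finite (Box L)" for L
    by (simp add: Box_def finite_PiE)
  have Box_subset: "Box L \<subseteq> \<Omega>" for L
    by (auto simp: Box_def \<Omega>_def PiE_iff)
  have "(S has_sum (inverse P ^ 2 * \<Theta>)) \<Omega>"
  proof (rule has_sum_fpsI)
    fix d
    show "finite {x \<in> \<Omega>. S x $ d \<noteq> 0}"
      using support[of d "d + 1"] fin by (rule finite_subset) simp
    define W where "W = {v. (case v of (x, y) \<Rightarrow> (chi (x - y) :: rat)) \<noteq> 0 \<and> theta_exponent ?K s 1 v \<le> int d}"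
    have "finite W"
      unfolding W_def using theta_product(2)[of s 1 ?K] k s by (simp add: admissible_def)
    then obtain M where M: "\<And>v. v \<in> W \<Longrightarrow> nat (\<bar>fst v\<bar> + \<bar>snd v\<bar>) \<le> M"
      using finite_nat_set_iff_bounded_le[of "(\<lambda>v. nat (\<bar>fst v\<bar> + \<bar>snd v\<bar>)) ` W"] by auto
    \<comment> \<open>\<open>M\<close> covers the lattice vectors of order at most \<open>d\<close>,
      for which the kernel must have reached its limit; \<open>2 d + 1\<close> ensures
      \<open>L - n_1 >= d\<close> whenever \<open>n_1 <= d + 1\<close>.\<close>
    define L where "L = M + 2 * d + 1"
    have "fps_agree d (P ^ 2 * (\<Sum>f\<in>PiE {1..k-1} (\<lambda>_. {..L}). \<Sum>g\<in>PiE {1..k-1} (\<lambda>_. {..2*L}). summand k s f g)) \<Theta>"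
      unfolding P_def \<Theta>_def
    proof (rule sum_summand_agree[OF k s])
      fix x y :: int
      assume "chi (x - y) \<noteq> (0 :: rat)" "theta_exponent ?K s 1 (x, y) \<le> int d"
      then have "nat (\<bar>x\<bar> + \<bar>y\<bar>) \<le> M"
        using M[of "(x, y)"] by (simp add: W_def)
      then show "\<bar>x\<bar> + \<bar>y\<bar> + int d \<le> int L"
        by (simp add: L_def)
    qed (simp add: L_def)
    then have "fps_agree d (P ^ 2 * sum S (Box L)) \<Theta>"
      by (simp add: S_def Box_def sum.cartesian_product)
    then have "fps_agree d (inverse P ^ 2 * (P ^ 2 * sum S (Box L))) (inverse P ^ 2 * \<Theta>)"
      by (rule fps_agree_mult[OF fps_agree_refl])
    moreover have "inverse P ^ 2 * (P ^ 2 * sum S (Box L)) = sum S (Box L)"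
      by (metis P mult.assoc mult_1_left power_mult_distrib power_one)
    ultimately have "(inverse P ^ 2 * \<Theta>) $ d = sum S (Box L) $ d"
      by (simp add: fps_agree_def)
    also have "\<dots> = (\<Sum>x | x \<in> \<Omega> \<and> S x $ d \<noteq> 0. S x $ d)"
      unfolding fps_sum_nth
    proof (rule sum.mono_neutral_right[OF fin])
      show "{x. x \<in> \<Omega> \<and> S x $ d \<noteq> 0} \<subseteq> Box L"
        using support[of d L] by (simp add: L_def)
    qed (use Box_subset in auto)
    finally show "(inverse P ^ 2 * \<Theta>) $ d = (\<Sum>x | x \<in> \<Omega> \<and> S x $ d \<noteq> 0. S x $ d)" .
  qed
  then show ?thesis
    unfolding rhs S_def \<Omega>_def .
qed

theorem theorem2p9:
  fixes k s :: nat
  assumes "k \<ge> 2" and "s \<in> {1, k - 1, k}"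
  shows "((\<lambda>(n, m).
             fps_X ^ summand_exponent k s n m / qpoch fps_X fps_X (n 1)
             * qbinom (2 * int (n (k - 1))) (int (m (k - 1)))
             * (\<Prod>i=1..k-2.
                  qbinom (int (n i)) (int (n (i + 1)))
                  * qbinom (int (n i) - int (n (i + 1)) + int (m (i + 1))) (int (m i))))
          has_sum
            (qpoch_inf (fps_X ^ (3 * k + 1)) (fps_X ^ (3 * k + 1)) ^ 2 / qpoch_inf fps_X fps_X ^ 2
             * thetas [fps_X, fps_X ^ s, fps_X ^ (s + 1)] (fps_X ^ (3 * k + 1))))
         (({1..k-1} \<rightarrow>\<^sub>E (UNIV :: nat set)) \<times> ({1..k-1} \<rightarrow>\<^sub>E (UNIV :: nat set)))"
proof -
  have "1 \<le> s" "s \<le> k"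
    using assms by auto
  from A2_Andrews_Gordon[OF assms(1) this] show ?thesis
    unfolding summand_def .
qed

end
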